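(* Let $V$ and $W$ be optimal computers, and let $f\colon\mathbb{N}^+\to\mathbb{N}$ be a total recursive function. Then the following two conditions are equivalent: (i) There exist an oracle deterministic Turing machine $M$ and $c\in\mathbb{N}$ such that, for infinitely many $n\in\mathbb{N}^+$, $M^{\mathrm{Dom}\,V\restriction n}(n)=\Omega_W\restriction(n-f(n)-c)$. (ii) The function $f$ is not bounded from above.
   Context: $\{0,1\}^*$ is the set of finite binary strings. A computer is a partial recursive function $C\colon\{0,1\}^*\to\{0,1\}^*$ whose domain $\mathrm{Dom}\,C$ is prefix-free. A computer $U$ is optimal if for every computer $C$ there is $d\in\mathbb{N}$ such that for every $p\in\mathrm{Dom}\,C$ there is $q$ with $U(q)=C(p)$ and $|q|\le|p|+d$. For an optimal computer $W$, $\Omega_W=\sum_{p\in\mathrm{Dom}\,W}2^{-|p|}$. For $S\subseteq\{0,1\}^*$ and $n\in\mathbb{Z}$, $S\restriction n=\{s\in S:|s|\le n\}$. For a real $\alpha$ and $n\in\mathbb{N}^+$, $\alpha\restriction n$ is the string of the first $n$ bits of the base-two expansion of $\alpha-\lfloor\alpha\rfloor$ (with infinitely many zeros when there is a choice); for integers $n\le0$ it is the empty string. $M^A(n)$ is the output of oracle machine $M$ on input $n$ with oracle set $A$. *)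

theory Defs
  imports "HOL-Analysis.Analysis" "HOL-Library.Sublist"
begin

type_synonym bitstring = "bool list"

text \<open>
  A machine has finitely many two-way infinite tapes over the alphabet
  \<open>{0..<alphabet M}\<close>, where \<open>0\<close> is the blank and \<open>1\<close>, \<open>2\<close> are the bits 0, 1.  Tape 0 carries
  the input and the output, tape 1 is the oracle tape, and all others are work tapes.
  The states are the positions in \<open>control M\<close>, and state 0 is initial.  An ordinary state carries
  its row of the transition function, from the scanned symbols to the next state and the
  symbol to be written and head move of each tape; only its values on the finitely many
  tuples over the alphabet matter.  A state \<open>Query y n\<close> passes to state \<open>y\<close>
  if the string on the oracle tape is in the oracle set and to state \<open>n\<close> otherwise.
\<close>

datatype move = Leftwards | Stay | Rightwards

datatype state_kind =
    Halt
  | Query nat nat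
  | Step "nat list \<Rightarrow> nat \<times> (nat \<times> move) list"

record machine =
  tapes :: nat
  alphabet :: nat
  control :: "state_kind list"

definition oracle_machine :: "machine \<Rightarrow> bool" where
  "oracle_machine M \<longleftrightarrow>
     tapes M \<ge> 2 \<and> alphabet M \<ge> 3 \<and> control M \<noteq> [] \<and>
     (\<forall>y n. Query y n \<in> set (control M) \<longrightarrow> y < length (control M) \<and> n < length (control M)) \<and>
     (\<forall>\<delta> xs. Step \<delta> \<in> set (control M) \<and> length xs = tapes M \<and> set xs \<subseteq> {0..<alphabet M} \<longrightarrow>
        fst (\<delta> xs) < length (control M) \<and> length (snd (\<delta> xs)) = tapes M \<and>
        fst ` set (snd (\<delta> xs)) \<subseteq> {0..<alphabet M})"

definition turing_machine :: "machine \<Rightarrow> bool" where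
  "turing_machine M \<longleftrightarrow> oracle_machine M \<and> (\<forall>y n. Query y n \<notin> set (control M))"

text \<open>A tape is its inscription together with the position of its head.\<close>

type_synonym tape = "(int \<Rightarrow> nat) \<times> int"
type_synonym config = "nat \<times> tape list"

fun scanned :: "tape \<Rightarrow> nat" where
  "scanned (c, h) = c h"

fun shift :: "move \<Rightarrow> int" where
  "shift Leftwards = -1"
| "shift Stay = 0"
| "shift Rightwards = 1"

fun write_move :: "nat \<times> move \<Rightarrow> tape \<Rightarrow> tape" where
  "write_move (a, d) (c, h) = (c(h := a), h + shift d)"

definition tape_of :: "bitstring \<Rightarrow> tape" where
  "tape_of x =
     ((\<lambda>i. if 0 \<le> i \<and> i < int (length x) then if x ! nat i then 2 else 1 else 0), 0)"

text \<open>The string on a tape is the maximal block of bits beginning at cell 0.\<close>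

fun string_on :: "tape \<Rightarrow> bitstring" where
  "string_on (c, h) = map (\<lambda>i. c (int i) = 2) [0..<(LEAST n. c (int n) \<notin> {1, 2})]"

definition initial :: "machine \<Rightarrow> bitstring \<Rightarrow> config" where
  "initial M x = (0, tape_of x # replicate (tapes M - 1) (tape_of []))"

fun halted :: "machine \<Rightarrow> config \<Rightarrow> bool" where
  "halted M (q, ts) \<longleftrightarrow> control M ! q = Halt"

fun step :: "machine \<Rightarrow> bitstring set \<Rightarrow> config \<Rightarrow> config" where
  "step M A (q, ts) =
     (case control M ! q of
        Halt \<Rightarrow> (q, ts)
      | Query y n \<Rightarrow> (if string_on (ts ! 1) \<in> A then y else n, ts)
      | Step \<delta> \<Rightarrow> (case \<delta> (map scanned ts) of (q', as) \<Rightarrow> (q', map2 write_move as ts)))"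

definition run :: "machine \<Rightarrow> bitstring set \<Rightarrow> bitstring \<Rightarrow> bitstring option" where
  "run M A x =
     (let conf = (\<lambda>t. (step M A ^^ t) (initial M x))
      in if \<exists>t. halted M (conf t)
         then Some (string_on (snd (conf (LEAST t. halted M (conf t))) ! 0))
         else None)"

text \<open>A Turing machine makes no queries, so the oracle passed to \<^const>\<open>run\<close> is immaterial here.\<close>

definition partial_recursive :: "(bitstring \<rightharpoonup> bitstring) \<Rightarrow> bool" where
  "partial_recursive C \<longleftrightarrow> (\<exists>M. turing_machine M \<and> (\<forall>x. run M {} x = C x))"

text \<open>Numbers are presented to machines, and returned by them, in unary.\<close>

definition unary :: "nat \<Rightarrow> bitstring" where
  "unary n = replicate n True"

text \<open>A function from the positive integers is a function on \<^typ>\<open>nat\<close> whose value at 0 is ignored.\<close>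

definition total_recursive_pos :: "(nat \<Rightarrow> nat) \<Rightarrow> bool" where
  "total_recursive_pos f \<longleftrightarrow>
     (\<exists>M. turing_machine M \<and>
        (\<forall>n\<ge>1. run M {} (unary n) = Some (unary (f n))))"

definition prefix_free :: "bitstring set \<Rightarrow> bool" where
  "prefix_free S \<longleftrightarrow> (\<forall>p\<in>S. \<forall>q\<in>S. prefix p q \<longrightarrow> p = q)"

definition computer :: "(bitstring \<rightharpoonup> bitstring) \<Rightarrow> bool" where
  "computer C \<longleftrightarrow> partial_recursive C \<and> prefix_free (dom C)"

definition optimal_computer :: "(bitstring \<rightharpoonup> bitstring) \<Rightarrow> bool" where
  "optimal_computer U \<longleftrightarrow> computer U \<and>
     (\<forall>C. computer C \<longrightarrow>
        (\<exists>d::nat. \<forall>p\<in>dom C. \<exists>q. U q = C p \<and> length q \<le> length p + d))"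

text \<open>For a computer the sum converges, by the Kraft inequality for the prefix-free set \<^term>\<open>dom W\<close>.\<close>

definition Omega :: "(bitstring \<rightharpoonup> bitstring) \<Rightarrow> real" where
  "Omega W = (\<Sum>\<^sub>\<infinity>p\<in>dom W. 2 powi (- int (length p)))"

definition restrict_length :: "bitstring set \<Rightarrow> int \<Rightarrow> bitstring set" where
  "restrict_length S n = {s \<in> S. int (length s) \<le> n}"

definition binary_expansion :: "real \<Rightarrow> nat \<Rightarrow> bool" where
  "binary_expansion \<alpha> =
     (THE b. (\<lambda>i. of_bool (b i) / 2 ^ Suc i) sums frac \<alpha> \<and> (\<exists>\<^sub>\<infinity>i. \<not> b i))"

text \<open>The defining property of \<^const>\<open>binary_expansion\<close> determines it.\<close>

lemma ex1_binary_expansion: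
  fixes \<alpha> :: real
  shows "\<exists>!b. (\<lambda>i. of_bool (b i) / 2 ^ Suc i) sums frac \<alpha> \<and> (\<exists>\<^sub>\<infinity>i. \<not> b i)"
proof -
  define x where "x = frac \<alpha>"
  have x: "0 \<le> x" "x < 1" by (simp_all add: x_def frac_lt_1)
  define b where "b i = odd \<lfloor>2 ^ Suc i * x\<rfloor>" for i
  have dbl: "\<lfloor>2 * y\<rfloor> = 2 * \<lfloor>y\<rfloor> + of_bool (odd \<lfloor>2 * y\<rfloor>)" for y :: real
  proof -
    have "\<lfloor>2 * y\<rfloor> = 2 * \<lfloor>y\<rfloor> \<or> \<lfloor>2 * y\<rfloor> = 2 * \<lfloor>y\<rfloor> + 1" by linarith
    then show ?thesis by auto
  qed
  have part: "(\<Sum>i<n. of_bool (b i) / 2 ^ Suc i) = real_of_int \<lfloor>2 ^ n * x\<rfloor> / 2 ^ n" for n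
  proof (induction n)
    case 0
    have "\<lfloor>x\<rfloor> = 0" using x by (simp add: floor_eq_iff)
    then show ?case by simp
  next
    case (Suc n)
    have "\<lfloor>2 ^ Suc n * x\<rfloor> = 2 * \<lfloor>2 ^ n * x\<rfloor> + of_bool (b n)"
      using dbl[where y = "(2::real) ^ n * x"] by (simp only: b_def power_Suc mult.assoc)
    then have "real_of_int \<lfloor>2 ^ Suc n * x\<rfloor> = 2 * real_of_int \<lfloor>2 ^ n * x\<rfloor> + of_bool (b n)"
      by simp
    then show ?case using Suc by (simp add: field_simps)
  qed
  have sums: "(\<lambda>i. of_bool (b i) / 2 ^ Suc i) sums x"
    unfolding sums_def part
  proof (rule tendsto_sandwich)
    show "\<forall>\<^sub>F n in sequentially. x - (1/2) ^ n \<le> of_int \<lfloor>2 ^ n * x\<rfloor> / 2 ^ n"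
    proof (intro always_eventually allI)
      fix n :: nat
      have "2 ^ n * x - 1 \<le> of_int \<lfloor>2 ^ n * x\<rfloor>" by linarith
      then have "(2 ^ n * x - 1) / 2 ^ n \<le> of_int \<lfloor>2 ^ n * x\<rfloor> / 2 ^ n"
        by (rule divide_right_mono) simp
      then show "x - (1/2) ^ n \<le> of_int \<lfloor>2 ^ n * x\<rfloor> / 2 ^ n"
        by (simp add: power_one_over diff_divide_distrib)
    qed
    show "\<forall>\<^sub>F n in sequentially. of_int \<lfloor>2 ^ n * x\<rfloor> / 2 ^ n \<le> x"
      by (intro always_eventually allI) (simp add: field_simps mult.commute)
    have "(\<lambda>n. (1/2::real) ^ n) \<longlonglongrightarrow> 0" by (rule LIMSEQ_realpow_zero) auto
    from tendsto_diff[OF tendsto_const this] show "(\<lambda>n. x - (1/2) ^ n) \<longlonglongrightarrow> x" by simp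
  qed auto
  have geo: "(\<lambda>i. 1 / 2 ^ Suc (i + n)) sums ((1/2::real) ^ n)" for n
    using sums_mult[OF power_half_series, of "(1/2) ^ n"]
    by (simp add: power_add power_divide mult.commute mult.left_commute)
  have inf: "\<exists>\<^sub>\<infinity>i. \<not> b i"
  proof (rule ccontr)
    assume "\<not> (\<exists>\<^sub>\<infinity>i. \<not> b i)"
    then obtain n where n: "\<And>i. i \<ge> n \<Longrightarrow> b i"
      by (auto simp: INFM_nat_le)
    have "(\<lambda>i. of_bool (b (i + n)) / 2 ^ Suc (i + n)) sums (x - of_int \<lfloor>2 ^ n * x\<rfloor> / 2 ^ n)"
      using sums_split_initial_segment[OF sums, of n] by (simp only: part)
    moreover have "(\<lambda>i. of_bool (b (i + n)) / 2 ^ Suc (i + n) :: real) = (\<lambda>i. 1 / 2 ^ Suc (i + n))"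
      using n by auto
    ultimately have "x - of_int \<lfloor>2 ^ n * x\<rfloor> / 2 ^ n = (1/2) ^ n"
      using geo[of n] sums_unique2 by metis
    then have "2 ^ n * x = of_int \<lfloor>2 ^ n * x\<rfloor> + 1"
      by (simp add: divide_simps split: if_splits) (simp add: algebra_simps)
    then show False by linarith
  qed
  have uniq: "b' = b''"
    if b': "(\<lambda>i. of_bool (b' i) / 2 ^ Suc i) sums x" "\<exists>\<^sub>\<infinity>i. \<not> b' i"
      and b'': "(\<lambda>i. of_bool (b'' i) / 2 ^ Suc i) sums x" "\<exists>\<^sub>\<infinity>i. \<not> b'' i"
    for b' b'' :: "nat \<Rightarrow> bool"
  proof (rule ccontr)
    assume "b' \<noteq> b''"
    have less: False
      if c: "(\<lambda>i. of_bool (c i) / 2 ^ Suc i) sums x" "\<exists>\<^sub>\<infinity>i. \<not> c i"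
        and c': "(\<lambda>i. of_bool (c' i) / 2 ^ Suc i) sums x"
        and eq: "\<And>i. i < n \<Longrightarrow> c i = c' i" and ne: "\<not> c n" "c' n"
      for c c' :: "nat \<Rightarrow> bool" and n
    proof -
      let ?s = "\<Sum>i<n. of_bool (c i) / 2 ^ Suc i :: real"
      have s': "(\<Sum>i<n. of_bool (c' i) / 2 ^ Suc i :: real) = ?s"
        using eq by (intro sum.cong) auto
      have t: "(\<lambda>i. of_bool (c (i + Suc n)) / 2 ^ Suc (i + Suc n)) sums (x - ?s)"
        using sums_split_initial_segment[OF c(1), of "Suc n"] ne by simp
      have t': "(\<lambda>i. of_bool (c' (i + Suc n)) / 2 ^ Suc (i + Suc n)) sums (x - ?s - 1 / 2 ^ Suc n)"
        using sums_split_initial_segment[OF c', of "Suc n"] ne s' by (simp add: algebra_simps)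
      have "0 \<le> x - ?s - 1 / 2 ^ Suc n"
        by (rule sums_le[OF _ sums_zero t']) auto
      moreover have "x - ?s < (1/2) ^ Suc n"
      proof -
        obtain m where m: "m > n" "\<not> c m" using c(2) by (auto simp: INFM_nat)
        define k where "k = m - Suc n"
        have k: "\<not> c (k + Suc n)" using m by (simp add: k_def)
        note d = sums_diff[OF geo[of "Suc n"] t]
        have "0 < (\<Sum>i. 1 / 2 ^ Suc (i + Suc n) - of_bool (c (i + Suc n)) / 2 ^ Suc (i + Suc n) :: real)"
        proof (rule suminf_pos2[where i = k])
          show "0 \<le> (1 / 2 ^ Suc (i + Suc n) - of_bool (c (i + Suc n)) / 2 ^ Suc (i + Suc n) :: real)" for i
            by (cases "c (i + Suc n)") simp_all
        qed (use k sums_summable[OF d] in simp_all)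
        then show ?thesis using sums_unique[OF d] by linarith
      qed
      ultimately show False by (simp add: power_divide)
    qed
    obtain n where n: "b' n \<noteq> b'' n" "\<And>i. i < n \<Longrightarrow> b' i = b'' i"
      using \<open>b' \<noteq> b''\<close> exists_least_iff[of "\<lambda>n. b' n \<noteq> b'' n"] by (auto simp: fun_eq_iff)
    show False
      using less[OF b' b''(1), of n] less[OF b'' b'(1), of n] n by auto
  qed
  show ?thesis
    unfolding x_def[symmetric] using sums inf uniq by (intro ex1I[of _ b]) blast+
qed

text \<open>\<^const>\<open>nat\<close> sends negative integers to 0, which gives the empty string for \<open>n \<le> 0\<close>.\<close>

definition first_bits :: "real \<Rightarrow> int \<Rightarrow> bitstring" where
  "first_bits \<alpha> n = map (binary_expansion \<alpha>) [0..<nat n]"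

end

theory Submission
  imports Defs "HOL-Library.Nat_Bijection"
begin

text \<open>
  Enumerate \<open>dom W\<close> as \<open>q\<^sub>0, q\<^sub>1, \<dots>\<close> and put \<open>x\<^sub>e = \<Sum>\<^sub>i\<^sub><\<^sub>e 2\<^bsup>-|q\<^sub>i|\<^esup>\<close>, so that \<open>x\<^sub>e\<close> increases to \<open>Omega W\<close>.

  Let \<open>f\<close> be bounded, and let \<open>M\<close> compute \<open>n - O(1)\<close> bits of \<open>Omega W\<close> from \<open>dom V \<restriction> n\<close> for
  infinitely many \<open>n\<close>.  If \<open>p\<close> is the last element of \<open>dom V \<restriction> n\<close> to be enumerated, then
  \<open>p\<close> and \<open>n\<close> determine \<open>dom V \<restriction> n\<close>, hence the computer \<open>T\<close> that runs \<open>M\<close> on the elements enumerated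
  up to \<open>p\<close> sends \<open>z = p 1\<^sup>i 0\<close>, where \<open>i = n - |p|\<close>, to an interval around \<open>Omega W\<close> of length
  \<open>2\<^bsup>-|z| + O(1)\<^esup>\<close>.  There are only finitely many such \<open>z\<close>, whatever \<open>T\<close> is: let \<open>v\<^sub>e\<close> be a string of
  length \<open>|q\<^sub>e| + 1\<close> whose dyadic interval lies in \<open>[x\<^sub>e, x\<^sub>e\<^sub>+\<^sub>1]\<close>, and let \<open>C (z u)\<close>, where \<open>T z u = v\<^sub>e\<close>, be
  an output that \<open>W\<close> has not yet produced when \<open>q\<^sub>e\<close> is enumerated.  As \<open>W\<close> is optimal, \<open>K\<close> such \<open>z\<close>
  force \<open>Omega W - x\<^sub>s \<ge> K 2\<^bsup>-O(1)\<^esup> (Omega W - x\<^sub>s)\<close> for all large \<open>s\<close>, which bounds \<open>K\<close>.  With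
  \<open>T (1\<^sup>n 0) = \<rho> 1\<^sup>n\<close> this also shows that \<open>Omega W\<close> is not dyadic.

  Let \<open>f\<close> be unbounded, and choose \<open>n\<^sub>k\<close> recursively with \<open>f n\<^sub>k \<ge> 2 k\<close>.  The computer that sends
  \<open>1\<^sup>k 0 r\<close>, where \<open>|r| = n\<^sub>k - f n\<^sub>k\<close>, to \<open>1\<^sup>e\<close> for some \<open>e\<close> with \<open>x\<^sub>e > 0.r\<close>, has programs of length at most
  \<open>n\<^sub>k - k + 1\<close> (if \<open>f n\<^sub>k \<le> n\<^sub>k\<close>), so for large \<open>k\<close> the outputs of \<open>V\<close> on \<open>dom V \<restriction> n\<^sub>k\<close> bound such an \<open>e\<close>
  for the first \<open>n\<^sub>k - f n\<^sub>k\<close> bits \<open>r\<close> of \<open>Omega W\<close>.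
\<close>

section \<open>Structured programs and their machine code\<close>

text \<open>Every primitive reads and changes a single tape, so the effect of a program on a tuple
  of tapes can be described tape by tape. Only \<open>Ask\<close> refers to the oracle set.\<close>

datatype prog =
    Act nat "nat \<Rightarrow> nat \<times> move"
  | Seq prog prog (infixr ";;" 60)
  | Cond nat "nat \<Rightarrow> bool" prog prog
  | While nat "nat \<Rightarrow> bool" prog
  | Ask prog prog

fun width :: "prog \<Rightarrow> nat" where
  "width (Act j g) = Suc j"
| "width (Seq p q) = max (width p) (width q)"
| "width (Cond j b p q) = max (Suc j) (max (width p) (width q))"
| "width (While j b p) = max (Suc j) (width p)"
| "width (Ask p q) = max 2 (max (width p) (width q))"

fun wf_prog :: "prog \<Rightarrow> bool" where
  "wf_prog (Act j g) \<longleftrightarrow> (\<forall>s<3. fst (g s) < 3)"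
| "wf_prog (Seq p q) \<longleftrightarrow> wf_prog p \<and> wf_prog q"
| "wf_prog (Cond j b p q) \<longleftrightarrow> wf_prog p \<and> wf_prog q"
| "wf_prog (While j b p) \<longleftrightarrow> wf_prog p"
| "wf_prog (Ask p q) \<longleftrightarrow> wf_prog p \<and> wf_prog q"

fun query_free :: "prog \<Rightarrow> bool" where
  "query_free (Act j g) \<longleftrightarrow> True"
| "query_free (Seq p q) \<longleftrightarrow> query_free p \<and> query_free q"
| "query_free (Cond j b p q) \<longleftrightarrow> query_free p \<and> query_free q"
| "query_free (While j b p) \<longleftrightarrow> query_free p"
| "query_free (Ask p q) \<longleftrightarrow> False"

text \<open>A big-step semantics records terminating executions only; divergence is treated on the
  level of machine steps, in \<open>run_assemble_diverges\<close>.\<close>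

inductive exec :: "bitstring set \<Rightarrow> prog \<Rightarrow> tape list \<Rightarrow> tape list \<Rightarrow> bool" for A where
  exec_Act: "exec A (Act j g) ts (ts[j := write_move (g (scanned (ts ! j))) (ts ! j)])"
| exec_Seq: "exec A p ts us \<Longrightarrow> exec A q us vs \<Longrightarrow> exec A (Seq p q) ts vs"
| exec_CondT: "b (scanned (ts ! j)) \<Longrightarrow> exec A p ts us \<Longrightarrow> exec A (Cond j b p q) ts us"
| exec_CondF: "\<not> b (scanned (ts ! j)) \<Longrightarrow> exec A q ts us \<Longrightarrow> exec A (Cond j b p q) ts us"
| exec_WhileF: "\<not> b (scanned (ts ! j)) \<Longrightarrow> exec A (While j b p) ts ts"
| exec_WhileT: "b (scanned (ts ! j)) \<Longrightarrow> exec A p ts us \<Longrightarrow> exec A (While j b p) us vs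
    \<Longrightarrow> exec A (While j b p) ts vs"
| exec_AskT: "string_on (ts ! 1) \<in> A \<Longrightarrow> exec A p ts us \<Longrightarrow> exec A (Ask p q) ts us"
| exec_AskF: "string_on (ts ! 1) \<notin> A \<Longrightarrow> exec A q ts us \<Longrightarrow> exec A (Ask p q) ts us"

fun psize :: "prog \<Rightarrow> nat" where
  "psize (Act j g) = 1"
| "psize (Seq p q) = psize p + psize q"
| "psize (Cond j b p q) = psize p + psize q + 2"
| "psize (While j b p) = psize p + 2"
| "psize (Ask p q) = psize p + psize q + 2"

definition idle :: "nat list \<Rightarrow> (nat \<times> move) list" where
  "idle = map (\<lambda>s. (s, Stay))"

definition goto :: "nat \<Rightarrow> state_kind" where
  "goto a = Step (\<lambda>xs. (a, idle xs))"

text \<open>\<open>code p a\<close> is the code of \<open>p\<close> loaded at address \<open>a\<close>; it is left at address \<open>a + psize p\<close>.\<close>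

fun code :: "prog \<Rightarrow> nat \<Rightarrow> state_kind list" where
  "code (Act j g) a = [Step (\<lambda>xs. (a + 1, (idle xs)[j := g (xs ! j)]))]"
| "code (Seq p q) a = code p a @ code q (a + psize p)"
| "code (Cond j b p q) a =
     Step (\<lambda>xs. (if b (xs ! j) then a + 1 else a + 2 + psize p, idle xs))
       # code p (a + 1) @ goto (a + 2 + psize p + psize q) # code q (a + 2 + psize p)"
| "code (While j b p) a =
     Step (\<lambda>xs. (if b (xs ! j) then a + 1 else a + 2 + psize p, idle xs))
       # code p (a + 1) @ [goto a]"
| "code (Ask p q) a =
     Query (a + 1) (a + 2 + psize p)
       # code p (a + 1) @ goto (a + 2 + psize p + psize q) # code q (a + 2 + psize p)"

lemma length_code [simp]: "length (code p a) = psize p"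
  by (induction p arbitrary: a) auto

lemma map2_idle: "map2 write_move (idle (map scanned ts)) ts = ts"
  by (induction ts) (auto simp: idle_def)

lemma map2_idle_update:
  "map2 write_move ((idle (map scanned ts))[j := w]) ts = ts[j := write_move w (ts ! j)]"
proof (cases "j < length ts")
  case True
  show ?thesis
  proof (rule nth_equalityI)
    fix i assume "i < length (map2 write_move ((idle (map scanned ts))[j := w]) ts)"
    then have i: "i < length ts" by (simp add: idle_def)
    obtain c h where "ts ! i = (c, h)" by (cases "ts ! i")
    with i show "map2 write_move ((idle (map scanned ts))[j := w]) ts ! i
        = ts[j := write_move w (ts ! j)] ! i"
      by (cases "i = j") (auto simp: idle_def)
  qed (simp add: idle_def)
next
  case False
  then have "(idle (map scanned ts))[j := w] = idle (map scanned ts)"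
    by (simp add: idle_def list_update_beyond)
  with False show ?thesis using map2_idle by (simp add: list_update_beyond)
qed

definition reaches :: "machine \<Rightarrow> bitstring set \<Rightarrow> config \<Rightarrow> config \<Rightarrow> bool" where
  "reaches M A c c' \<longleftrightarrow> (\<exists>t. (step M A ^^ t) c = c')"

lemma reaches_trans: "reaches M A c c' \<Longrightarrow> reaches M A c' c'' \<Longrightarrow> reaches M A c c''"
  unfolding reaches_def by (metis (no_types) comp_apply funpow_add)

lemma reaches_step: "step M A c = c' \<Longrightarrow> reaches M A c c'"
  unfolding reaches_def by (rule exI[of _ 1]) simp

definition loaded :: "machine \<Rightarrow> nat \<Rightarrow> state_kind list \<Rightarrow> bool" where
  "loaded M a ks \<longleftrightarrow> (\<forall>i<length ks. control M ! (a + i) = ks ! i)"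

lemma loaded_Cons: "loaded M a (k # ks) \<longleftrightarrow> control M ! a = k \<and> loaded M (Suc a) ks"
  unfolding loaded_def length_Cons All_less_Suc2 by simp

lemma loaded_append: "loaded M a (ks @ ls) \<longleftrightarrow> loaded M a ks \<and> loaded M (a + length ks) ls"
proof (induction ks arbitrary: a)
  case Nil
  show ?case by (simp add: loaded_def)
qed (simp add: loaded_Cons)

lemmas loaded_simps = loaded_Cons loaded_append

lemma exec_length: "exec A p ts us \<Longrightarrow> length us = length ts"
  by (induction rule: exec.induct) auto

lemma step_scan:
  assumes "control M ! q = Step (\<lambda>xs. (if b (xs ! j) then m else n, idle xs))" "j < length ts"
  shows "step M A (q, ts) = (if b (scanned (ts ! j)) then m else n, ts)"
  using assms map2_idle by simp

lemma step_goto: "control M ! q = goto a \<Longrightarrow> step M A (q, ts) = (a, ts)"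
  using map2_idle by (simp add: goto_def)

text \<open>The compiled jumps are absolute, so the induction on the execution is for all load
  addresses. For \<open>While\<close> the jump back leads to the same address, where the second
  induction hypothesis applies to the loop itself.\<close>

lemma exec_reaches:
  assumes "exec A p ts us" "loaded M a (code p a)" "width p \<le> length ts"
  shows "reaches M A (a, ts) (a + psize p, us)"
  using assms
proof (induction arbitrary: a rule: exec.induct)
  case (exec_Act j g ts)
  then show ?case
    by (intro reaches_step) (simp add: loaded_Cons map2_idle_update)
next
  case (exec_Seq p ts us q vs)
  have "reaches M A (a, ts) (a + psize p, us)"
    using exec_Seq.prems by (intro exec_Seq.IH(1)) (auto simp: loaded_simps)
  moreover have "reaches M A (a + psize p, us) (a + psize p + psize q, vs)"
    using exec_Seq.prems exec_length[OF exec_Seq.hyps(1)]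
    by (intro exec_Seq.IH(2)) (auto simp: loaded_simps)
  ultimately have "reaches M A (a, ts) (a + psize p + psize q, vs)"
    by (rule reaches_trans)
  then show ?case by (simp add: add.assoc)
next
  case (exec_CondT b ts j p us q)
  have "reaches M A (a, ts) (a + 1, ts)"
    using exec_CondT by (intro reaches_step) (subst step_scan[where b = b and j = j], auto simp: loaded_simps)
  moreover have "reaches M A (a + 1, ts) (a + 1 + psize p, us)"
    using exec_CondT.prems by (intro exec_CondT.IH) (auto simp: loaded_simps)
  moreover have "reaches M A (a + 1 + psize p, us) (a + 2 + psize p + psize q, us)"
    using exec_CondT.prems by (intro reaches_step step_goto) (auto simp: loaded_simps)
  ultimately have "reaches M A (a, ts) (a + 2 + psize p + psize q, us)"
    by (blast intro: reaches_trans)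
  then show ?case by (simp add: ac_simps)
next
  case (exec_CondF b ts j q us p)
  have "reaches M A (a, ts) (a + 2 + psize p, ts)"
    using exec_CondF by (intro reaches_step) (subst step_scan[where b = b and j = j], auto simp: loaded_simps)
  moreover have "reaches M A (a + 2 + psize p, ts) (a + 2 + psize p + psize q, us)"
    using exec_CondF by (intro exec_CondF.IH) (auto simp: loaded_simps)
  ultimately have "reaches M A (a, ts) (a + 2 + psize p + psize q, us)"
    by (blast intro: reaches_trans)
  then show ?case by (simp add: ac_simps)
next
  case (exec_WhileF b ts j p)
  then show ?case
    by (intro reaches_step) (subst step_scan[where b = b and j = j], auto simp: loaded_simps)
next
  case (exec_WhileT b ts j p us vs)
  have "reaches M A (a, ts) (a + 1, ts)"
    using exec_WhileT by (intro reaches_step) (subst step_scan[where b = b and j = j], auto simp: loaded_simps)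
  moreover have "reaches M A (a + 1, ts) (a + 1 + psize p, us)"
    using exec_WhileT.prems by (intro exec_WhileT.IH(1)) (auto simp: loaded_simps)
  moreover have "reaches M A (a + 1 + psize p, us) (a, us)"
    using exec_WhileT.prems by (intro reaches_step step_goto) (auto simp: loaded_simps)
  moreover have "reaches M A (a, us) (a + psize (While j b p), vs)"
    using exec_WhileT.prems exec_length[OF exec_WhileT.hyps(2)] by (intro exec_WhileT.IH(2)) auto
  ultimately show ?case
    by (blast intro: reaches_trans)
next
  case (exec_AskT ts p us q)
  have "reaches M A (a, ts) (a + 1, ts)"
    using exec_AskT by (intro reaches_step) (auto simp: loaded_simps)
  moreover have "reaches M A (a + 1, ts) (a + 1 + psize p, us)"
    using exec_AskT.prems by (intro exec_AskT.IH) (auto simp: loaded_simps)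
  moreover have "reaches M A (a + 1 + psize p, us) (a + 2 + psize p + psize q, us)"
    using exec_AskT.prems by (intro reaches_step step_goto) (auto simp: loaded_simps)
  ultimately have "reaches M A (a, ts) (a + 2 + psize p + psize q, us)"
    by (blast intro: reaches_trans)
  then show ?case by (simp add: ac_simps)
next
  case (exec_AskF ts q us p)
  have "reaches M A (a, ts) (a + 2 + psize p, ts)"
    using exec_AskF by (intro reaches_step) (auto simp: loaded_simps)
  moreover have "reaches M A (a + 2 + psize p, ts) (a + 2 + psize p + psize q, us)"
    using exec_AskF by (intro exec_AskF.IH) (auto simp: loaded_simps)
  ultimately have "reaches M A (a, ts) (a + 2 + psize p + psize q, us)"
    by (blast intro: reaches_trans)
  then show ?case by (simp add: ac_simps)
qed

definition assemble :: "nat \<Rightarrow> prog \<Rightarrow> machine" where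
  "assemble k p = \<lparr>tapes = k, alphabet = 3, control = code p 0 @ [Halt]\<rparr>"

lemma idle_wf:
  "length (idle xs) = length xs" "fst ` set (idle xs) = set xs"
  by (auto simp: idle_def image_image)

text \<open>The bounds are not strict: control may pass to the address just behind the code, where
  \<open>assemble\<close> puts \<open>Halt\<close>.\<close>

lemma code_Query: "Query y n \<in> set (code p a) \<Longrightarrow> y \<le> a + psize p \<and> n \<le> a + psize p \<and> \<not> query_free p"
  by (induction p arbitrary: a) (fastforce simp: goto_def)+

lemma code_Step:
  assumes "Step \<delta> \<in> set (code p a)" "wf_prog p" "width p \<le> length xs" "set xs \<subseteq> {0..<3}"
  shows "fst (\<delta> xs) \<le> a + psize p \<and> length (snd (\<delta> xs)) = length xs
    \<and> fst ` set (snd (\<delta> xs)) \<subseteq> {0..<3}"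
  using assms
proof (induction p arbitrary: a)
  case (Act j g)
  have "xs ! j < 3" using Act.prems by (auto simp: subset_iff)
  then have "fst (g (xs ! j)) < 3" using Act.prems by simp
  moreover have "set ((idle xs)[j := g (xs ! j)]) \<subseteq> insert (g (xs ! j)) (set (idle xs))"
    by (rule set_update_subset_insert)
  then have "fst ` set ((idle xs)[j := g (xs ! j)]) \<subseteq> fst ` insert (g (xs ! j)) (set (idle xs))"
    by (rule image_mono)
  ultimately have "fst ` set ((idle xs)[j := g (xs ! j)]) \<subseteq> {0..<3}"
    using Act.prems by (auto simp: idle_wf)
  then show ?case using Act.prems by (auto simp: idle_wf)
next
  case (Seq p q)
  then show ?case by (fastforce simp: add.assoc)
next
  case (Cond j b p q)
  then consider "\<delta> = (\<lambda>xs. (if b (xs ! j) then a + 1 else a + 2 + psize p, idle xs))"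
    | "Step \<delta> \<in> set (code p (a + 1))" | "Step \<delta> = goto (a + 2 + psize p + psize q)"
    | "Step \<delta> \<in> set (code q (a + 2 + psize p))" by auto
  then show ?case
  proof cases
    case 2 then show ?thesis using Cond.IH(1)[OF 2] Cond.prems by auto
  next
    case 4 then show ?thesis using Cond.IH(2)[OF 4] Cond.prems by auto
  qed (use Cond.prems in \<open>auto simp: idle_wf goto_def\<close>)
next
  case (While j b p)
  then consider "\<delta> = (\<lambda>xs. (if b (xs ! j) then a + 1 else a + 2 + psize p, idle xs))"
    | "Step \<delta> \<in> set (code p (a + 1))" | "Step \<delta> = goto a" by auto
  then show ?case
  proof cases
    case 2 then show ?thesis using While.IH[OF 2] While.prems by auto
  qed (use While.prems in \<open>auto simp: idle_wf goto_def\<close>)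
next
  case (Ask p q)
  then consider 
     "Step \<delta> \<in> set (code p (a + 1))" | "Step \<delta> = goto (a + 2 + psize p + psize q)"
    | "Step \<delta> \<in> set (code q (a + 2 + psize p))" by auto
  then show ?case
  proof cases
    case 1 then show ?thesis using Ask.IH(1)[OF 1] Ask.prems by auto
  next
    case 3 then show ?thesis using Ask.IH(2)[OF 3] Ask.prems by auto
  qed (use Ask.prems in \<open>auto simp: idle_wf goto_def\<close>)
qed

lemma oracle_machine_assemble:
  assumes "wf_prog p" "width p \<le> k" "k \<ge> 2"
  shows "oracle_machine (assemble k p)"
  unfolding oracle_machine_def assemble_def
  using assms code_Query[of _ _ p 0] code_Step[of _ p 0] by (auto simp: le_imp_less_Suc)

lemma turing_machine_assemble:
  assumes "wf_prog p" "width p \<le> k" "k \<ge> 2" "query_free p"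
  shows "turing_machine (assemble k p)"
  unfolding turing_machine_def
  using oracle_machine_assemble[OF assms(1-3)] assms(4) code_Query[of _ _ p 0]
  by (auto simp: assemble_def)

lemma loaded_assemble: "loaded (assemble k p) 0 (code p 0)"
  "control (assemble k p) ! psize p = Halt"
  by (auto simp: assemble_def loaded_def nth_append)

lemma halted_stays: "halted M c \<Longrightarrow> (step M A ^^ t) c = c"
proof (induction t)
  case (Suc t)
  then show ?case by (cases c) simp
qed simp

lemma funpow_split: "i \<le> j \<Longrightarrow> (f ^^ j) x = (f ^^ (j - i)) ((f ^^ i) x)"
  using funpow_add[of "j - i" i f] by simp

text \<open>A halted configuration is a fixed point of \<open>step\<close>, so any halting time
  shows the same tapes as the least one, at which \<open>run\<close> reads the output.\<close>

lemma run_Some_reaches: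
  assumes "reaches M A (initial M x) (q, ts)" "control M ! q = Halt"
  shows "run M A x = Some (string_on (ts ! 0))"
proof -
  let ?c = "\<lambda>t. (step M A ^^ t) (initial M x)"
  obtain t where t: "?c t = (q, ts)" using assms(1) by (auto simp: reaches_def)
  then have h: "halted M (?c t)" using assms(2) by simp
  define l where "l = (LEAST t. halted M (?c t))"
  have l: "halted M (?c l)" "l \<le> t"
    unfolding l_def by (rule LeastI[of "\<lambda>t. halted M (?c t)", OF h], rule Least_le[of "\<lambda>t. halted M (?c t)", OF h])
  have "?c t = (step M A ^^ (t - l)) (?c l)"
    using l(2) by (rule funpow_split)
  then have "?c l = (q, ts)" using t halted_stays[OF l(1)] by simp
  then show ?thesis
    using h unfolding run_def Let_def l_def[symmetric] by auto
qed

lemma run_None: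
  assumes "\<And>i. \<exists>t\<ge>i. \<not> halted M ((step M A ^^ t) (initial M x))"
  shows "run M A x = None"
proof -
  let ?c = "\<lambda>t. (step M A ^^ t) (initial M x)"
  have "\<not> halted M (?c t)" for t
  proof
    assume h: "halted M (?c t)"
    obtain u where u: "u \<ge> t" "\<not> halted M (?c u)" using assms by blast
    have "?c u = (step M A ^^ (u - t)) (?c t)"
      using u(1) by (rule funpow_split)
    with u(2) h halted_stays[OF h] show False by simp
  qed
  then show ?thesis by (simp add: run_def)
qed

lemma initial_assemble:
  "k \<ge> 2 \<Longrightarrow> initial (assemble k p) x = (0, tape_of x # tape_of [] # replicate (k - 2) (tape_of []))"
proof -
  assume "k \<ge> 2"
  then obtain j where "k = 2 + j" using le_Suc_ex by blast
  then show ?thesis by (simp add: initial_def assemble_def)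
qed

lemma run_assemble:
  assumes "exec A p (tape_of x # tape_of [] # replicate (k - 2) (tape_of [])) ts"
    and "width p \<le> k" "k \<ge> 2"
  shows "run (assemble k p) A x = Some (string_on (ts ! 0))"
proof (rule run_Some_reaches)
  show "reaches (assemble k p) A (initial (assemble k p) x) (0 + psize p, ts)"
    unfolding initial_assemble[OF assms(3)]
    using assms by (intro exec_reaches loaded_assemble) auto
qed (use loaded_assemble in simp)

text \<open>Each round of the loop costs at least the step of its test. Hence the
  \<open>i\<close>-th visit to the loop head, which is not a halting state, happens at time
  \<open>i\<close> or later.\<close>

lemma run_assemble_diverges:
  assumes p: "exec A p (tape_of x # tape_of [] # replicate (k - 2) (tape_of [])) (us 0)"
    and test: "\<And>i. b (scanned (us i ! j))"
    and body: "\<And>i. exec A q (us i) (us (Suc i))"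
    and k: "width (p ;; While j b q ;; r) \<le> k" "k \<ge> 2"
  shows "run (assemble k (p ;; While j b q ;; r)) A x = None"
proof (rule run_None)
  fix i
  let ?M = "assemble k (p ;; While j b q ;; r)" and ?a = "psize p"
  have ld: "loaded ?M 0 (code (p ;; While j b q ;; r) 0)" by (rule loaded_assemble)
  have len: "length (us i) = k" for i
  proof (induction i)
    case 0
    show ?case using exec_length[OF p] k by simp
  next
    case (Suc i)
    then show ?case using exec_length[OF body[of i]] by simp
  qed
  have "\<exists>t\<ge>i. (step ?M A ^^ t) (initial ?M x) = (?a, us i)"
  proof (induction i)
    case 0
    have "reaches ?M A (0, tape_of x # tape_of [] # replicate (k - 2) (tape_of [])) (0 + ?a, us 0)"
      using p ld k by (intro exec_reaches) (auto simp: loaded_simps)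
    then show ?case
      using k by (auto simp: reaches_def initial_assemble)
  next
    case (Suc i)
    then obtain t where t: "t \<ge> i" "(step ?M A ^^ t) (initial ?M x) = (?a, us i)" by blast
    have 1: "step ?M A (?a, us i) = (?a + 1, us i)"
      using ld test[of i] len[of i] k
      by (subst step_scan[where b = b and j = j]) (auto simp: loaded_simps)
    have "reaches ?M A (?a + 1, us i) (?a + 1 + psize q, us (Suc i))"
      using ld len[of i] k body by (intro exec_reaches) (auto simp: loaded_simps)
    moreover have "reaches ?M A (?a + 1 + psize q, us (Suc i)) (?a, us (Suc i))"
      using ld by (intro reaches_step step_goto) (auto simp: loaded_simps)
    ultimately have "reaches ?M A (?a + 1, us i) (?a, us (Suc i))"
      by (rule reaches_trans)
    then obtain u where "(step ?M A ^^ u) (?a + 1, us i) = (?a, us (Suc i))"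
      by (auto simp: reaches_def)
    moreover have "(step ?M A ^^ Suc t) (initial ?M x) = (?a + 1, us i)"
      using t(2) 1 by (simp only: funpow.simps comp_apply)
    ultimately have "(step ?M A ^^ (u + Suc t)) (initial ?M x) = (?a, us (Suc i))"
      by (simp only: funpow_add comp_apply)
    then show ?case using t(1) by (intro exI[of _ "u + Suc t"]) auto
  qed
  then obtain t where "t \<ge> i" "(step ?M A ^^ t) (initial ?M x) = (?a, us i)" by blast
  moreover have "control ?M ! ?a \<noteq> Halt" using ld by (auto simp: loaded_simps)
  ultimately show "\<exists>t\<ge>i. \<not> halted ?M ((step ?M A ^^ t) (initial ?M x))"
    by (intro exI[of _ t]) simp
qed

section \<open>Registers\<close>

definition reg_tape :: "nat \<Rightarrow> tape" where
  "reg_tape v = ((\<lambda>i. if i = 0 then 1 else 0), int v)"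

text \<open>
  A register holds the distance of a head from the only marked cell of its tape.  Programs act on
  an input/output tape, an oracle tape, and infinitely many registers, of which any tuple of
  tapes that is wide enough carries an initial segment.
\<close>

type_synonym state = "tape \<times> tape \<times> (nat \<Rightarrow> nat)"

fun layout :: "nat \<Rightarrow> state \<Rightarrow> tape list" where
  "layout N (io, oc, R) = io # oc # map (\<lambda>r. reg_tape (R r)) [0..<N]"

text \<open>The quantifier over \<open>N\<close> lets programs be composed before the number of
  registers is fixed; \<open>search_machine\<close> chooses it at the end.\<close>

definition sexec :: "bitstring set \<Rightarrow> prog \<Rightarrow> state \<Rightarrow> state \<Rightarrow> bool" where
  "sexec A p s s' \<longleftrightarrow> (\<forall>N. width p \<le> N + 2 \<longrightarrow> exec A p (layout N s) (layout N s'))"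

fun scan :: "nat \<Rightarrow> state \<Rightarrow> nat" where
  "scan j (io, oc, R) =
     (if j = 0 then scanned io else if j = 1 then scanned oc else of_bool (R (j - 2) = 0))"

lemma scanned_layout: "j < N + 2 \<Longrightarrow> scanned (layout N s ! j) = scan j s"
  by (cases s) (auto simp: nth_Cons reg_tape_def split: nat.splits)

lemma sexec_Seq: "sexec A p s s' \<Longrightarrow> sexec A q s' s'' \<Longrightarrow> sexec A (p ;; q) s s''"
  unfolding sexec_def by (auto intro: exec.intros)

lemma sexec_Cond:
  "sexec A (if b (scan j s) then p else q) s s' \<Longrightarrow> sexec A (Cond j b p q) s s'"
  unfolding sexec_def
  by (cases "b (scan j s)") (auto intro: exec_CondT exec_CondF simp: scanned_layout)

lemma sexec_Ask:
  assumes "sexec A (if string_on oc \<in> A then p else q) (io, oc, R) s'"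
  shows "sexec A (Ask p q) (io, oc, R) s'"
  using assms unfolding sexec_def
  by (cases "string_on oc \<in> A") (auto intro: exec_AskT exec_AskF)

text \<open>A loop is described by the sequence \<open>S\<close> of states at its head. The
  executions are assembled from the last round backwards, as \<open>exec_WhileT\<close>
  requires.\<close>

lemma sexec_While:
  assumes "\<And>i. i < n \<Longrightarrow> b (scan j (S i)) \<and> sexec A p (S i) (S (Suc i))" "\<not> b (scan j (S n))"
  shows "sexec A (While j b p) (S 0) (S n)"
  unfolding sexec_def
proof (intro allI impI)
  fix N assume N: "width (While j b p) \<le> N + 2"
  have "i \<le> n \<Longrightarrow> exec A (While j b p) (layout N (S i)) (layout N (S n))" for i
  proof (induction "n - i" arbitrary: i)
    case 0
    then show ?case using assms(2) N by (auto intro!: exec_WhileF simp: scanned_layout)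
  next
    case (Suc k)
    then have "i < n" by simp
    show ?case
    proof (rule exec_WhileT)
      show "b (scanned (layout N (S i) ! j))"
        using \<open>i < n\<close> assms(1) N by (simp add: scanned_layout)
      show "exec A p (layout N (S i)) (layout N (S (Suc i)))"
        using \<open>i < n\<close> assms(1) N by (simp add: sexec_def)
      show "exec A (While j b p) (layout N (S (Suc i))) (layout N (S n))"
        using Suc.hyps \<open>i < n\<close> by simp
    qed
  qed
  then show "exec A (While j b p) (layout N (S 0)) (layout N (S n))" by simp
qed

lemma sexec_io: "sexec A (Act 0 g) (io, oc, R) (write_move (g (scanned io)) io, oc, R)"
  unfolding sexec_def
proof (intro allI impI)
  fix N
  show "exec A (Act 0 g) (layout N (io, oc, R)) (layout N (write_move (g (scanned io)) io, oc, R))"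
    using exec_Act[of A 0 g "layout N (io, oc, R)"] by simp
qed

lemma sexec_oc: "sexec A (Act 1 g) (io, oc, R) (io, write_move (g (scanned oc)) oc, R)"
  unfolding sexec_def
proof (intro allI impI)
  fix N
  show "exec A (Act 1 g) (layout N (io, oc, R)) (layout N (io, write_move (g (scanned oc)) oc, R))"
    using exec_Act[of A 1 g "layout N (io, oc, R)"] by simp
qed

definition Inc :: "nat \<Rightarrow> prog" where
  "Inc r = Act (r + 2) (\<lambda>s. (s, Rightwards))"

text \<open>The head does not move past the mark, so this is truncated subtraction.\<close>

definition Dec :: "nat \<Rightarrow> prog" where
  "Dec r = Act (r + 2) (\<lambda>s. (s, if s = 1 then Stay else Leftwards))"

lemma sexec_reg:
  assumes "write_move (g (of_bool (R r = 0))) (reg_tape (R r)) = reg_tape v"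
  shows "sexec A (Act (r + 2) g) (io, oc, R) (io, oc, R(r := v))"
  unfolding sexec_def
proof (intro allI impI)
  fix N assume "width (Act (r + 2) g) \<le> N + 2"
  then have r: "r < N" by simp
  have s: "scanned (reg_tape v) = of_bool (v = 0)" for v by (simp add: reg_tape_def)
  have "(layout N (io, oc, R))[r + 2 := reg_tape v] = layout N (io, oc, R(r := v))"
    using r by (auto intro!: nth_equalityI simp: nth_list_update)
  with exec_Act[of A "r + 2" g "layout N (io, oc, R)"] assms r
  show "exec A (Act (r + 2) g) (layout N (io, oc, R)) (layout N (io, oc, R(r := v)))"
    by (simp add: s del: write_move.simps)
qed

lemma sexec_Inc: "sexec A (Inc r) (io, oc, R) (io, oc, R(r := Suc (R r)))"
  unfolding Inc_def by (rule sexec_reg) (auto simp: reg_tape_def fun_eq_iff)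

lemma sexec_Dec: "sexec A (Dec r) (io, oc, R) (io, oc, R(r := R r - 1))"
  unfolding Dec_def by (rule sexec_reg) (auto simp: reg_tape_def fun_eq_iff)

text \<open>The symbol 1 is the mark; it is scanned exactly when the register is 0.\<close>

definition Loop :: "nat \<Rightarrow> prog \<Rightarrow> prog" where
  "Loop r p = While (r + 2) (\<lambda>s. s \<noteq> 1) p"

definition If_nz :: "nat \<Rightarrow> prog \<Rightarrow> prog \<Rightarrow> prog" where
  "If_nz r p q = Cond (r + 2) (\<lambda>s. s \<noteq> 1) p q"

lemma sexec_Loop:
  assumes "\<And>i. i < n \<Longrightarrow> snd (snd (S i)) r \<noteq> 0 \<and> sexec A p (S i) (S (Suc i))"
    and "snd (snd (S n)) r = 0"
  shows "sexec A (Loop r p) (S 0) (S n)"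
proof -
  have "scan (r + 2) s \<noteq> 1 \<longleftrightarrow> snd (snd s) r \<noteq> 0" for s
    by (cases s) simp
  with assms show ?thesis unfolding Loop_def by (intro sexec_While) auto
qed

lemma sexec_If_nz:
  "sexec A (if R r \<noteq> 0 then p else q) (io, oc, R) s' \<Longrightarrow> sexec A (If_nz r p q) (io, oc, R) s'"
  unfolding If_nz_def by (rule sexec_Cond) (auto split: if_splits)

definition admissible :: "prog \<Rightarrow> bool" where
  "admissible p \<longleftrightarrow> wf_prog p \<and> query_free p"

lemma admissible_simps [simp]:
  "admissible (p ;; q) \<longleftrightarrow> admissible p \<and> admissible q"
  "admissible (Inc r)" "admissible (Dec r)"
  "admissible (Loop r p) \<longleftrightarrow> admissible p"
  "admissible (If_nz r p q) \<longleftrightarrow> admissible p \<and> admissible q"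
  "admissible (While j b p) \<longleftrightarrow> admissible p"
  "admissible (Cond j b p q) \<longleftrightarrow> admissible p \<and> admissible q"
  by (auto simp: admissible_def Inc_def Dec_def Loop_def If_nz_def)

definition rexec :: "prog \<Rightarrow> (nat \<Rightarrow> nat) \<Rightarrow> (nat \<Rightarrow> nat) \<Rightarrow> bool" where
  "rexec p R R' \<longleftrightarrow> (\<forall>A io oc. sexec A p (io, oc, R) (io, oc, R'))"

lemma rexec_Inc: "R' = R(r := Suc (R r)) \<Longrightarrow> rexec (Inc r) R R'"
  unfolding rexec_def by (blast intro: sexec_Inc)

lemma rexec_Dec: "R' = R(r := R r - 1) \<Longrightarrow> rexec (Dec r) R R'"
  unfolding rexec_def by (blast intro: sexec_Dec)

lemma rexec_Seq: "rexec p R R' \<Longrightarrow> rexec q R' R'' \<Longrightarrow> rexec (p ;; q) R R''"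
  unfolding rexec_def by (blast intro: sexec_Seq)

lemma rexec_If_nz: "rexec (if R r \<noteq> 0 then p else q) R R' \<Longrightarrow> rexec (If_nz r p q) R R'"
  unfolding rexec_def by (blast intro: sexec_If_nz)

lemma rexec_Loop:
  assumes "S 0 = R" "S n = R'"
    and "\<And>i. i < n \<Longrightarrow> S i r \<noteq> 0" "\<And>i. i < n \<Longrightarrow> rexec p (S i) (S (Suc i))"
    and "S n r = 0"
  shows "rexec (Loop r p) R R'"
  unfolding rexec_def
proof (intro allI)
  fix A io oc
  have "sexec A p (io, oc, S i) (io, oc, S (Suc i))" if "i < n" for i
    using assms(4)[OF that] unfolding rexec_def by blast
  then have "sexec A (Loop r p) (io, oc, S 0) (io, oc, S n)"
    using assms(3,5) by (intro sexec_Loop[where S = "\<lambda>i. (io, oc, S i)"]) auto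
  then show "sexec A (Loop r p) (io, oc, R) (io, oc, R')" using assms(1,2) by simp
qed

section \<open>Arithmetic and pairing on registers\<close>

definition Move :: "nat \<Rightarrow> nat \<Rightarrow> prog" where
  "Move r s = Loop r (Dec r ;; Inc s)"

lemma rexec_Move:
  assumes "r \<noteq> s" "R' = R(r := 0, s := R s + R r)"
  shows "rexec (Move r s) R R'"
  unfolding Move_def
proof (rule rexec_Loop[where S = "\<lambda>i. R(r := R r - i, s := R s + i)" and n = "R r"])
  fix i assume "i < R r"
  show "rexec (Dec r ;; Inc s) (R(r := R r - i, s := R s + i))
      (R(r := R r - Suc i, s := R s + Suc i))"
    by (rule rexec_Seq[OF rexec_Dec[OF refl] rexec_Inc]) (use assms in \<open>auto simp: fun_eq_iff\<close>)
qed (use assms in auto)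

definition Clear :: "nat \<Rightarrow> prog" where
  "Clear r = Loop r (Dec r)"

lemma rexec_Clear: "R' = R(r := 0) \<Longrightarrow> rexec (Clear r) R R'"
  unfolding Clear_def
  by (rule rexec_Loop[where S = "\<lambda>i. R(r := R r - i)" and n = "R r"])
    (auto intro!: rexec_Dec simp: fun_eq_iff)

definition Add :: "nat \<Rightarrow> nat \<Rightarrow> nat \<Rightarrow> prog" where
  "Add r s t = Loop r (Dec r ;; Inc s ;; Inc t) ;; Move t r"

lemma rexec_Add:
  assumes "distinct [r, s, t]" "R t = 0" "R' = R(s := R s + R r)"
  shows "rexec (Add r s t) R R'"
  unfolding Add_def
proof (rule rexec_Seq)
  show "rexec (Loop r (Dec r ;; Inc s ;; Inc t)) R (R(r := 0, s := R s + R r, t := R r))"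
  proof (rule rexec_Loop[where S = "\<lambda>i. R(r := R r - i, s := R s + i, t := i)" and n = "R r"])
    fix i
    show "rexec (Dec r ;; Inc s ;; Inc t) (R(r := R r - i, s := R s + i, t := i))
        (R(r := R r - Suc i, s := R s + Suc i, t := Suc i))"
      by (rule rexec_Seq[OF rexec_Dec[OF refl] rexec_Seq[OF rexec_Inc[OF refl] rexec_Inc]])
        (use assms in \<open>auto simp: fun_eq_iff\<close>)
  qed (use assms in \<open>auto simp: fun_eq_iff\<close>)
  show "rexec (Move t r) (R(r := 0, s := R s + R r, t := R r)) R'"
    using assms by (intro rexec_Move) (auto simp: fun_eq_iff)
qed

text \<open>By definition \<open>prod_encode (m, n)\<close> is \<open>triangle (m + n) + m\<close>.
  The first loop puts \<open>m\<close> into register \<open>k\<close> and \<open>m + n\<close> into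
  register \<open>k + 1\<close>; the second adds the triangle as a descending sum.\<close>

definition Encode_pair :: "nat \<Rightarrow> prog" where
  "Encode_pair k = Loop (k + 2) (Dec (k + 2) ;; Inc k ;; Inc (k + 1))
     ;; Loop (k + 1) (Add (k + 1) k (k + 2) ;; Dec (k + 1))"

lemma rexec_Encode_pair:
  assumes "R k = 0"
    and "R' = R(k := prod_encode (R (k + 2), R (k + 1)), k + 1 := 0, k + 2 := 0)"
  shows "rexec (Encode_pair k) R R'"
  unfolding Encode_pair_def
proof (rule rexec_Seq)
  let ?m = "R (k + 2)" and ?n = "R (k + 1)"
  let ?\<tau> = "R(k := ?m, k + 1 := ?m + ?n, k + 2 := 0)"
  show "rexec (Loop (k + 2) (Dec (k + 2) ;; Inc k ;; Inc (k + 1))) R ?\<tau>"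
  proof (rule rexec_Loop[where S = "\<lambda>i. R(k := i, k + 1 := i + ?n, k + 2 := ?m - i)" and n = "?m"])
    fix i
    show "rexec (Dec (k + 2) ;; Inc k ;; Inc (k + 1)) (R(k := i, k + 1 := i + ?n, k + 2 := ?m - i))
        (R(k := Suc i, k + 1 := Suc i + ?n, k + 2 := ?m - Suc i))"
      by (rule rexec_Seq[OF rexec_Dec[OF refl] rexec_Seq[OF rexec_Inc[OF refl] rexec_Inc]])
        (auto simp: fun_eq_iff)
  qed (use assms in \<open>auto simp: fun_eq_iff\<close>)
  let ?s = "?m + ?n"
  let ?S = "\<lambda>i. ?\<tau>(k := ?m + (triangle ?s - triangle (?s - i)), k + 1 := ?s - i)"
  have mono: "triangle a \<le> triangle b" if "a \<le> b" for a b
    using that by (induction b) (auto simp: le_Suc_eq)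
  show "rexec (Loop (k + 1) (Add (k + 1) k (k + 2) ;; Dec (k + 1))) ?\<tau> R'"
  proof (rule rexec_Loop[where S = ?S and n = ?s])
    fix i assume i: "i < ?s"
    then have "triangle (?s - i) = triangle (?s - Suc i) + (?s - i)"
      by (metis Suc_diff_Suc triangle_Suc)
    then have eq: "triangle ?s - triangle (?s - Suc i) = triangle ?s - triangle (?s - i) + (?s - i)"
      using mono[of "?s - i" ?s] by linarith
    show "rexec (Add (k + 1) k (k + 2) ;; Dec (k + 1)) (?S i) (?S (Suc i))"
      by (rule rexec_Seq[OF rexec_Add[OF _ _ refl] rexec_Dec]) (use eq in \<open>auto simp: fun_eq_iff\<close>)
  qed (use assms in \<open>auto simp: fun_eq_iff prod_encode_def\<close>)
qed

text \<open>Register \<open>k\<close> is counted down while the other two registers run through all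
  pairs in the order of their codes, one diagonal after the other; \<open>prod_decode_Suc\<close> is
  the successor in this order.\<close>

definition Decode_pair :: "nat \<Rightarrow> prog" where
  "Decode_pair k = Loop k (Dec k ;;
     If_nz (k + 2) (Dec (k + 2) ;; Inc (k + 1)) (Move (k + 1) (k + 2) ;; Inc (k + 2)))"

lemma prod_decode_Suc:
  "prod_decode (Suc z) = (case prod_decode z of (m, 0) \<Rightarrow> (0, Suc m) | (m, Suc n) \<Rightarrow> (Suc m, n))"
proof -
  obtain m n where z: "z = prod_encode (m, n)" by (metis prod_decode_inverse surj_pair)
  have "Suc z = prod_encode (case n of 0 \<Rightarrow> (0, Suc m) | Suc n \<Rightarrow> (Suc m, n))"
    by (auto simp: z prod_encode_def split: nat.splits)
  then show ?thesis by (auto simp: z split: nat.splits)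
qed

definition pfst :: "nat \<Rightarrow> nat" where "pfst z = fst (prod_decode z)"
definition psnd :: "nat \<Rightarrow> nat" where "psnd z = snd (prod_decode z)"

lemma pfst_pair [simp]: "pfst (prod_encode (m, n)) = m"
  and psnd_pair [simp]: "psnd (prod_encode (m, n)) = n"
  by (simp_all add: pfst_def psnd_def)

lemma pair_collapse [simp]: "prod_encode (pfst z, psnd z) = z"
  by (simp add: pfst_def psnd_def)

lemma rexec_Decode_pair:
  assumes "R (k + 1) = 0" "R (k + 2) = 0"
    and "R' = R(k := 0, k + 1 := pfst (R k), k + 2 := psnd (R k))"
  shows "rexec (Decode_pair k) R R'"
  unfolding Decode_pair_def
proof (rule rexec_Loop[where S = "\<lambda>i. R(k := R k - i, k + 1 := pfst i, k + 2 := psnd i)" and n = "R k"])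
  show "R(k := R k - 0, k + 1 := pfst 0, k + 2 := psnd 0) = R"
    using assms by (auto simp: fun_eq_iff pfst_def psnd_def prod_decode_def prod_decode_aux.simps)
  fix i assume i: "i < R k"
  let ?\<tau> = "\<lambda>i. R(k := R k - i, k + 1 := pfst i, k + 2 := psnd i)"
  have step: "rexec (if ((?\<tau> i)(k := R k - Suc i)) (k + 2) \<noteq> 0
      then Dec (k + 2) ;; Inc (k + 1) else Move (k + 1) (k + 2) ;; Inc (k + 2))
      ((?\<tau> i)(k := R k - Suc i)) (?\<tau> (Suc i))"
  proof (cases "psnd i")
    case 0
    then have "pfst (Suc i) = 0" "psnd (Suc i) = Suc (pfst i)"
      by (cases "prod_decode i", simp add: pfst_def psnd_def prod_decode_Suc)+
    with 0 show ?thesis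
      by (auto intro!: rexec_Seq[OF rexec_Move[OF _ refl] rexec_Inc] simp: fun_eq_iff)
  next
    case (Suc n)
    then have "pfst (Suc i) = Suc (pfst i)" "psnd (Suc i) = n"
      by (cases "prod_decode i", simp add: pfst_def psnd_def prod_decode_Suc)+
    with Suc show ?thesis
      by (auto intro!: rexec_Seq[OF rexec_Dec[OF refl] rexec_Inc] simp: fun_eq_iff)
  qed
  show "rexec (Dec k ;; If_nz (k + 2) (Dec (k + 2) ;; Inc (k + 1)) (Move (k + 1) (k + 2) ;; Inc (k + 2)))
      (?\<tau> i) (?\<tau> (Suc i))"
    by (rule rexec_Seq[OF rexec_Dec[OF refl]], rule rexec_If_nz)
      (use step in \<open>simp add: fun_upd_twist\<close>)
qed (use assms in \<open>auto simp: fun_eq_iff\<close>)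

section \<open>Compiling primitive recursive functions\<close>

inductive prec :: "(nat \<Rightarrow> nat) \<Rightarrow> bool" where
  prec_id: "prec (\<lambda>x. x)"
| prec_0: "prec (\<lambda>x. 0)"
| prec_Suc: "prec f \<Longrightarrow> prec (\<lambda>x. Suc (f x))"
| prec_pair: "prec f \<Longrightarrow> prec g \<Longrightarrow> prec (\<lambda>x. prod_encode (f x, g x))"
| prec_pfst: "prec f \<Longrightarrow> prec (\<lambda>x. pfst (f x))"
| prec_psnd: "prec f \<Longrightarrow> prec (\<lambda>x. psnd (f x))"
| prec_comp: "prec f \<Longrightarrow> prec g \<Longrightarrow> prec (\<lambda>x. f (g x))"
| prec_iter: "prec f \<Longrightarrow> prec (\<lambda>x. (f ^^ psnd x) (pfst x))"

text \<open>The registers above \<open>k\<close> are scratch space that is returned clean, and those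
  below \<open>k\<close> are preserved; this is what allows intermediate values to be kept in lower
  registers.\<close>

definition computes :: "nat \<Rightarrow> (nat \<Rightarrow> nat) \<Rightarrow> prog \<Rightarrow> bool" where
  "computes k f p \<longleftrightarrow> admissible p \<and>
     (\<forall>R. (\<forall>r>k. R r = 0) \<longrightarrow> rexec p R (R(k := f (R k))))"

lemma computesI:
  assumes "admissible p" "\<And>R. (\<And>r. r > k \<Longrightarrow> R r = 0) \<Longrightarrow> rexec p R (R(k := f (R k)))"
  shows "computes k f p"
  using assms by (auto simp: computes_def)

lemma computes_rexec:
  assumes "computes k f p" "\<And>r. r > k \<Longrightarrow> R r = 0" "R' = R(k := f (R k))"
  shows "rexec p R R'"
  using assms by (auto simp: computes_def)

lemma computes_admissible: "computes k f p \<Longrightarrow> admissible p"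
  by (simp add: computes_def)

lemma computes_comp: "computes k f p \<Longrightarrow> computes k g q \<Longrightarrow> computes k (\<lambda>x. f (g x)) (q ;; p)"
  by (rule computesI)
    (auto simp: computes_admissible intro!: rexec_Seq[OF computes_rexec[OF _ _ refl] computes_rexec])

text \<open>First \<open>g\<close> runs at \<open>k + 1\<close>, then \<open>f\<close> at
  \<open>k + 2\<close>, so that each finds only zeros above its own register. This explains the
  reversed order of the components in \<open>Encode_pair\<close>.\<close>

lemma computes_pair:
  assumes "computes (k + 1) g q" "computes (k + 2) f p"
  shows "computes k (\<lambda>x. prod_encode (f x, g x))
    (Add k (k + 1) (k + 2) ;; q ;; Move k (k + 2) ;; p ;; Encode_pair k)"
proof (rule computesI)
  fix R :: "nat \<Rightarrow> nat" assume z: "\<And>r. r > k \<Longrightarrow> R r = 0"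
  let ?x = "R k"
  have 1: "rexec (Add k (k + 1) (k + 2)) R (R(k + 1 := ?x))"
    by (rule rexec_Add) (auto simp: z)
  have 2: "rexec q (R(k + 1 := ?x)) (R(k + 1 := g ?x))"
    by (rule computes_rexec[OF assms(1)]) (auto simp: z)
  have 3: "rexec (Move k (k + 2)) (R(k + 1 := g ?x)) (R(k := 0, k + 1 := g ?x, k + 2 := ?x))"
    by (rule rexec_Move) (auto simp: z fun_eq_iff)
  have 4: "rexec p (R(k := 0, k + 1 := g ?x, k + 2 := ?x)) (R(k := 0, k + 1 := g ?x, k + 2 := f ?x))"
    by (rule computes_rexec[OF assms(2)]) (auto simp: z fun_eq_iff)
  have 5: "rexec (Encode_pair k) (R(k := 0, k + 1 := g ?x, k + 2 := f ?x)) (R(k := prod_encode (f ?x, g ?x)))"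
    by (rule rexec_Encode_pair) (auto simp: z fun_eq_iff)
  show "rexec (Add k (k + 1) (k + 2) ;; q ;; Move k (k + 2) ;; p ;; Encode_pair k) R
      (R(k := prod_encode (f ?x, g ?x)))"
    by (rule rexec_Seq[OF 1 rexec_Seq[OF 2 rexec_Seq[OF 3 rexec_Seq[OF 4 5]]]])
qed (use assms in \<open>auto simp: computes_admissible Add_def Move_def Encode_pair_def\<close>)

lemma computes_pfst: "computes k pfst (Decode_pair k ;; Clear (k + 2) ;; Move (k + 1) k)"
proof (rule computesI)
  fix R :: "nat \<Rightarrow> nat" assume z: "\<And>r. r > k \<Longrightarrow> R r = 0"
  show "rexec (Decode_pair k ;; Clear (k + 2) ;; Move (k + 1) k) R (R(k := pfst (R k)))"
    by (rule rexec_Seq[OF rexec_Decode_pair[OF _ _ refl] rexec_Seq[OF rexec_Clear[OF refl] rexec_Move]])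
      (auto simp: z fun_eq_iff)
qed (auto simp: Decode_pair_def Clear_def Move_def)

lemma computes_psnd: "computes k psnd (Decode_pair k ;; Clear (k + 1) ;; Move (k + 2) k)"
proof (rule computesI)
  fix R :: "nat \<Rightarrow> nat" assume z: "\<And>r. r > k \<Longrightarrow> R r = 0"
  show "rexec (Decode_pair k ;; Clear (k + 1) ;; Move (k + 2) k) R (R(k := psnd (R k)))"
    by (rule rexec_Seq[OF rexec_Decode_pair[OF _ _ refl] rexec_Seq[OF rexec_Clear[OF refl] rexec_Move]])
      (auto simp: z fun_eq_iff)
qed (auto simp: Decode_pair_def Clear_def Move_def)

lemma computes_iter:
  assumes "computes (k + 1) f p"
  shows "computes k (\<lambda>x. (f ^^ psnd x) (pfst x))
    (Decode_pair k ;; Move (k + 2) k ;; Loop k (Dec k ;; p) ;; Move (k + 1) k)"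
proof (rule computesI)
  fix R :: "nat \<Rightarrow> nat" assume z: "\<And>r. r > k \<Longrightarrow> R r = 0"
  let ?a = "pfst (R k)" and ?n = "psnd (R k)"
  have 1: "rexec (Decode_pair k) R (R(k := 0, k + 1 := ?a, k + 2 := ?n))"
    by (rule rexec_Decode_pair) (auto simp: z)
  have 2: "rexec (Move (k + 2) k) (R(k := 0, k + 1 := ?a, k + 2 := ?n)) (R(k := ?n, k + 1 := ?a))"
    by (rule rexec_Move) (auto simp: z fun_eq_iff)
  have 3: "rexec (Loop k (Dec k ;; p)) (R(k := ?n, k + 1 := ?a)) (R(k := 0, k + 1 := (f ^^ ?n) ?a))"
  proof (rule rexec_Loop[where S = "\<lambda>i. R(k := ?n - i, k + 1 := (f ^^ i) ?a)" and n = ?n])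
    fix i
    show "rexec (Dec k ;; p) (R(k := ?n - i, k + 1 := (f ^^ i) ?a))
        (R(k := ?n - Suc i, k + 1 := (f ^^ Suc i) ?a))"
      by (rule rexec_Seq[OF rexec_Dec[OF refl] computes_rexec[OF assms]]) (auto simp: z fun_eq_iff)
  qed auto
  have 4: "rexec (Move (k + 1) k) (R(k := 0, k + 1 := (f ^^ ?n) ?a)) (R(k := (f ^^ ?n) ?a))"
    by (rule rexec_Move) (auto simp: z fun_eq_iff)
  show "rexec (Decode_pair k ;; Move (k + 2) k ;; Loop k (Dec k ;; p) ;; Move (k + 1) k) R
      (R(k := (f ^^ ?n) ?a))"
    by (rule rexec_Seq[OF 1 rexec_Seq[OF 2 rexec_Seq[OF 3 4]]])
qed (use assms in \<open>auto simp: computes_admissible Decode_pair_def Move_def\<close>)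

text \<open>The induction is for all base registers at once, because \<open>computes_pair\<close>
  and \<open>computes_iter\<close> run their parts at shifted ones.\<close>

lemma prec_computes: "prec f \<Longrightarrow> \<exists>p. computes k f p"
proof (induction arbitrary: k rule: prec.induct)
  case prec_id
  have "computes k (\<lambda>x. x) (Inc k ;; Dec k)"
    by (rule computesI) (auto intro!: rexec_Seq[OF rexec_Inc[OF refl] rexec_Dec])
  then show ?case ..
next
  case prec_0
  have "computes k (\<lambda>x. 0) (Clear k)"
    by (rule computesI) (auto simp: Clear_def[symmetric] intro!: rexec_Clear, simp add: Clear_def)
  then show ?case ..
next
  case (prec_Suc f)
  have "computes k Suc (Inc k)"
    by (rule computesI) (auto intro: rexec_Inc)
  then show ?case using prec_Suc computes_comp by blast
next
  case (prec_pair f g)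
  then show ?case using computes_pair by blast
next
  case (prec_pfst f)
  then show ?case using computes_pfst computes_comp by blast
next
  case (prec_psnd f)
  then show ?case using computes_psnd computes_comp by blast
next
  case (prec_comp f g)
  then show ?case using computes_comp by blast
next
  case (prec_iter f)
  then show ?case using computes_iter by blast
qed

definition prog_for :: "(nat \<Rightarrow> nat) \<Rightarrow> nat \<Rightarrow> prog" where
  "prog_for f k = (SOME p. computes k f p)"

lemma computes_prog_for: "prec f \<Longrightarrow> computes k f (prog_for f k)"
  unfolding prog_for_def using prec_computes by (metis someI_ex)

section \<open>Primitive recursive functions\<close>

lemma prec_const: "prec (\<lambda>x. c)"
  by (induction c) (auto intro: prec_0 prec_Suc)

lemmas prec_basic = prec_id prec_const prec_Suc prec_pair prec_pfst prec_psnd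

text \<open>Recursion with parameters is obtained from iteration on triples of parameter, counter
  and current value.\<close>

lemma prec_rec:
  assumes "prec b" "prec n" "prec (\<lambda>z. s (pfst z) (pfst (psnd z)) (psnd (psnd z)))"
  shows "prec (\<lambda>x. rec_nat (b x) (\<lambda>i r. s x i r) (n x))"
proof -
  define F where "F z = prod_encode (pfst z, prod_encode (Suc (pfst (psnd z)),
    s (pfst z) (pfst (psnd z)) (psnd (psnd z))))" for z
  have F: "prec F" unfolding F_def by (intro prec_basic assms)
  have iter: "(F ^^ m) (prod_encode (x, prod_encode (0, b x)))
      = prod_encode (x, prod_encode (m, rec_nat (b x) (s x) m))" for m x
    by (induction m) (auto simp: F_def)
  have "prec (\<lambda>x. (F ^^ psnd (prod_encode (prod_encode (x, prod_encode (0, b x)), n x)))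
      (pfst (prod_encode (prod_encode (x, prod_encode (0, b x)), n x))))"
    by (rule prec_comp[OF prec_iter[OF F]]) (intro prec_basic assms)
  from prec_psnd[OF prec_psnd[OF this]] show ?thesis by (simp add: iter)
qed

lemma prec_add: "prec f \<Longrightarrow> prec g \<Longrightarrow> prec (\<lambda>x. f x + g x)"
proof -
  assume fg: "prec f" "prec g"
  have "rec_nat a (\<lambda>i r. Suc r) b = a + b" for a b by (induction b) auto
  with prec_rec[OF fg, of "\<lambda>x i r. Suc r"] show ?thesis by (simp add: prec_basic)
qed

lemma prec_pred: "prec f \<Longrightarrow> prec (\<lambda>x. f x - 1)"
proof -
  assume f: "prec f"
  have "rec_nat 0 (\<lambda>i r. i) b = b - 1" for b :: nat by (induction b) auto
  with prec_rec[OF prec_const[of 0] f, of "\<lambda>x i r. i"] show ?thesis by (simp add: prec_basic)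
qed

lemma prec_diff: "prec f \<Longrightarrow> prec g \<Longrightarrow> prec (\<lambda>x. f x - g x)"
proof -
  assume fg: "prec f" "prec g"
  have "rec_nat a (\<lambda>i r. r - 1) b = a - b" for a b :: nat by (induction b) auto
  with prec_rec[OF fg, of "\<lambda>x i r. r - 1"] show ?thesis by (simp add: prec_basic prec_pred[unfolded One_nat_def])
qed

lemma prec_mult: "prec f \<Longrightarrow> prec g \<Longrightarrow> prec (\<lambda>x. f x * g x)"
proof -
  assume fg: "prec f" "prec g"
  have "rec_nat 0 (\<lambda>i r. r + a) b = a * b" for a b :: nat by (induction b) auto
  with prec_rec[OF prec_const[of 0] fg(2), of "\<lambda>x i r. r + f x"] show ?thesis
    by (simp add: prec_basic prec_add prec_comp[OF fg(1)])
qed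

lemma prec_power: "prec f \<Longrightarrow> prec g \<Longrightarrow> prec (\<lambda>x. f x ^ g x)"
proof -
  assume fg: "prec f" "prec g"
  have "rec_nat 1 (\<lambda>i r. r * a) b = a ^ b" for a b :: nat by (induction b) auto
  with prec_rec[OF prec_const[of 1] fg(2), of "\<lambda>x i r. r * f x"] show ?thesis
    by (simp add: prec_basic prec_mult prec_comp[OF fg(1)])
qed

lemma prec_sum:
  assumes "prec n" "prec (\<lambda>z. f (pfst z) (psnd z))"
  shows "prec (\<lambda>x. \<Sum>i<n x. f x i)"
proof -
  have "rec_nat 0 (\<lambda>i r. r + f x i) m = (\<Sum>i<m. f x i)" for x m by (induction m) auto
  moreover have "prec (\<lambda>z. f (pfst z) (pfst (psnd z)))"
    using prec_comp[OF assms(2), of "\<lambda>z. prod_encode (pfst z, pfst (psnd z))"]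
    by (simp add: prec_basic)
  ultimately show ?thesis
    using prec_rec[OF prec_const[of 0] assms(1), of "\<lambda>x i r. r + f x i"]
    by (simp add: prec_basic prec_add)
qed

definition decidable :: "(nat \<Rightarrow> bool) \<Rightarrow> bool" where
  "decidable P \<longleftrightarrow> prec (\<lambda>x. of_bool (P x))"

lemma prec_of_bool: "decidable P \<Longrightarrow> prec (\<lambda>x. of_bool (P x))"
  by (simp add: decidable_def)

lemma decidable_le: "prec f \<Longrightarrow> prec g \<Longrightarrow> decidable (\<lambda>x. f x \<le> g x)"
proof -
  assume "prec f" "prec g"
  then have "prec (\<lambda>x. 1 - (f x - g x))" by (intro prec_diff prec_const)
  moreover have "(\<lambda>x. 1 - (f x - g x)) = (\<lambda>x. of_bool (f x \<le> g x))" by auto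
  ultimately show ?thesis by (simp add: decidable_def)
qed

lemma decidable_less: "prec f \<Longrightarrow> prec g \<Longrightarrow> decidable (\<lambda>x. f x < g x)"
  using decidable_le[of "\<lambda>x. Suc (f x)" g] by (simp add: prec_Suc Suc_le_eq)

lemma decidable_not: "decidable P \<Longrightarrow> decidable (\<lambda>x. \<not> P x)"
proof -
  assume "decidable P"
  then have "prec (\<lambda>x. 1 - of_bool (P x))" by (intro prec_diff prec_const prec_of_bool)
  moreover have "(\<lambda>x. 1 - of_bool (P x)) = (\<lambda>x. of_bool (\<not> P x) :: nat)" by auto
  ultimately show ?thesis by (simp add: decidable_def)
qed

lemma decidable_conj: "decidable P \<Longrightarrow> decidable Q \<Longrightarrow> decidable (\<lambda>x. P x \<and> Q x)"
  unfolding decidable_def of_bool_conj by (rule prec_mult)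

lemma decidable_disj:
  assumes "decidable P" "decidable Q"
  shows "decidable (\<lambda>x. P x \<or> Q x)"
  using decidable_not[OF decidable_conj[OF assms[THEN decidable_not]]] by simp

lemma decidable_imp:
  assumes "decidable P" "decidable Q"
  shows "decidable (\<lambda>x. P x \<longrightarrow> Q x)"
  unfolding imp_conv_disj by (intro decidable_disj decidable_not assms)

lemma decidable_eq:
  assumes "prec f" "prec g"
  shows "decidable (\<lambda>x. f x = g x)"
  unfolding eq_iff by (intro decidable_conj decidable_le assms)

lemma decidable_neq: "prec f \<Longrightarrow> prec g \<Longrightarrow> decidable (\<lambda>x. f x \<noteq> g x)"
  by (intro decidable_not decidable_eq)

lemma decidable_Ex:
  assumes "prec n" "decidable (\<lambda>z. P (pfst z) (psnd z))"
  shows "decidable (\<lambda>x. \<exists>i<n x. P x i)"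
proof -
  have eq: "0 < (\<Sum>i<m. of_bool (Q i) :: nat) \<longleftrightarrow> (\<exists>i<m. Q i)" for m :: nat and Q
    by (induction m) (auto simp: less_Suc_eq)
  have "prec (\<lambda>x. \<Sum>i<n x. of_bool (P x i))"
    using assms by (intro prec_sum) (auto simp: decidable_def)
  from decidable_less[OF prec_const[of 0] this] show ?thesis by (simp only: eq)
qed

lemma decidable_All:
  assumes "prec n" "decidable (\<lambda>z. P (pfst z) (psnd z))"
  shows "decidable (\<lambda>x. \<forall>i<n x. P x i)"
  using decidable_not[OF decidable_Ex[of n "\<lambda>x i. \<not> P x i"]] assms decidable_not by simp

lemma prec_if:
  assumes "decidable P" "prec f" "prec g"
  shows "prec (\<lambda>x. if P x then f x else g x)"
proof -
  have "prec (\<lambda>x. of_bool (P x) * f x + of_bool (\<not> P x) * g x)"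
    using assms by (intro prec_add prec_mult prec_of_bool decidable_not)
  moreover have "(\<lambda>x. of_bool (P x) * f x + of_bool (\<not> P x) * g x) = (\<lambda>x. if P x then f x else g x)"
    by auto
  ultimately show ?thesis by simp
qed

lemma prec_div: "prec f \<Longrightarrow> prec g \<Longrightarrow> prec (\<lambda>x. f x div g x)"
proof -
  assume fg: "prec f" "prec g"
  \<comment> \<open>The quotient counts the positive multiples of \<open>b\<close> up to
    \<open>a\<close>; for nonzero \<open>b\<close> their factors are at most \<open>a\<close>, which
    bounds the sum. Division by 0 gives 0.\<close>
  have eq: "a div b = (if b = 0 then 0 else \<Sum>j<a. of_bool (Suc j * b \<le> a))" for a b :: nat
  proof (cases "b = 0")
    case False
    have "Suc j \<le> a" if "Suc j * b \<le> a" for j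
      using that False mult_le_mono2[of 1 b "Suc j"] by simp
    then have "{..<a} \<inter> {j. Suc j * b \<le> a} = {..<a div b}"
      using False by (auto simp: less_eq_div_iff_mult_less_eq simp flip: Suc_le_eq)
    then show ?thesis using False by (simp add: of_bool_def flip: card_eq_sum sum.inter_filter)
        (simp add: Int_def conj_commute)
  qed simp
  have "prec (\<lambda>x. if g x = 0 then 0 else \<Sum>j<f x. of_bool (Suc j * g x \<le> f x))"
    by (intro prec_if decidable_eq prec_const fg prec_sum prec_of_bool decidable_le prec_mult
        prec_basic prec_comp[OF fg(1)] prec_comp[OF fg(2)])
  then show ?thesis by (simp add: eq)
qed

lemma prec_mod: "prec f \<Longrightarrow> prec g \<Longrightarrow> prec (\<lambda>x. f x mod g x)"
  unfolding minus_mult_div_eq_mod[symmetric] by (intro prec_diff prec_mult prec_div)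

lemmas prec_intros = prec_basic prec_add prec_diff prec_mult prec_power prec_sum prec_if
  prec_div prec_mod prec_of_bool decidable_le decidable_less decidable_eq decidable_neq
  decidable_conj decidable_disj decidable_imp decidable_not decidable_Ex decidable_All

text \<open>This is how the transition function of a machine, a finite table without further
  structure, becomes primitive recursive.\<close>

lemma prec_finite_support: "finite S \<Longrightarrow> prec (\<lambda>x. if x \<in> S then F x else 0)"
proof (induction rule: finite_induct)
  case (insert a S)
  have "prec (\<lambda>x. if x = a then F a else if x \<in> S then F x else 0)"
    by (intro prec_if decidable_eq prec_basic insert)
  moreover have "(\<lambda>x. if x = a then F a else if x \<in> S then F x else 0)
      = (\<lambda>x. if x \<in> insert a S then F x else 0)"
    using insert by auto
  ultimately show ?case by simp
qed (simp add: prec_const)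

text \<open>Bijective base two: the digits are the symbols 1 and 2 by which tapes represent bits.\<close>

fun nb :: "bitstring \<Rightarrow> nat" where
  "nb [] = 0"
| "nb (b # bs) = 2 * nb bs + 1 + of_bool b"

lemma nb_inj: "nb x = nb y \<longleftrightarrow> x = y"
proof (induction x arbitrary: y)
  case Nil
  show ?case by (cases y) auto
next
  case (Cons b x)
  show ?case
  proof (cases y)
    case Nil
    then show ?thesis by simp
  next
    case (Cons c y')
    have "2 * nb x + 1 + of_bool b = 2 * nb y' + 1 + of_bool c \<longleftrightarrow> nb x = nb y' \<and> b = c"
      by (cases b; cases c) (simp_all, presburger+)
    then show ?thesis using Cons.IH[of y'] \<open>y = c # y'\<close> by auto
  qed
qed

lemma nb_surj: "\<exists>x. nb x = n"
proof (induction n rule: less_induct)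
  case (less n)
  show ?case
  proof (cases "n = 0")
    case True
    then show ?thesis by (metis nb.simps(1))
  next
    case False
    then have "(n - 1) div 2 < n" by linarith
    with less obtain x where x: "nb x = (n - 1) div 2" by blast
    have "n = 2 * ((n - 1) div 2) + 1 + of_bool (even n)"
      using False by (cases "even n"; simp; presburger)
    then have "nb (even n # x) = n" using x by simp
    then show ?thesis by blast
  qed
qed

definition str :: "nat \<Rightarrow> bitstring" where
  "str n = (THE x. nb x = n)"

lemma nb_str [simp]: "nb (str n) = n"
proof -
  obtain x where "nb x = n" using nb_surj by blast
  then show ?thesis unfolding str_def by (intro theI[of "\<lambda>x. nb x = n"]) (auto simp flip: nb_inj)
qed

lemma str_nb [simp]: "str (nb x) = x"
  using nb_str nb_inj by blast

section \<open>Unbounded search\<close>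

definition wtape :: "bitstring \<Rightarrow> nat \<Rightarrow> tape" where
  "wtape x h = (fst (tape_of x), int h)"

lemma wtape_0: "wtape x 0 = tape_of x"
  by (simp add: wtape_def tape_of_def)

lemma tape_of_append: "fst (tape_of (x @ [b])) = (fst (tape_of x))(int (length x) := if b then 2 else 1)"
  by (auto simp: tape_of_def nth_append fun_eq_iff nat_less_iff)

lemma string_on_wtape: "string_on (wtape x h) = x"
proof -
  have "(LEAST n. fst (tape_of x) (int n) \<notin> {1, 2}) = length x"
  proof (rule Least_equality)
    show "length x \<le> n" if "fst (tape_of x) (int n) \<notin> {1, 2}" for n
      using that by (cases "n < length x"; cases "x ! n") (auto simp: tape_of_def)
  qed (simp add: tape_of_def)
  then show ?thesis
    by (auto simp: wtape_def tape_of_def intro!: nth_equalityI)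
qed

text \<open>The tape \<open>t\<close> in use is the input/output tape or the oracle tape, so that
  writing and erasing are verified once for both.\<close>

definition place :: "nat \<Rightarrow> tape \<Rightarrow> tape \<Rightarrow> (nat \<Rightarrow> nat) \<Rightarrow> state" where
  "place j t u R = (if j = 0 then (t, u, R) else (u, t, R))"

lemma sexec_place:
  assumes "j < 2" "t' = write_move (g (scanned t)) t"
  shows "sexec A (Act j g) (place j t u R) (place j t' u R)"
  using assms sexec_io[of A g] sexec_oc[of A g] by (cases "j = 0") (auto simp: place_def less_2_cases_iff)

lemma sexec_rexec: "rexec p R R' \<Longrightarrow> sexec A p (place j t u R) (place j t u R')"
  unfolding rexec_def place_def by presburger

lemma scan_place: "j < 2 \<Longrightarrow> scan j (place j t u R) = scanned t"
  by (auto simp: place_def less_2_cases_iff)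

lemma regs_place: "snd (snd (place j t u R)) = R"
  by (simp add: place_def)

lemma scanned_wtape: "scanned (wtape x h) = (if h < length x then if x ! h then 2 else 1 else 0)"
  by (simp add: wtape_def tape_of_def)

text \<open>The bits are erased from the last to the first, in the order in which \<open>nb\<close> consumes
  them; the blank cell at \<open>-1\<close> ends the sweep.\<close>

definition Sweep :: "nat \<Rightarrow> prog \<Rightarrow> prog \<Rightarrow> prog" where
  "Sweep j p q = Act j (\<lambda>s. (s, Leftwards))
     ;; While j (\<lambda>s. s \<noteq> 0) (Cond j (\<lambda>s. s = 2) p q ;; Act j (\<lambda>_. (0, Leftwards)))
     ;; Act j (\<lambda>s. (s, Rightwards))"

lemma sexec_Sweep:
  assumes j: "j < 2"
    and body: "\<And>i. i < length x \<Longrightarrow>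
      rexec (if x ! (length x - Suc i) then p else q) (\<rho> i) (\<rho> (Suc i))"
  shows "sexec A (Sweep j p q) (place j (wtape x (length x)) u (\<rho> 0))
    (place j (tape_of []) u (\<rho> (length x)))"
  unfolding Sweep_def
proof (rule sexec_Seq[OF _ sexec_Seq])
  \<comment> \<open>This is the tape when \<open>i\<close> bits have been erased. At the end the
    head stands on cell -1, and the last action brings it back to cell 0.\<close>
  define T where "T i = (fst (tape_of (take (length x - i) x)), int (length x) - int i - 1)" for i
  show "sexec A (Act j (\<lambda>s. (s, Leftwards))) (place j (wtape x (length x)) u (\<rho> 0)) (place j (T 0) u (\<rho> 0))"
    using j by (intro sexec_place) (auto simp: wtape_def T_def fun_eq_iff)
  show "sexec A (Act j (\<lambda>s. (s, Rightwards))) (place j (T (length x)) u (\<rho> (length x)))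
      (place j (tape_of []) u (\<rho> (length x)))"
    using j by (intro sexec_place) (auto simp: T_def tape_of_def fun_eq_iff)
  show "sexec A (While j (\<lambda>s. s \<noteq> 0) (Cond j (\<lambda>s. s = 2) p q ;; Act j (\<lambda>_. (0, Leftwards))))
      (place j (T 0) u (\<rho> 0)) (place j (T (length x)) u (\<rho> (length x)))"
  proof (rule sexec_While[where S = "\<lambda>i. place j (T i) u (\<rho> i)"])
    fix i assume i: "i < length x"
    define k where "k = length x - Suc i"
    let ?b = "x ! k"
    have k: "length x = Suc (k + i)" using i by (simp add: k_def)
    then have Ti: "T i = (fst (tape_of (take (Suc k) x)), int k)"
      and TSi: "T (Suc i) = (fst (tape_of (take k x)), int k - 1)"
      by (simp_all add: T_def)
    have s: "scanned (T i) = (if ?b then 2 else 1)"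
      using k by (simp add: Ti tape_of_def)
    have "take (Suc k) x = take k x @ [?b]"
      using k by (simp add: take_Suc_conv_app_nth)
    then have T: "T (Suc i) = write_move (0, Leftwards) (T i)"
      using k tape_of_append[of "take k x" ?b]
      by (auto simp: Ti TSi fun_eq_iff tape_of_def)
    have "sexec A (Cond j (\<lambda>s. s = 2) p q) (place j (T i) u (\<rho> i)) (place j (T i) u (\<rho> (Suc i)))"
      by (rule sexec_Cond) (use body[OF i, folded k_def] s j in \<open>auto simp: scan_place intro: sexec_rexec\<close>)
    moreover have "sexec A (Act j (\<lambda>_. (0, Leftwards))) (place j (T i) u (\<rho> (Suc i))) (place j (T (Suc i)) u (\<rho> (Suc i)))"
      using j T by (intro sexec_place) auto
    ultimately show "scan j (place j (T i) u (\<rho> i)) \<noteq> 0 \<and>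
        sexec A (Cond j (\<lambda>s. s = 2) p q ;; Act j (\<lambda>_. (0, Leftwards))) (place j (T i) u (\<rho> i))
          (place j (T (Suc i)) u (\<rho> (Suc i)))"
      using s j by (auto simp: scan_place intro: sexec_Seq)
  next
    show "\<not> scan j (place j (T (length x)) u (\<rho> (length x))) \<noteq> 0"
      using j by (simp add: scan_place T_def tape_of_def)
  qed
qed

text \<open>Here \<open>Inc 0 ;; Dec 0\<close> serves as the program that does nothing.\<close>

definition Erase :: "nat \<Rightarrow> prog" where
  "Erase j = Sweep j (Inc 0 ;; Dec 0) (Inc 0 ;; Dec 0)"

lemma sexec_Erase:
  "j < 2 \<Longrightarrow> sexec A (Erase j) (place j (wtape x (length x)) u R) (place j (tape_of []) u R)"
proof -
  assume j: "j < 2"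
  have "rexec (Inc 0 ;; Dec 0) R R"
    by (rule rexec_Seq[OF rexec_Inc[OF refl] rexec_Dec]) auto
  then show ?thesis
    unfolding Erase_def using j by (intro sexec_Sweep[where \<rho> = "\<lambda>_. R"]) auto
qed

definition digit :: "bool \<Rightarrow> nat \<Rightarrow> nat" where
  "digit b a = 2 * a + 1 + of_bool b"

lemma prec_digit: "prec (digit b)"
  unfolding digit_def by (intro prec_intros)

definition Read :: prog where
  "Read = While 0 (\<lambda>s. s \<noteq> 0) (Act 0 (\<lambda>s. (s, Rightwards)))
     ;; Sweep 0 (prog_for (digit True) 0) (prog_for (digit False) 0)"

lemma sexec_Read:
  assumes "\<And>r. R r = 0"
  shows "sexec A Read (tape_of x, u, R) (tape_of [], u, R(0 := nb x))"
proof -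
  have 1: "sexec A (While 0 (\<lambda>s. s \<noteq> 0) (Act 0 (\<lambda>s. (s, Rightwards)))) (place 0 (wtape x 0) u R)
      (place 0 (wtape x (length x)) u R)"
  proof (rule sexec_While[where S = "\<lambda>i. place 0 (wtape x i) u R"])
    fix i assume "i < length x"
    moreover have "sexec A (Act 0 (\<lambda>s. (s, Rightwards))) (place 0 (wtape x i) u R)
        (place 0 (wtape x (Suc i)) u R)"
      by (rule sexec_place) (auto simp: wtape_def fun_eq_iff)
    ultimately show "scan 0 (place 0 (wtape x i) u R) \<noteq> 0 \<and>
        sexec A (Act 0 (\<lambda>s. (s, Rightwards))) (place 0 (wtape x i) u R) (place 0 (wtape x (Suc i)) u R)"
      by (auto simp: scan_place scanned_wtape simp del: scanned.simps)
  qed (auto simp: scan_place scanned_wtape)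
  let ?\<rho> = "\<lambda>i. R(0 := nb (drop (length x - i) x))"
  have 2: "sexec A (Sweep 0 (prog_for (digit True) 0) (prog_for (digit False) 0))
      (place 0 (wtape x (length x)) u (?\<rho> 0)) (place 0 (tape_of []) u (?\<rho> (length x)))"
  proof (rule sexec_Sweep)
    fix i assume i: "i < length x"
    let ?b = "x ! (length x - Suc i)"
    have "drop (length x - Suc i) x = ?b # drop (length x - i) x"
      using i Cons_nth_drop_Suc[of "length x - Suc i" x] by (simp add: Suc_diff_Suc)
    then have "rexec (prog_for (digit ?b) 0) (?\<rho> i) (?\<rho> (Suc i))"
      using assms by (intro computes_rexec[OF computes_prog_for[OF prec_digit]])
        (auto simp: digit_def fun_eq_iff)
    then show "rexec (if ?b then prog_for (digit True) 0 else prog_for (digit False) 0)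
        (?\<rho> i) (?\<rho> (Suc i))"
      by (cases ?b) auto
  qed simp
  have "?\<rho> 0 = R" using assms by (simp add: fun_eq_iff)
  with sexec_Seq[OF 1] 2 show ?thesis
    unfolding Read_def by (simp add: place_def wtape_0)
qed

text \<open>The inverse of \<open>digit\<close>: the code of a nonempty string is split into the
  code of its tail and its first bit.\<close>

definition halve :: "nat \<Rightarrow> nat" where
  "halve v = prod_encode ((v - 1) div 2, (v - 1) mod 2)"

lemma prec_halve: "prec halve"
  unfolding halve_def by (intro prec_intros)

definition Write :: "nat \<Rightarrow> nat \<Rightarrow> prog" where
  "Write r j = Loop r (prog_for halve r ;; Decode_pair r
     ;; If_nz (r + 2) (Dec (r + 2) ;; Act j (\<lambda>_. (2, Rightwards))) (Act j (\<lambda>_. (1, Rightwards)))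
     ;; Move (r + 1) r)"

lemma sexec_Write:
  assumes j: "j < 2" and z: "\<And>q. q > r \<Longrightarrow> R q = 0" and y: "R r = nb y"
  shows "sexec A (Write r j) (place j (tape_of []) u R) (place j (wtape y (length y)) u (R(r := 0)))"
proof -
  let ?S = "\<lambda>i. place j (wtape (take i y) i) u (R(r := nb (drop i y)))"
  have "sexec A (Write r j) (?S 0) (?S (length y))"
    unfolding Write_def
  proof (rule sexec_Loop)
    fix i assume i: "i < length y"
    let ?b = "y ! i" and ?n = "nb (drop (Suc i) y)"
    let ?t = "wtape (take i y) i"
    have d: "nb (drop i y) = 2 * ?n + 1 + of_bool ?b"
      using i by (simp flip: Cons_nth_drop_Suc)
    have h: "halve (nb (drop i y)) = prod_encode (?n, of_bool ?b)"
      by (simp add: halve_def d)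
    have 1: "sexec A (prog_for halve r) (?S i) (place j ?t u (R(r := prod_encode (?n, of_bool ?b))))"
      by (rule sexec_rexec, rule computes_rexec[OF computes_prog_for[OF prec_halve]])
        (auto simp: z h fun_eq_iff)
    have 2: "sexec A (Decode_pair r) (place j ?t u (R(r := prod_encode (?n, of_bool ?b))))
        (place j ?t u (R(r := 0, r + 1 := ?n, r + 2 := of_bool ?b)))"
      by (rule sexec_rexec, rule rexec_Decode_pair) (auto simp: z)
    have w: "wtape (take (Suc i) y) (Suc i) = write_move (if ?b then 2 else 1, Rightwards) ?t"
      using i tape_of_append[of "take i y" ?b]
      by (auto simp: wtape_def take_Suc_conv_app_nth)
    have act: "sexec A (Act j (\<lambda>_. (if ?b then 2 else 1, Rightwards))) (place j ?t u \<tau>)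
        (place j (wtape (take (Suc i) y) (Suc i)) u \<tau>)" for \<tau>
      using j w by (intro sexec_place) auto
    have 3: "sexec A (If_nz (r + 2) (Dec (r + 2) ;; Act j (\<lambda>_. (2, Rightwards))) (Act j (\<lambda>_. (1, Rightwards))))
        (place j ?t u (R(r := 0, r + 1 := ?n, r + 2 := of_bool ?b)))
        (place j (wtape (take (Suc i) y) (Suc i)) u (R(r := 0, r + 1 := ?n)))"
    proof (cases ?b)
      case True
      have "sexec A (Dec (r + 2)) (place j ?t u (R(r := 0, r + 1 := ?n, r + 2 := of_bool ?b)))
          (place j ?t u (R(r := 0, r + 1 := ?n)))"
        using True by (intro sexec_rexec rexec_Dec) (auto simp: z fun_eq_iff)
      from sexec_Seq[OF this act] True show ?thesis
        by (auto simp: place_def intro!: sexec_If_nz split: if_splits)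
    next
      case False
      then have "R(r := 0, r + 1 := ?n, r + 2 := of_bool ?b) = R(r := 0, r + 1 := ?n)"
        by (auto simp: z fun_eq_iff)
      with act[of "R(r := 0, r + 1 := ?n)"] False show ?thesis
        by (auto simp: place_def z intro!: sexec_If_nz split: if_splits)
    qed
    have 4: "sexec A (Move (r + 1) r) (place j (wtape (take (Suc i) y) (Suc i)) u (R(r := 0, r + 1 := ?n)))
        (?S (Suc i))"
      by (rule sexec_rexec, rule rexec_Move) (auto simp: z fun_eq_iff)
    show "snd (snd (?S i)) r \<noteq> 0 \<and> sexec A (prog_for halve r ;; Decode_pair r
     ;; If_nz (r + 2) (Dec (r + 2) ;; Act j (\<lambda>_. (2, Rightwards))) (Act j (\<lambda>_. (1, Rightwards)))
     ;; Move (r + 1) r) (?S i) (?S (Suc i))"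
      using sexec_Seq[OF 1 sexec_Seq[OF 2 sexec_Seq[OF 3 4]]] d by (simp add: regs_place)
  qed (simp add: regs_place)
  moreover have "R(r := nb y) = R" using y by auto
  ultimately show ?thesis by (simp add: wtape_0)
qed

text \<open>A blank tape becomes a register holding 0 as soon as cell 0 carries the mark. The
  program \<open>Init 0\<close> has no effect.\<close>

fun Init :: "nat \<Rightarrow> prog" where
  "Init 0 = Act 0 (\<lambda>s. (s, Stay))"
| "Init (Suc r) = Init r ;; Act (r + 2) (\<lambda>_. (1, Stay))"

lemma exec_Init:
  "n \<le> N \<Longrightarrow> exec A (Init n) (io # oc # replicate N (tape_of []))
     (io # oc # map (\<lambda>r. if r < n then reg_tape 0 else tape_of []) [0..<N])"
proof (induction n)
  case 0
  have "write_move (scanned io, Stay) io = io" by (cases io) auto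
  with exec_Act[of A 0 "\<lambda>s. (s, Stay)" "io # oc # replicate N (tape_of [])"] show ?case
    by (simp add: map_replicate_const)
next
  case (Suc n)
  let ?ts = "\<lambda>n. map (\<lambda>r. if r < n then reg_tape 0 else tape_of []) [0..<N]"
  have "exec A (Act (n + 2) (\<lambda>_. (1, Stay))) (io # oc # ?ts n)
      ((io # oc # ?ts n)[n + 2 := write_move (1, Stay) ((io # oc # ?ts n) ! (n + 2))])"
    by (rule exec_Act)
  moreover have "(?ts n)[n := write_move (1, Stay) (?ts n ! n)] = ?ts (Suc n)"
    using Suc by (auto intro!: nth_equalityI simp: nth_list_update less_Suc_eq reg_tape_def
        tape_of_def fun_eq_iff)
  ultimately show ?case using Suc by (auto intro: exec_Seq)
qed

lemma width_Init: "width (Init n) \<le> n + 2"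
  by (induction n) auto

lemma admissible_Init: "admissible (Init n)"
  by (induction n) (auto simp: admissible_def)

definition Eval :: "(nat \<Rightarrow> nat) \<Rightarrow> prog" where
  "Eval S = Add 0 1 2 ;; prog_for S 1"

text \<open>
  Register 0 holds the code of \<open>(y, e)\<close> and register 1 the value of \<open>S\<close> there.  The oracle tape
  is only used by the initial part, which turns the code of the input into \<open>y\<close>.
\<close>

definition Search_init :: "prog \<Rightarrow> (nat \<Rightarrow> nat) \<Rightarrow> prog" where
  "Search_init p S = Read ;; p ;; prog_for (\<lambda>y. prod_encode (y, 0)) 0 ;; Eval S"

definition Search_next :: "(nat \<Rightarrow> nat) \<Rightarrow> prog" where
  "Search_next S = Clear 1 ;; prog_for (\<lambda>z. prod_encode (pfst z, Suc (psnd z))) 0 ;; Eval S"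

text \<open>Tape 3 is register 1, and the symbol 1 is scanned there as long as the value of
  \<open>S\<close> is 0. A value \<open>Suc a\<close> ends the search with the output
  \<open>str a\<close>, hence the \<open>Dec 1\<close>.\<close>

definition Search :: "nat \<Rightarrow> prog \<Rightarrow> (nat \<Rightarrow> nat) \<Rightarrow> prog" where
  "Search N p S = (Init N ;; Search_init p S) ;; While 3 (\<lambda>s. s = 1) (Search_next S)
     ;; Dec 1 ;; Write 1 0"

definition search_state :: "(nat \<Rightarrow> nat) \<Rightarrow> nat \<Rightarrow> nat \<Rightarrow> state" where
  "search_state S y e = (tape_of [], tape_of [],
     (\<lambda>_. 0)(0 := prod_encode (y, e), 1 := S (prod_encode (y, e))))"

lemma rexec_Eval:
  assumes "prec S"
  shows "rexec (Eval S) ((\<lambda>_. 0)(0 := z)) ((\<lambda>_. 0)(0 := z, 1 := S z))"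
  unfolding Eval_def
  by (rule rexec_Seq[OF rexec_Add[OF _ _ refl] computes_rexec[OF computes_prog_for[OF assms]]])
    (auto simp: fun_eq_iff)

lemma sexec_Search_init:
  assumes "prec S"
    and p: "sexec A p (tape_of [], tape_of [], (\<lambda>_. 0)(0 := nb x)) (tape_of [], tape_of [], (\<lambda>_. 0)(0 := y))"
  shows "sexec A (Search_init p S) (tape_of x, tape_of [], \<lambda>_. 0) (search_state S y 0)"
proof -
  have c: "computes 0 (\<lambda>y. prod_encode (y, 0)) (prog_for (\<lambda>y. prod_encode (y, 0)) 0)"
    by (intro computes_prog_for prec_intros)
  have "rexec (prog_for (\<lambda>y. prod_encode (y, 0)) 0 ;; Eval S) ((\<lambda>_. 0)(0 := y))
      ((\<lambda>_. 0)(0 := prod_encode (y, 0), 1 := S (prod_encode (y, 0))))"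
    by (rule rexec_Seq[OF computes_rexec[OF c _ refl]]) (simp_all add: rexec_Eval[OF assms(1), unfolded One_nat_def])
  then have "sexec A (prog_for (\<lambda>y. prod_encode (y, 0)) 0 ;; Eval S)
      (tape_of [], tape_of [], (\<lambda>_. 0)(0 := y)) (search_state S y 0)"
    unfolding rexec_def search_state_def by blast
  from sexec_Seq[OF sexec_Read sexec_Seq[OF p this]] show ?thesis
    unfolding Search_init_def by simp
qed

lemma sexec_Search_next:
  assumes "prec S"
  shows "sexec A (Search_next S) (search_state S y e) (search_state S y (Suc e))"
proof -
  let ?f = "\<lambda>z. prod_encode (pfst z, Suc (psnd z))"
  have c: "computes 0 ?f (prog_for ?f 0)"
    by (intro computes_prog_for prec_intros)
  have "rexec (prog_for ?f 0 ;; Eval S) ((\<lambda>_. 0)(0 := prod_encode (y, e)))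
      ((\<lambda>_. 0)(0 := prod_encode (y, Suc e), 1 := S (prod_encode (y, Suc e))))"
    by (rule rexec_Seq[OF computes_rexec[OF c _ refl]])
      (use rexec_Eval[OF assms, of "prod_encode (y, Suc e)"] in auto)
  then have "rexec (Search_next S) ((\<lambda>_. 0)(0 := prod_encode (y, e), 1 := S (prod_encode (y, e))))
      ((\<lambda>_. 0)(0 := prod_encode (y, Suc e), 1 := S (prod_encode (y, Suc e))))"
    unfolding Search_next_def by (rule rexec_Seq[OF rexec_Clear, rotated]) (auto simp: fun_eq_iff)
  then show ?thesis unfolding rexec_def search_state_def by blast
qed

lemma sexec_Search_finish:
  assumes "S (prod_encode (y, e)) \<noteq> 0"
  shows "\<exists>s. sexec A (Dec 1 ;; Write 1 0) (search_state S y e) s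
    \<and> string_on (fst s) = str (S (prod_encode (y, e)) - 1)"
proof -
  let ?v = "S (prod_encode (y, e))" and ?R = "(\<lambda>_. 0)(0 := prod_encode (y, e)) :: nat \<Rightarrow> nat"
  have "sexec A (Dec 1) (place 0 (tape_of []) (tape_of []) (?R(1 := ?v)))
      (place 0 (tape_of []) (tape_of []) (?R(1 := ?v - 1)))"
    by (rule sexec_rexec, rule rexec_Dec) (auto simp: fun_eq_iff)
  moreover have "sexec A (Write 1 0) (place 0 (tape_of []) (tape_of []) (?R(1 := ?v - 1)))
      (place 0 (wtape (str (?v - 1)) (length (str (?v - 1)))) (tape_of []) (?R(1 := ?v - 1, 1 := 0)))"
    by (rule sexec_Write) auto
  ultimately have "sexec A (Dec 1 ;; Write 1 0) (search_state S y e)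
      (place 0 (wtape (str (?v - 1)) (length (str (?v - 1)))) (tape_of []) (?R(1 := ?v - 1, 1 := 0)))"
    unfolding search_state_def by (auto simp: place_def intro: sexec_Seq)
  then show ?thesis
    by (rule_tac exI, rule_tac conjI) (auto simp: place_def string_on_wtape simp del: string_on.simps)
qed

lemma admissible_prog_for: "prec f \<Longrightarrow> admissible (prog_for f k)"
  using computes_admissible computes_prog_for by blast

lemma admissible_Write: "admissible (Write r j)"
  unfolding Write_def using admissible_prog_for[OF prec_halve]
  by (simp add: Decode_pair_def Move_def) (simp add: admissible_def)

lemma admissible_Sweep: "admissible p \<Longrightarrow> admissible q \<Longrightarrow> admissible (Sweep j p q)"
  unfolding Sweep_def by simp (auto simp: admissible_def less_Suc_eq numeral_3_eq_3)

lemma admissible_Read: "admissible Read"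
proof -
  have "admissible (prog_for (digit b) 0)" for b
    by (intro admissible_prog_for prec_digit)
  then show ?thesis unfolding Read_def by (simp add: admissible_Sweep) (simp add: admissible_def)
qed

lemma admissible_Eval: "prec S \<Longrightarrow> admissible (Eval S)"
  by (simp add: Eval_def Add_def Move_def admissible_prog_for)

text \<open>This is Kleene's normal form. The machines for it are built in
  \<open>search_machine\<close>; that every partial recursive function has such a form follows from
  \<open>clocked_partial_recursive\<close>.\<close>

definition search :: "(nat \<Rightarrow> nat) \<Rightarrow> nat \<Rightarrow> bitstring option" where
  "search S a =
     (if \<exists>e. S (prod_encode (a, e)) \<noteq> 0
      then Some (str (S (prod_encode (a, LEAST e. S (prod_encode (a, e)) \<noteq> 0)) - 1))
      else None)"

text \<open>The dependence on the oracle is confined to the initial program \<open>p\<close>, so one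
  construction yields both the Turing machines and the oracle machines.\<close>

lemma search_machine:
  assumes S: "prec S" and p: "wf_prog p"
    and pre: "\<And>A x. sexec A p (tape_of [], tape_of [], (\<lambda>_. 0)(0 := nb x))
      (tape_of [], tape_of [], (\<lambda>_. 0)(0 := y A x))"
  shows "\<exists>M. oracle_machine M \<and> (query_free p \<longrightarrow> turing_machine M) \<and>
    (\<forall>A x. run M A x = search S (y A x))"
proof -
  \<comment> \<open>The program contains \<open>Init N\<close>, so its width depends on
    \<open>N\<close>. There is no circle: the other parts are bounded by the width of
    \<open>Search 0 p S\<close>, and \<open>Init N\<close> needs at most \<open>N + 2\<close>
    tapes.\<close>
  define N where "N = width (Search 0 p S)"
  have mono: "max (max a b) c \<le> max n (max (max a' b) c)" if "a \<le> n" for a a' b c n :: nat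
    using that by linarith
  have w0: "width (Search N p S) \<le> max (N + 2) (width (Search 0 p S))"
    unfolding Search_def width.simps(2) by (rule mono[OF width_Init])
  then have w: "width (Search N p S) \<le> N + 2" unfolding N_def by simp
  have adm: "admissible (prog_for (\<lambda>y. prod_encode (y, 0)) 0)"
    "admissible (prog_for (\<lambda>z. prod_encode (pfst z, Suc (psnd z))) 0)"
    by (intro admissible_prog_for prec_intros)+
  have wf: "wf_prog (Search N p S)" "query_free (Search N p S) \<longleftrightarrow> query_free p"
    using adm admissible_Init[of N] admissible_Read admissible_Eval[OF S] admissible_Write[of 1 0] p
    by (auto simp: Search_def Search_init_def Search_next_def admissible_def Clear_def Loop_def Dec_def)
  let ?M = "assemble (N + 2) (Search N p S)"
  have "run ?M A x = search S (y A x)" for A x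
  proof -
    let ?y = "y A x"
    let ?ts = "tape_of x # tape_of [] # replicate (N + 2 - 2) (tape_of [])"
    have parts: "width (Search_init p S) \<le> N + 2" "width (Search_next S) \<le> N + 2"
      "width (While 3 (\<lambda>s. s = 1) (Search_next S)) \<le> N + 2" "width (Dec 1 ;; Write 1 0) \<le> N + 2" "1 < N"
      using w w0 unfolding Search_def N_def by auto
    have ms: "map (\<lambda>r. if r < N then reg_tape 0 else tape_of []) [0..<N] = map (\<lambda>r. reg_tape 0) [0..<N]"
      by auto
    have "exec A (Init N) ?ts (layout N (tape_of x, tape_of [], \<lambda>_. 0))"
      using exec_Init[of N N A "tape_of x" "tape_of []"] unfolding ms layout.simps by simp
    moreover have "exec A (Search_init p S) (layout N (tape_of x, tape_of [], \<lambda>_. 0))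
        (layout N (search_state S ?y 0))"
      using sexec_Search_init[OF S pre] parts(1) by (auto simp: sexec_def simp del: layout.simps)
    ultimately have init: "exec A (Init N ;; Search_init p S) ?ts (layout N (search_state S ?y 0))"
      by (rule exec_Seq)
    have next_state: "exec A (Search_next S) (layout N (search_state S ?y e)) (layout N (search_state S ?y (Suc e)))" for e
      using sexec_Search_next[OF S] parts(2) by (simp add: sexec_def)
    have test: "scan 3 (search_state S ?y e) = 1 \<longleftrightarrow> S (prod_encode (?y, e)) = 0" for e
      by (simp add: search_state_def)
    have scan: "scanned (layout N s ! 3) = scan 3 s" for s
      using scanned_layout[of 3 N s] parts(5) by simp
    show ?thesis
    proof (cases "\<exists>e. S (prod_encode (?y, e)) \<noteq> 0")
      case True
      define e where "e = (LEAST e. S (prod_encode (?y, e)) \<noteq> 0)"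
      have e: "S (prod_encode (?y, e)) \<noteq> 0"
        unfolding e_def using True by (rule LeastI_ex)
      have less: "S (prod_encode (?y, i)) = 0" if "i < e" for i
        using not_less_Least that unfolding e_def by blast
      obtain s where s: "sexec A (Dec 1 ;; Write 1 0) (search_state S ?y e) s"
        "string_on (fst s) = str (S (prod_encode (?y, e)) - 1)"
        using sexec_Search_finish[of S ?y e] e by blast
      have "sexec A (While 3 (\<lambda>s. s = 1) (Search_next S)) (search_state S ?y 0) (search_state S ?y e)"
        using e less sexec_Search_next[OF S] test by (intro sexec_While) auto
      with parts(3) have "exec A (While 3 (\<lambda>s. s = 1) (Search_next S)) (layout N (search_state S ?y 0)) (layout N (search_state S ?y e))"
        unfolding sexec_def by blast
      moreover have "exec A (Dec 1 ;; Write 1 0) (layout N (search_state S ?y e)) (layout N s)"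
        using s(1) parts(4) unfolding sexec_def by blast
      ultimately have "exec A (Search N p S) ?ts (layout N s)"
        unfolding Search_def using init exec_Seq by blast
      from run_assemble[OF this w] have "run ?M A x = Some (string_on (layout N s ! 0))" by simp
      moreover have "layout N s ! 0 = fst s" by (cases s) simp
      moreover have "search S ?y = Some (str (S (prod_encode (?y, e)) - 1))"
        unfolding search_def e_def using True by (simp only: if_True)
      ultimately show ?thesis using s(2) by simp
    next
      case False
      have "run ?M A x = None"
        unfolding Search_def
      proof (rule run_assemble_diverges[where us = "\<lambda>e. layout N (search_state S ?y e)"])
        show "scanned (layout N (search_state S ?y e) ! 3) = 1" for e
          unfolding scan test using False by simp
        show "width ((Init N ;; Search_init p S) ;; While 3 (\<lambda>s. s = 1) (Search_next S)
            ;; Dec 1 ;; Write 1 0) \<le> N + 2"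
          using w unfolding Search_def .
      qed (use init next_state in simp_all)
      then show ?thesis using False by (simp add: search_def)
    qed
  qed
  moreover have "oracle_machine ?M"
    by (rule oracle_machine_assemble[OF wf(1) w]) simp
  moreover have "turing_machine ?M" if "query_free p"
    by (rule turing_machine_assemble[OF wf(1) w]) (use that wf(2) in simp_all)
  ultimately show ?thesis by blast
qed

lemma turing_search:
  assumes S: "prec S"
  shows "\<exists>M. turing_machine M \<and> (\<forall>A x. run M A x = search S (nb x))"
proof -
  let ?p = "Inc 0 ;; Dec 0"
  have "rexec ?p R R" for R
    by (rule rexec_Seq[OF rexec_Inc[OF refl] rexec_Dec]) auto
  then have "sexec A ?p (tape_of [], tape_of [], (\<lambda>_. 0)(0 := nb x))
      (tape_of [], tape_of [], (\<lambda>_. 0)(0 := nb x))" for A x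
    unfolding rexec_def by blast
  moreover have "wf_prog ?p" "query_free ?p" by (auto simp: Inc_def Dec_def)
  ultimately show ?thesis using search_machine[OF S, of ?p "\<lambda>A x. nb x"] by blast
qed

section \<open>Reading a finite part of the oracle\<close>

definition oracle_code :: "bitstring set \<Rightarrow> nat \<Rightarrow> nat" where
  "oracle_code A n = (\<Sum>i<n. 2 ^ i * of_bool (str i \<in> A))"

text \<open>The strings with codes \<open>a\<close> down to 0 are queried in turn. Each answer is
  shifted in at the low end, so the one for \<open>str i\<close> ends up at place \<open>i\<close>;
  the first component keeps the input code.\<close>

definition push :: "bool \<Rightarrow> nat \<Rightarrow> nat" where
  "push b z = prod_encode (pfst z, 2 * psnd z + of_bool b)"

lemma prec_push: "prec (push b)"
  unfolding push_def by (intro prec_intros)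

definition Ask_one :: prog where
  "Ask_one = Dec 1 ;; Add 1 3 4 ;; Write 3 1
          ;; Ask (prog_for (push True) 2) (prog_for (push False) 2) ;; Erase 1"

definition Ask_all :: prog where
  "Ask_all = prog_for (\<lambda>a. prod_encode (Suc a, prod_encode (a, 0))) 0 ;; Decode_pair 0
     ;; Loop 1 Ask_one
     ;; Move 2 0"

lemma sexec_Ask_all:
  "sexec A Ask_all (tape_of [], tape_of [], (\<lambda>_. 0)(0 := a))
    (tape_of [], tape_of [], (\<lambda>_. 0)(0 := prod_encode (a, oracle_code A (Suc a))))"
proof -
  let ?b = "tape_of []"
  have c: "computes 0 (\<lambda>a. prod_encode (Suc a, prod_encode (a, 0)))
      (prog_for (\<lambda>a. prod_encode (Suc a, prod_encode (a, 0))) 0)"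
    by (intro computes_prog_for prec_intros)
  define \<rho> :: "nat \<Rightarrow> nat \<Rightarrow> nat \<Rightarrow> nat"
    where "\<rho> m z = (\<lambda>_. 0)(1 := m, 2 := prod_encode (a, z))" for m z
  \<comment> \<open>This is the number collected once the strings with codes from \<open>m\<close>
    to \<open>a\<close> have been queried; the recursion below is Horner's scheme.\<close>
  define h where "h m = (\<Sum>i<Suc a - m. 2 ^ i * of_bool (str (m + i) \<in> A) :: nat)" for m
  have h: "h m = 2 * h (Suc m) + of_bool (str m \<in> A)" if "m < Suc a" for m
  proof -
    have "Suc a - m = Suc (Suc a - Suc m)" using that by simp
    then show ?thesis
      unfolding h_def by (simp only: sum.lessThan_Suc_shift) (simp add: sum_distrib_left mult.assoc del: sum_mult_of_bool_eq)
  qed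
  have 1: "sexec A (prog_for (\<lambda>a. prod_encode (Suc a, prod_encode (a, 0))) 0)
      (place 1 ?b ?b ((\<lambda>_. 0)(0 := a))) (place 1 ?b ?b ((\<lambda>_. 0)(0 := prod_encode (Suc a, prod_encode (a, 0)))))"
    by (rule sexec_rexec, rule computes_rexec[OF c]) auto
  have 2: "sexec A (Decode_pair 0) (place 1 ?b ?b ((\<lambda>_. 0)(0 := prod_encode (Suc a, prod_encode (a, 0)))))
      (place 1 ?b ?b (\<rho> (Suc a) (h (Suc a))))"
    by (rule sexec_rexec, rule rexec_Decode_pair) (auto simp: \<rho>_def h_def fun_eq_iff)
  have 3: "sexec A (Loop 1 Ask_one)
      (place 1 ?b ?b (\<rho> (Suc a - 0) (h (Suc a - 0)))) (place 1 ?b ?b (\<rho> (Suc a - Suc a) (h (Suc a - Suc a))))"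
  proof (rule sexec_Loop[where S = "\<lambda>i. place 1 ?b ?b (\<rho> (Suc a - i) (h (Suc a - i)))"])
    fix i assume i: "i < Suc a"
    define m where "m = a - i"
    have m: "Suc a - i = Suc m" "Suc a - Suc i = m" "m < Suc a" using i by (auto simp: m_def)
    let ?s = "str m"
    let ?w = "wtape ?s (length ?s)"
    have 1: "sexec A (Dec 1) (place 1 ?b ?b (\<rho> (Suc m) (h (Suc m)))) (place 1 ?b ?b (\<rho> m (h (Suc m))))"
      by (rule sexec_rexec, rule rexec_Dec) (auto simp: \<rho>_def fun_eq_iff)
    have 2: "sexec A (Add 1 3 4) (place 1 ?b ?b (\<rho> m (h (Suc m))))
        (place 1 ?b ?b ((\<rho> m (h (Suc m)))(3 := m)))"
      by (rule sexec_rexec, rule rexec_Add) (auto simp: \<rho>_def fun_eq_iff)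
    have 3: "sexec A (Write 3 1) (place 1 ?b ?b ((\<rho> m (h (Suc m)))(3 := m)))
        (place 1 ?w ?b ((\<rho> m (h (Suc m)))(3 := m, 3 := 0)))"
      by (rule sexec_Write) (auto simp: \<rho>_def)
    have 3: "sexec A (Write 3 1) (place 1 ?b ?b ((\<rho> m (h (Suc m)))(3 := m)))
        (place 1 ?w ?b (\<rho> m (h (Suc m))))"
    proof -
      have "(\<rho> m (h (Suc m)))(3 := m, 3 := 0) = \<rho> m (h (Suc m))" by (auto simp: \<rho>_def fun_eq_iff)
      with 3 show ?thesis by simp
    qed
    have push: "sexec A (prog_for (push (?s \<in> A)) 2) (place 1 ?w ?b (\<rho> m (h (Suc m)))) (place 1 ?w ?b (\<rho> m (h m)))"
      by (rule sexec_rexec, rule computes_rexec[OF computes_prog_for[OF prec_push]])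
        (auto simp: \<rho>_def push_def h[OF m(3)] fun_eq_iff)
    have 4: "sexec A (Ask (prog_for (push True) 2) (prog_for (push False) 2))
        (place 1 ?w ?b (\<rho> m (h (Suc m)))) (place 1 ?w ?b (\<rho> m (h m)))"
      unfolding place_def
      by (simp only: if_False one_neq_zero, rule sexec_Ask)
        (use push in \<open>cases "?s \<in> A"; simp add: place_def string_on_wtape del: string_on.simps\<close>)
    have 5: "sexec A (Erase 1) (place 1 ?w ?b (\<rho> m (h m))) (place 1 ?b ?b (\<rho> m (h m)))"
      by (rule sexec_Erase) simp
    have "sexec A Ask_one
        (place 1 ?b ?b (\<rho> (Suc m) (h (Suc m)))) (place 1 ?b ?b (\<rho> m (h m)))"
      unfolding Ask_one_def by (rule sexec_Seq[OF 1 sexec_Seq[OF 2 sexec_Seq[OF 3 sexec_Seq[OF 4 5]]]])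
    then show "snd (snd (place 1 ?b ?b (\<rho> (Suc a - i) (h (Suc a - i))))) 1 \<noteq> 0 \<and>
        sexec A Ask_one
        (place 1 ?b ?b (\<rho> (Suc a - i) (h (Suc a - i))))
        (place 1 ?b ?b (\<rho> (Suc a - Suc i) (h (Suc a - Suc i))))"
      unfolding m by (simp add: regs_place \<rho>_def)
  qed (simp add: regs_place \<rho>_def)
  have 3: "sexec A (Loop 1 Ask_one)
      (place 1 ?b ?b (\<rho> (Suc a) (h (Suc a)))) (place 1 ?b ?b (\<rho> 0 (h 0)))"
    using 3 by simp
  have 4: "sexec A (Move 2 0) (place 1 ?b ?b (\<rho> 0 (h 0)))
      (place 1 ?b ?b ((\<lambda>_. 0)(0 := prod_encode (a, oracle_code A (Suc a)))))"
    by (rule sexec_rexec, rule rexec_Move) (auto simp: \<rho>_def h_def oracle_code_def fun_eq_iff)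
  show ?thesis
    using sexec_Seq[OF 1 sexec_Seq[OF 2 sexec_Seq[OF 3 4]]] unfolding Ask_all_def
    by (simp add: place_def)
qed

text \<open>On input \<open>unary n\<close>, whose code is the largest among the strings of length
  at most \<open>n\<close>, the table covers the oracle set up to length \<open>n\<close>.\<close>

lemma oracle_machine_search:
  assumes S: "prec S"
  shows "\<exists>M. oracle_machine M \<and>
    (\<forall>A x. run M A x = search S (prod_encode (nb x, oracle_code A (Suc (nb x)))))"
proof -
  have "admissible (prog_for (\<lambda>a. prod_encode (Suc a, prod_encode (a, 0))) 0)"
    by (intro admissible_prog_for prec_intros)
  moreover have "admissible (prog_for (push b) 2)" for b
    by (intro admissible_prog_for prec_push)
  moreover have "admissible (Erase 1)"
    unfolding Erase_def by (simp add: admissible_Sweep)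
  moreover have "admissible (Decode_pair 0)" "admissible (Move 2 0)" "admissible (Dec 1)" "admissible (Add 1 3 4)"
    by (simp_all add: Decode_pair_def Move_def Add_def)
  ultimately have "wf_prog Ask_all"
    using admissible_Write[of 3 1] by (simp add: Ask_all_def Ask_one_def Loop_def admissible_def)
  from search_machine[OF S this sexec_Ask_all] show ?thesis by blast
qed

section \<open>Simulation of machines\<close>

definition digit_at :: "nat \<Rightarrow> nat \<Rightarrow> nat \<Rightarrow> nat" where
  "digit_at b c j = c div b ^ j mod b"

text \<open>The three summands occupy disjoint places, so exchanging \<open>d\<close> changes one
  digit only. This is what \<open>digit_at_set\<close> and \<open>digit_at_sum\<close> rest
  on.\<close>

lemma digit_at_split:
  assumes "lo < b ^ j" "d < b"
  shows "digit_at b (hi * b ^ Suc j + d * b ^ j + lo) i =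
    (if i = j then d else if i < j then digit_at b lo i else digit_at b hi (i - Suc j))"
proof -
  let ?n = "hi * b ^ Suc j + d * b ^ j + lo"
  have b: "b > 0" using assms(2) by simp
  have n: "?n = (hi * b + d) * b ^ j + lo" by (simp add: algebra_simps)
  consider "i = j" | "i < j" | "j < i" by linarith
  then show ?thesis
  proof cases
    case 1
    then show ?thesis unfolding n digit_at_def using assms b by simp
  next
    case 2
    then obtain k where k: "j = i + Suc k" using less_iff_Suc_add by auto
    have "?n = b ^ i * (b * ((hi * b + d) * b ^ k)) + lo"
      unfolding n k by (simp add: power_add algebra_simps)
    then have "?n div b ^ i = b * ((hi * b + d) * b ^ k) + lo div b ^ i"
      using b by simp
    with 2 show ?thesis unfolding digit_at_def by simp
  next
    case 3
    then obtain k where k: "i = Suc j + k" using less_iff_Suc_add by auto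
    have "d * b ^ j + lo < Suc d * b ^ j" using assms(1) by simp
    also have "\<dots> \<le> b ^ Suc j" using assms(2) by (simp add: mult_le_mono1 Suc_leI del: mult_Suc)
    finally have "?n div b ^ Suc j = hi" using b
      by (subst add.assoc, subst mult.commute, subst div_mult_self4) auto
    then have "?n div b ^ i = hi div b ^ k"
      unfolding k power_add div_mult2_eq by simp
    with 3 k show ?thesis unfolding digit_at_def by simp
  qed
qed

definition set_digit :: "nat \<Rightarrow> nat \<Rightarrow> nat \<Rightarrow> nat \<Rightarrow> nat" where
  "set_digit b c j a = c - digit_at b c j * b ^ j + a * b ^ j"

lemma digit_at_less: "b > 0 \<Longrightarrow> digit_at b c j < b"
  by (simp add: digit_at_def)

lemma digit_at_set:
  assumes "a < b"
  shows "digit_at b (set_digit b c j a) i = (if i = j then a else digit_at b c i)"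
proof -
  have b: "b > 0" using assms by simp
  define lo d hi where "lo = c mod b ^ j" and "d = digit_at b c j" and "hi = c div b ^ Suc j"
  have "c div b ^ j = hi * b + d"
    unfolding hi_def d_def digit_at_def power_Suc2 div_mult2_eq by simp
  then have c: "c = hi * b ^ Suc j + d * b ^ j + lo"
    using div_mult_mod_eq[of c "b ^ j"] unfolding lo_def by (simp add: algebra_simps)
  have lo: "lo < b ^ j" and d: "d < b" using b by (auto simp: lo_def d_def digit_at_less)
  have "set_digit b c j a = hi * b ^ Suc j + a * b ^ j + lo"
    unfolding set_digit_def d_def[symmetric] by (subst c) simp
  then show ?thesis
    using digit_at_split[OF lo assms] digit_at_split[OF lo d] c by metis
qed

lemma digit_at_sum:
  assumes "\<And>i. s i < b"
  shows "digit_at b (\<Sum>i<N. s i * b ^ i) j = (if j < N then s j else 0)"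
    and "(\<Sum>i<N. s i * b ^ i) < b ^ N"
proof (induction N)
  case 0
  show "digit_at b (\<Sum>i<0. s i * b ^ i) j = (if j < 0 then s j else 0)"
    by (simp add: digit_at_def)
  show "(\<Sum>i<0. s i * b ^ i) < b ^ 0" by simp
next
  case (Suc N)
  have "digit_at b 0 k = 0" for k by (simp add: digit_at_def)
  then show "digit_at b (\<Sum>i<Suc N. s i * b ^ i) j = (if j < Suc N then s j else 0)"
    using digit_at_split[OF Suc(2) assms[of N], of 0 j] Suc(1) by (auto simp: add.commute)
  have "(\<Sum>i<Suc N. s i * b ^ i) < Suc (s N) * b ^ N" using Suc(2) by simp
  also have "\<dots> \<le> b ^ Suc N" using assms[of N] by (simp add: mult_le_mono1 Suc_leI del: mult_Suc)
  finally show "(\<Sum>i<Suc N. s i * b ^ i) < b ^ Suc N" .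
qed

text \<open>The bound is crude but is given by \<open>c\<close> itself, which is all that
  \<open>block_code\<close> needs for the start of its scan.\<close>

lemma digit_at_beyond:
  assumes "b \<ge> 2" "c \<le> j"
  shows "digit_at b c j = 0"
proof -
  have "c < 2 ^ c" by (rule less_exp)
  also have "\<dots> \<le> b ^ c" using assms(1) by (rule power_mono) simp
  also have "\<dots> \<le> b ^ j" using assms by (intro power_increasing) auto
  finally show ?thesis by (simp add: digit_at_def)
qed

lemma prec_digit_at: "prec f \<Longrightarrow> prec g \<Longrightarrow> prec (\<lambda>x. digit_at b (f x) (g x))"
  unfolding digit_at_def by (intro prec_intros)

lemma prec_set_digit:
  "prec f \<Longrightarrow> prec g \<Longrightarrow> prec h \<Longrightarrow> prec (\<lambda>x. set_digit b (f x) (g x) (h x))"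
  unfolding set_digit_def by (intro prec_intros prec_digit_at)

definition member :: "nat \<Rightarrow> nat \<Rightarrow> bool" where
  "member D n \<longleftrightarrow> digit_at 2 D n = 1"

lemma decidable_member: "prec f \<Longrightarrow> prec g \<Longrightarrow> decidable (\<lambda>x. member (f x) (g x))"
  unfolding member_def by (intro prec_intros prec_digit_at)

lemma member_sum: "member (\<Sum>i<N. 2 ^ i * of_bool (P i)) n \<longleftrightarrow> n < N \<and> P n"
  using digit_at_sum(1)[of "\<lambda>i. of_bool (P i)" 2 N n]
  unfolding member_def by (simp add: mult.commute del: sum_mult_of_bool_eq sum_of_bool_mult_eq)

lemma member_oracle_code: "member (oracle_code A N) n \<longleftrightarrow> n < N \<and> str n \<in> A"
  unfolding oracle_code_def by (rule member_sum)

primrec nth_code :: "nat \<Rightarrow> nat \<Rightarrow> nat" where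
  "nth_code 0 z = pfst (z - 1)"
| "nth_code (Suc k) z = nth_code k (psnd (z - 1))"

lemma nth_code_list_encode: "k < length zs \<Longrightarrow> nth_code k (list_encode zs) = zs ! k"
proof (induction k arbitrary: zs)
  case 0
  then show ?case by (cases zs) auto
next
  case (Suc k)
  then show ?case by (cases zs) auto
qed

lemma prec_nth_code: "prec f \<Longrightarrow> prec (\<lambda>x. nth_code k (f x))"
proof (induction k arbitrary: f)
  case 0
  then show ?case by (simp only: nth_code.simps) (intro prec_intros)
next
  case (Suc k)
  then have "prec (\<lambda>x. psnd (f x - 1))" by (intro prec_intros)
  from Suc.IH[OF this] show ?case by simp
qed

lemma prec_list_encode:
  "(\<And>k. k \<in> set ks \<Longrightarrow> prec (g k)) \<Longrightarrow> prec (\<lambda>x. list_encode (map (\<lambda>k. g k x) ks))"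
  by (induction ks) (auto intro!: prec_const prec_Suc prec_pair)

text \<open>Cell \<open>i\<close> of a tape is the digit at place \<open>int_encode i\<close> of a number; this is how a head moves.\<close>

definition head_move :: "nat \<Rightarrow> nat \<Rightarrow> nat" where
  "head_move m j =
     (if m = 0 then if j = 0 then 1 else if j mod 2 = 0 then j - 2 else j + 2
      else if m = 1 then j
      else if j mod 2 = 0 then j + 2 else if j = 1 then 0 else j - 2)"

fun move_code :: "move \<Rightarrow> nat" where
  "move_code Leftwards = 0"
| "move_code Stay = 1"
| "move_code Rightwards = 2"

lemma prec_head_move: "prec f \<Longrightarrow> prec g \<Longrightarrow> prec (\<lambda>x. head_move (f x) (g x))"
  unfolding head_move_def by (intro prec_intros)

lemma int_encode_simps: "int_encode i = (if 0 \<le> i then 2 * nat i else 2 * nat (- i - 1) + 1)"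
  by (simp add: int_encode_def sum_encode_def)

lemma int_encode_shift: "int_encode (h + shift d) = head_move (move_code d) (int_encode h)"
proof (cases d)
  case Leftwards
  consider "h < 0" | "h = 0" | "h > 0" by linarith
  then show ?thesis
  proof cases
    case 1
    then have "nat (- (h - 1) - 1) = Suc (nat (- h - 1))" by simp
    with 1 Leftwards show ?thesis by (simp add: int_encode_simps head_move_def)
  next
    case 3
    then obtain n where "h = int (Suc n)" by (metis zero_less_imp_eq_int Suc_pred)
    with Leftwards show ?thesis by (simp add: int_encode_simps head_move_def)
  qed (use Leftwards in \<open>simp add: int_encode_simps head_move_def\<close>)
next
  case Stay
  then show ?thesis by (simp add: head_move_def)
next
  case Rightwards
  consider "h \<ge> 0" | "h = -1" | "h < -1" by linarith
  then show ?thesis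
  proof cases
    case 1
    with Rightwards show ?thesis by (simp add: int_encode_simps head_move_def nat_add_distrib)
  next
    case 3
    then have "nat (- h - 1) = Suc (nat (- (h + 1) - 1))" by simp
    with 3 Rightwards show ?thesis by (simp add: int_encode_simps head_move_def)
  qed (use Rightwards in \<open>simp add: int_encode_simps head_move_def\<close>)
qed

text \<open>A relation and not a function of the tape, since an inscription with infinitely many
  nonblank cells has no code.\<close>

definition tape_rep :: "nat \<Rightarrow> tape \<Rightarrow> nat \<Rightarrow> bool" where
  "tape_rep b t z \<longleftrightarrow> psnd z = int_encode (snd t) \<and>
     (\<forall>i. fst t i = digit_at b (pfst z) (int_encode i))"

lemma scanned_rep: "tape_rep b t z \<Longrightarrow> scanned t = digit_at b (pfst z) (psnd z)"
  by (cases t) (auto simp: tape_rep_def)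

lemma tape_rep_write:
  assumes "tape_rep b t z" "a < b"
  shows "tape_rep b (write_move (a, d) t)
    (prod_encode (set_digit b (pfst z) (psnd z) a, head_move (move_code d) (psnd z)))"
proof (cases t)
  case (Pair c h)
  have "int_encode i = int_encode h \<longleftrightarrow> i = h" for i
    using inj_int_encode[of UNIV] by (auto simp: inj_on_def)
  with assms show ?thesis
    by (auto simp: Pair tape_rep_def digit_at_set int_encode_shift)
qed

text \<open>
  The block of bits that begins at cell \<open>i\<close>, for \<open>i\<close> descending to 0, starting from a
  place beyond all nonzero digits.
\<close>

definition block_code :: "nat \<Rightarrow> nat \<Rightarrow> nat" where
  "block_code b c = rec_nat 0 (\<lambda>i r.
     if digit_at b c (2 * (c - Suc i)) = 1 \<or> digit_at b c (2 * (c - Suc i)) = 2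
     then 2 * r + digit_at b c (2 * (c - Suc i)) else 0) c"

lemma prec_block_code: "prec f \<Longrightarrow> prec (\<lambda>x. block_code b (f x))"
proof -
  have "prec (block_code b)"
    unfolding block_code_def
    by (intro prec_rec prec_intros prec_digit_at)
  then show "prec f \<Longrightarrow> prec (\<lambda>x. block_code b (f x))" by (rule prec_comp)
qed

lemma block_code:
  assumes b: "b \<ge> 2" and t: "tape_rep b t z"
  shows "block_code b (pfst z) = nb (string_on t)"
proof -
  define c where "c = pfst z"
  define f where "f i = digit_at b c (2 * i)" for i
  \<comment> \<open>The string \<open>blk p\<close> is the block of bits that begins at cell
    \<open>p\<close>. After \<open>i\<close> rounds the recursion holds its code for
    \<open>p = c - i\<close>: a bit is put in front, and any other symbol resets the block.\<close>
  define blk where "blk p = map (\<lambda>i. f (p + i) = 2) [0..<(LEAST n. f (p + n) \<notin> {1, 2})]" for p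
  have f0: "f c = 0" unfolding f_def using b by (intro digit_at_beyond) auto
  have "rec_nat 0 (\<lambda>i r. if f (c - Suc i) = 1 \<or> f (c - Suc i) = 2
      then 2 * r + f (c - Suc i) else 0) i = nb (blk (c - i))" if "i \<le> c" for i
    using that
  proof (induction i)
    case 0
    have "(LEAST n. f (c + n) \<notin> {1, 2}) = 0" using f0 by (intro Least_equality) auto
    then show ?case by (simp add: blk_def)
  next
    case (Suc i)
    define p where "p = c - Suc i"
    have p: "c - i = Suc p" using Suc.prems by (simp add: p_def)
    show ?case
    proof (cases "f p \<in> {1, 2}")
      case True
      have "f (p + (c - p)) \<notin> {1, 2}" using f0 by (simp add: p_def)
      from Least_Suc[of "\<lambda>n. f (p + n) \<notin> {1, 2}", OF this] True
      have "(LEAST n. f (p + n) \<notin> {1, 2}) = Suc (LEAST n. f (Suc p + n) \<notin> {1, 2})" by simp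
      then have "blk p = (f p = 2) # blk (Suc p)"
        unfolding blk_def by (simp only: upt_conv_Cons zero_less_Suc list.map add_0_right map_Suc_upt[symmetric])
          (simp add: comp_def)
      then show ?thesis using Suc True p by (auto simp flip: p_def)
    next
      case False
      then have "(LEAST n. f (p + n) \<notin> {1, 2}) = 0" by (intro Least_equality) auto
      then have "blk p = []" by (simp add: blk_def)
      with False show ?thesis by (simp flip: p_def)
    qed
  qed
  from this[of c] have "block_code b c = nb (blk 0)" unfolding block_code_def f_def by simp
  moreover have "fst t (int i) = f i" for i
    using t by (simp add: tape_rep_def f_def c_def int_encode_simps)
  then have "string_on t = blk 0" by (cases t) (simp add: blk_def)
  ultimately show ?thesis by (simp add: c_def)
qed

text \<open>By \<open>nb_drop\<close>, \<open>Suc a div 2 ^ i - 1\<close> is the code of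
  \<open>str a\<close> without its first \<open>i\<close> bits. A nonzero code is odd exactly when
  the string begins with the bit 0, whose symbol is 1.\<close>

definition symbol :: "nat \<Rightarrow> nat \<Rightarrow> nat" where
  "symbol a i = (if Suc a div 2 ^ i - 1 = 0 then 0 else if (Suc a div 2 ^ i - 1) mod 2 = 1 then 1 else 2)"

lemma nb_drop: "Suc (nb x) div 2 ^ i - 1 = nb (drop i x)"
proof (induction i arbitrary: x)
  case (Suc i)
  show ?case
  proof (cases x)
    case Nil
    have "1 div (2::nat) ^ Suc i = 0" by (rule div_less) (use less_exp[of "Suc i"] in linarith)
    then show ?thesis using Nil by simp
  next
    case (Cons b y)
    have "Suc (nb x) div 2 = Suc (nb y)" unfolding Cons by simp
    then have "Suc (nb x) div 2 ^ Suc i = Suc (nb y) div 2 ^ i"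
      unfolding power_Suc div_mult2_eq by simp
    then show ?thesis using Suc[of y] Cons by simp
  qed
qed simp

lemma length_le_nb: "length x \<le> nb x"
  by (induction x) auto

lemma symbol: "symbol (nb x) i = (if i < length x then if x ! i then 2 else 1 else 0)"
proof (cases "i < length x")
  case True
  then have "nb (drop i x) = 2 * nb (drop (Suc i) x) + 1 + of_bool (x ! i)"
    by (simp flip: Cons_nth_drop_Suc)
  with True show ?thesis unfolding symbol_def nb_drop by simp
next
  case False
  then show ?thesis unfolding symbol_def nb_drop by simp
qed

section \<open>Machine steps as a primitive recursive function\<close>

context
  fixes M :: machine
  assumes M: "oracle_machine M"
begin

lemma tapes_ge: "tapes M \<ge> 2" and alphabet_ge: "alphabet M \<ge> 3"
  using M by (auto simp: oracle_machine_def)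

definition scans :: "nat set" where
  "scans = (\<lambda>(q, xs). prod_encode (q, list_encode xs)) `
     ({..<length (control M)} \<times> {xs. set xs \<subseteq> {0..<alphabet M} \<and> length xs = tapes M})"

text \<open>Everything that is needed of the control enters through functions of this form. They
  vanish outside the finite set \<open>scans\<close>, so they are primitive recursive although the
  rows \<open>\<delta>\<close> are arbitrary functions.\<close>

definition table :: "(state_kind \<Rightarrow> nat list \<Rightarrow> nat) \<Rightarrow> nat \<Rightarrow> nat" where
  "table F y = (if y \<in> scans then F (control M ! pfst y) (list_decode (psnd y)) else 0)"

lemma prec_table: "prec f \<Longrightarrow> prec (\<lambda>x. table F (f x))"
proof -
  have "finite scans"
    unfolding scans_def by (intro finite_imageI finite_cartesian_product finite_lists_length_eq) auto
  then have "prec (table F)" unfolding table_def by (rule prec_finite_support)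
  then show "prec f \<Longrightarrow> prec (\<lambda>x. table F (f x))" by (rule prec_comp)
qed

definition scan_code :: "nat \<Rightarrow> nat" where
  "scan_code z = prod_encode (pfst z, list_encode (map (\<lambda>k.
     digit_at (alphabet M) (pfst (nth_code k (psnd z))) (psnd (nth_code k (psnd z)))) [0..<tapes M]))"

definition kind :: "state_kind \<Rightarrow> nat list \<Rightarrow> nat" where
  "kind s xs = (case s of Halt \<Rightarrow> 0 | Query y n \<Rightarrow> 1 | Step \<delta> \<Rightarrow> 2)"

definition answer :: "bool \<Rightarrow> state_kind \<Rightarrow> nat list \<Rightarrow> nat" where
  "answer a s xs = (case s of Query y n \<Rightarrow> if a then y else n | _ \<Rightarrow> 0)"

definition next_state :: "state_kind \<Rightarrow> nat list \<Rightarrow> nat" where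
  "next_state s xs = (case s of Step \<delta> \<Rightarrow> fst (\<delta> xs) | _ \<Rightarrow> 0)"

definition written :: "nat \<Rightarrow> state_kind \<Rightarrow> nat list \<Rightarrow> nat" where
  "written k s xs = (case s of Step \<delta> \<Rightarrow> fst (snd (\<delta> xs) ! k) | _ \<Rightarrow> 0)"

definition moved :: "nat \<Rightarrow> state_kind \<Rightarrow> nat list \<Rightarrow> nat" where
  "moved k s xs = (case s of Step \<delta> \<Rightarrow> move_code (snd (snd (\<delta> xs) ! k)) | _ \<Rightarrow> 0)"

definition step_code :: "nat \<Rightarrow> nat \<Rightarrow> nat" where
  "step_code D z =
     (if table kind (scan_code z) = 0 then z
      else if table kind (scan_code z) = 1 then
        prod_encode
          (if member D (block_code (alphabet M) (pfst (nth_code 1 (psnd z))))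
           then table (answer True) (scan_code z) else table (answer False) (scan_code z), psnd z)
      else
        prod_encode (table next_state (scan_code z), list_encode (map (\<lambda>k. prod_encode
          (set_digit (alphabet M) (pfst (nth_code k (psnd z))) (psnd (nth_code k (psnd z)))
             (table (written k) (scan_code z)),
           head_move (table (moved k) (scan_code z)) (psnd (nth_code k (psnd z))))) [0..<tapes M])))"

lemma prec_scan_code: "prec f \<Longrightarrow> prec (\<lambda>x. scan_code (f x))"
  unfolding scan_code_def by (intro prec_intros prec_list_encode prec_digit_at prec_nth_code)

lemma prec_step_code: "prec f \<Longrightarrow> prec g \<Longrightarrow> prec (\<lambda>x. step_code (f x) (g x))"
  unfolding step_code_def
  by (intro prec_intros prec_list_encode prec_set_digit prec_head_move prec_table prec_scan_code
      prec_nth_code decidable_member prec_block_code)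

definition config_rep :: "config \<Rightarrow> nat \<Rightarrow> bool" where
  "config_rep c z \<longleftrightarrow> pfst z = fst c \<and> fst c < length (control M) \<and> length (snd c) = tapes M \<and>
     (\<forall>k<tapes M. tape_rep (alphabet M) (snd c ! k) (nth_code k (psnd z)))"

lemma table_rep:
  assumes "config_rep (q, ts) z"
  shows "table F (scan_code z) = F (control M ! q) (map scanned ts)"
    and "set (map scanned ts) \<subseteq> {0..<alphabet M}"
proof -
  have xs: "map scanned ts = map (\<lambda>k. digit_at (alphabet M) (pfst (nth_code k (psnd z)))
      (psnd (nth_code k (psnd z)))) [0..<tapes M]"
    using assms by (auto intro!: nth_equalityI scanned_rep simp: config_rep_def)
  then show s: "set (map scanned ts) \<subseteq> {0..<alphabet M}"
    using alphabet_ge by (auto simp: digit_at_less)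
  have code: "scan_code z = prod_encode (q, list_encode (map scanned ts))"
    using assms by (simp add: scan_code_def xs config_rep_def)
  have "scan_code z \<in> scans"
    unfolding scans_def code using s assms
    by (intro image_eqI[of _ _ "(q, map scanned ts)"]) (auto simp: config_rep_def)
  then show "table F (scan_code z) = F (control M ! q) (map scanned ts)"
    by (simp add: table_def code)
qed

text \<open>The oracle set is given by a number \<open>D\<close> and hence is finite; the empty set
  and the restrictions of \<open>dom V\<close> to bounded length are of this kind.\<close>

lemma step_rep:
  assumes c: "config_rep (q, ts) z" and A: "\<And>s. s \<in> A \<longleftrightarrow> member D (nb s)"
  shows "config_rep (step M A (q, ts)) (step_code D z)"
proof (cases "control M ! q")
  case Halt
  then have "table kind (scan_code z) = 0" by (simp add: table_rep[OF c] kind_def)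
  with Halt c show ?thesis by (simp add: step_code_def)
next
  case (Query y n)
  have "table kind (scan_code z) = 1" "table (answer a) (scan_code z) = (if a then y else n)" for a
    using Query by (auto simp: table_rep[OF c] kind_def answer_def)
  moreover have "block_code (alphabet M) (pfst (nth_code 1 (psnd z))) = nb (string_on (ts ! 1))"
    using c tapes_ge alphabet_ge by (intro block_code) (auto simp: config_rep_def simp del: nth_code.simps One_nat_def)
  moreover have "y < length (control M)" "n < length (control M)"
    using M Query c nth_mem[of q "control M"] by (auto simp: oracle_machine_def config_rep_def)
  ultimately show ?thesis
    using c Query A by (simp add: step_code_def config_rep_def)
next
  case (Step \<delta>)
  let ?xs = "map scanned ts"
  have q: "q < length (control M)" "length ?xs = tapes M" using c by (auto simp: config_rep_def)
  then have "Step \<delta> \<in> set (control M)" using Step nth_mem by metis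
  then have \<delta>: "fst (\<delta> ?xs) < length (control M)" "length (snd (\<delta> ?xs)) = tapes M"
      "fst ` set (snd (\<delta> ?xs)) \<subseteq> {0..<alphabet M}"
    using M q(2) table_rep(2)[OF c] unfolding oracle_machine_def by blast+
  have t: "table kind (scan_code z) = 2" "table next_state (scan_code z) = fst (\<delta> ?xs)"
    "table (written k) (scan_code z) = fst (snd (\<delta> ?xs) ! k)"
    "table (moved k) (scan_code z) = move_code (snd (snd (\<delta> ?xs) ! k))" for k
    using Step by (simp_all add: table_rep[OF c] kind_def next_state_def written_def moved_def)
  have "tape_rep (alphabet M) (map2 write_move (snd (\<delta> ?xs)) ts ! k)
      (prod_encode (set_digit (alphabet M) (pfst (nth_code k (psnd z))) (psnd (nth_code k (psnd z)))
             (fst (snd (\<delta> ?xs) ! k)),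
           head_move (move_code (snd (snd (\<delta> ?xs) ! k))) (psnd (nth_code k (psnd z)))))"
    if k: "k < tapes M" for k
  proof -
    have "fst (snd (\<delta> ?xs) ! k) < alphabet M"
      using \<delta>(2,3) k nth_mem[of k "snd (\<delta> ?xs)"] by fastforce
    with tape_rep_write[of "alphabet M" "ts ! k" "nth_code k (psnd z)" "fst (snd (\<delta> ?xs) ! k)"
        "snd (snd (\<delta> ?xs) ! k)"] show ?thesis
      using k c \<delta>(2) by (simp add: config_rep_def)
  qed
  then show ?thesis
    using Step \<delta> q t
    by (auto simp: step_code_def config_rep_def nth_code_list_encode case_prod_beta)
qed

text \<open>The even places are the nonnegative cells. The first \<open>2 * a\<close> places suffice
  because a string is no longer than its code.\<close>

definition input_code :: "nat \<Rightarrow> nat" where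
  "input_code a = (\<Sum>j<2 * a. (if j mod 2 = 0 then symbol a (j div 2) else 0) * alphabet M ^ j)"

definition initial_code :: "nat \<Rightarrow> nat" where
  "initial_code a = prod_encode (0, list_encode (map (\<lambda>k. if k = 0 then prod_encode (input_code a, 0)
     else 0) [0..<tapes M]))"

lemma prec_initial_code: "prec f \<Longrightarrow> prec (\<lambda>x. initial_code (f x))"
proof -
  have p: "prec (\<lambda>a. if k = 0 then prod_encode (input_code a, 0) else 0)" for k :: nat
    unfolding input_code_def symbol_def
    by (cases "k = 0") (simp_all only: if_True if_False, (intro prec_intros)+)
  then have "prec initial_code"
    unfolding initial_code_def by (intro prec_pair prec_const prec_list_encode p)
  then show "prec f \<Longrightarrow> prec (\<lambda>x. initial_code (f x))" by (rule prec_comp)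
qed

lemma initial_rep: "config_rep (initial M x) (initial_code (nb x))"
proof -
  have "tape_rep (alphabet M) (tape_of x) (prod_encode (input_code (nb x), 0))"
    unfolding tape_rep_def
  proof (intro conjI allI)
    fix i
    have "symbol a j < alphabet M" for a j using alphabet_ge by (simp add: symbol_def)
    then have "digit_at (alphabet M) (input_code (nb x)) (int_encode i)
        = (if int_encode i < 2 * nb x
           then if int_encode i mod 2 = 0 then symbol (nb x) (int_encode i div 2) else 0 else 0)"
      unfolding input_code_def using alphabet_ge by (subst digit_at_sum) auto
    moreover have "\<not> i < int (nb x) \<Longrightarrow> \<not> i < int (length x)" using length_le_nb[of x] by linarith
    ultimately show "fst (tape_of x) i = digit_at (alphabet M) (pfst (prod_encode (input_code (nb x), 0))) (int_encode i)"
      by (auto simp: int_encode_simps symbol tape_of_def mod_mult_self3 nat_less_iff)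
  qed (simp add: tape_of_def int_encode_simps)
  moreover have "tape_rep (alphabet M) (tape_of []) 0"
    by (simp add: tape_rep_def tape_of_def digit_at_def pfst_def psnd_def prod_decode_def
        prod_decode_aux.simps int_encode_simps)
  moreover have "0 < length (control M)" using M by (simp add: oracle_machine_def)
  ultimately show ?thesis
    using tapes_ge
    by (auto simp: config_rep_def initial_def initial_code_def nth_code_list_encode nth_Cons split: nat.splits)
qed

definition config_code :: "nat \<Rightarrow> nat \<Rightarrow> nat \<Rightarrow> nat" where
  "config_code a D t = rec_nat (initial_code a) (\<lambda>i z. step_code D z) t"

lemma config_code_rep:
  assumes "\<And>s. s \<in> A \<longleftrightarrow> member D (nb s)"
  shows "config_rep ((step M A ^^ t) (initial M x)) (config_code (nb x) D t)"
proof (induction t)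
  case 0
  show ?case by (simp add: config_code_def initial_rep)
next
  case (Suc t)
  then show ?case
    using step_rep[OF _ assms, of "fst ((step M A ^^ t) (initial M x))" "snd ((step M A ^^ t) (initial M x))"]
    by (simp add: config_code_def)
qed

lemma prec_config_code:
  assumes "prec f" "prec g" "prec h"
  shows "prec (\<lambda>x. config_code (f x) (g x) (h x))"
  unfolding config_code_def
  by (intro prec_rec prec_initial_code prec_step_code prec_basic assms prec_comp[OF assms(2)])

definition halted_code :: "nat \<Rightarrow> nat \<Rightarrow> nat \<Rightarrow> bool" where
  "halted_code a D t \<longleftrightarrow> table kind (scan_code (config_code a D t)) = 0"

text \<open>The argument codes the input, the oracle set and a time. The value is nonzero at the
  first halting time only, so that each halting computation has exactly one witness.\<close>

definition clock :: "nat \<Rightarrow> nat" where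
  "clock e = (if halted_code (pfst (pfst e)) (psnd (pfst e)) (psnd e) \<and>
       (\<forall>i<psnd e. \<not> halted_code (pfst (pfst e)) (psnd (pfst e)) i)
     then Suc (block_code (alphabet M)
       (pfst (nth_code 0 (psnd (config_code (pfst (pfst e)) (psnd (pfst e)) (psnd e))))))
     else 0)"

lemma prec_clock: "prec clock"
  unfolding clock_def halted_code_def
  by (intro prec_intros prec_table prec_scan_code prec_config_code prec_block_code prec_nth_code)

lemma clock_Suc_iff:
  assumes A: "\<And>s. s \<in> A \<longleftrightarrow> member D (nb s)"
  defines "S \<equiv> \<lambda>x t. clock (prod_encode (prod_encode (nb x, D), t))"
  shows "S x t \<noteq> 0 \<Longrightarrow> S x t' \<noteq> 0 \<Longrightarrow> t = t'"
    and "run M A x = Some y \<longleftrightarrow> (\<exists>t. S x t = Suc (nb y))"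
proof -
  let ?c = "\<lambda>t. (step M A ^^ t) (initial M x)"
  note rep = config_code_rep[where x = x, OF A]
  have h: "halted_code (nb x) D t \<longleftrightarrow> halted M (?c t)" for t
  proof -
    obtain q ts where c: "?c t = (q, ts)" by (cases "?c t")
    have "table kind (scan_code (config_code (nb x) D t)) = kind (control M ! q) (map scanned ts)"
      using rep[of t] table_rep(1) unfolding c by blast
    then show ?thesis by (simp add: halted_code_def c kind_def split: state_kind.splits)
  qed
  have out: "block_code (alphabet M) (pfst (nth_code 0 (psnd (config_code (nb x) D t))))
      = nb (string_on (snd (?c t) ! 0))" for t
    using rep[of t] tapes_ge alphabet_ge
    by (intro block_code) (auto simp: config_rep_def simp del: nth_code.simps)
  have S: "S x t = (if halted M (?c t) \<and> (\<forall>i<t. \<not> halted M (?c i))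
      then Suc (nb (string_on (snd (?c t) ! 0))) else 0)" for t
    unfolding S_def clock_def by (simp only: pfst_pair psnd_pair h out)
  show "S x t \<noteq> 0 \<Longrightarrow> S x t' \<noteq> 0 \<Longrightarrow> t = t'"
    by (cases t t' rule: linorder_cases) (auto simp: S split: if_splits)
  define l where "l = (LEAST t. halted M (?c t))"
  have least: "halted M (?c t) \<and> (\<forall>i<t. \<not> halted M (?c i)) \<longleftrightarrow> (\<exists>t. halted M (?c t)) \<and> t = l" for t
  proof
    assume "halted M (?c t) \<and> (\<forall>i<t. \<not> halted M (?c i))"
    then show "(\<exists>t. halted M (?c t)) \<and> t = l"
      unfolding l_def by (intro conjI exI[of _ t] Least_equality[symmetric]) (auto simp: not_less[symmetric])
  next
    assume "(\<exists>t. halted M (?c t)) \<and> t = l"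
    then show "halted M (?c t) \<and> (\<forall>i<t. \<not> halted M (?c i))"
      unfolding l_def using LeastI_ex[of "\<lambda>t. halted M (?c t)"] not_less_Least[of _ "\<lambda>t. halted M (?c t)"]
      by blast
  qed
  show "run M A x = Some y \<longleftrightarrow> (\<exists>t. S x t = Suc (nb y))"
    unfolding S least by (auto simp: run_def Let_def nb_inj simp flip: l_def split: if_splits)
qed

end

text \<open>A normal form with unique witness: an index \<open>prod_encode (a, t)\<close> of nonzero
  value stands for one program of the domain, and no program has two, so sums over indices are sums
  over programs.\<close>

definition clocked :: "(nat \<Rightarrow> nat) \<Rightarrow> (bitstring \<rightharpoonup> bitstring) \<Rightarrow> bool" where
  "clocked S C \<longleftrightarrow> prec S \<and>
     (\<forall>a t t'. S (prod_encode (a, t)) \<noteq> 0 \<and> S (prod_encode (a, t')) \<noteq> 0 \<longrightarrow> t = t') \<and>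
     (\<forall>x y. C x = Some y \<longleftrightarrow> (\<exists>t. S (prod_encode (nb x, t)) = Suc (nb y)))"

lemma clocked_partial_recursive:
  assumes "partial_recursive C"
  shows "\<exists>S. clocked S C"
proof -
  obtain M where M: "turing_machine M" "\<And>x. run M {} x = C x"
    using assms by (auto simp: partial_recursive_def)
  have om: "oracle_machine M" using M(1) by (simp add: turing_machine_def)
  have D: "s \<in> {} \<longleftrightarrow> member 0 (nb s)" for s
    by (simp add: member_def digit_at_def)
  have "t = t'" if "clock M (prod_encode (prod_encode (a, 0), t)) \<noteq> 0"
    "clock M (prod_encode (prod_encode (a, 0), t')) \<noteq> 0" for a t t'
    using clock_Suc_iff(1)[OF om D, of "str a" t t'] that by simp
  moreover have "C x = Some y \<longleftrightarrow> (\<exists>t. clock M (prod_encode (prod_encode (nb x, 0), t)) = Suc (nb y))" for x y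
    using clock_Suc_iff(2)[OF om D, of x y] unfolding M(2) .
  moreover have "prec (\<lambda>e. clock M (prod_encode (prod_encode (pfst e, 0), psnd e)))"
    by (intro prec_comp[OF prec_clock[OF om]] prec_intros)
  ultimately have "clocked (\<lambda>e. clock M (prod_encode (prod_encode (pfst e, 0), psnd e))) C"
    unfolding clocked_def pfst_pair psnd_pair by (intro conjI allI impI) auto
  then show ?thesis by (rule exI[where P = "\<lambda>S. clocked S C"])
qed

lemma search_Some:
  assumes "search S a = Some y"
  shows "\<exists>e. S (prod_encode (a, e)) = Suc (nb y)"
proof (cases "\<exists>e. S (prod_encode (a, e)) \<noteq> 0")
  case True
  define e where "e = (LEAST e. S (prod_encode (a, e)) \<noteq> 0)"
  have "S (prod_encode (a, e)) \<noteq> 0" unfolding e_def using True by (rule LeastI_ex)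
  moreover have "str (S (prod_encode (a, e)) - 1) = y"
    using assms True unfolding search_def e_def by (simp only: if_True option.inject)
  then have "S (prod_encode (a, e)) - 1 = nb y" using nb_str by metis
  ultimately show ?thesis by (intro exI[of _ e]) simp
next
  case False
  with assms show ?thesis unfolding search_def by (simp only: if_False option.distinct)
qed

lemma search_defined: "S (prod_encode (a, e)) \<noteq> 0 \<Longrightarrow> \<exists>y. search S a = Some y"
  by (auto simp: search_def)

lemma partial_recursive_search: "prec S \<Longrightarrow> partial_recursive (\<lambda>x. search S (nb x))"
  using turing_search[of S] unfolding partial_recursive_def by blast

section \<open>Enumerating the domain of a computer\<close>

fun bval :: "bitstring \<Rightarrow> nat" where
  "bval [] = 0"
| "bval (b # bs) = of_bool b * 2 ^ length bs + bval bs"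

lemma bval_less: "bval s < 2 ^ length s"
  by (induction s) (auto split: if_splits)

lemma bval_append: "bval (s @ t) = bval s * 2 ^ length t + bval t"
  by (induction s) (auto simp: power_add algebra_simps)

lemma bval_inj: "length s = length t \<Longrightarrow> bval s = bval t \<Longrightarrow> s = t"
proof (induction s t rule: list_induct2)
  case (Cons b s c t)
  then show ?case using bval_less[of s] bval_less[of t] by (cases b; cases c) auto
qed simp

lemma bval_surj: "n < 2 ^ k \<Longrightarrow> \<exists>s. length s = k \<and> bval s = n"
proof (induction k arbitrary: n)
  case (Suc k)
  show ?case
  proof (cases "n < 2 ^ k")
    case True
    then obtain s where "length s = k" "bval s = n" using Suc.IH by blast
    then show ?thesis by (intro exI[of _ "False # s"]) simp
  next
    case False
    then have "n - 2 ^ k < 2 ^ k" using Suc.prems by simp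
    then obtain s where "length s = k" "bval s = n - 2 ^ k" using Suc.IH by blast
    then show ?thesis using False by (intro exI[of _ "True # s"]) simp
  qed
qed simp

definition lo :: "bitstring \<Rightarrow> real" where "lo s = real (bval s) / 2 ^ length s"
definition hi :: "bitstring \<Rightarrow> real" where "hi s = (real (bval s) + 1) / 2 ^ length s"

lemma lo_less_hi: "lo s < hi s"
  by (simp add: lo_def hi_def divide_strict_right_mono)

lemma lo_append: "lo s \<le> lo (s @ t)" and hi_append: "hi (s @ t) \<le> hi s"
proof -
  have "bval t + 1 \<le> 2 ^ length t" using bval_less[of t] by simp
  then have "real (bval t) + 1 \<le> 2 ^ length t"
    using of_nat_mono[of "bval t + 1" "2 ^ length t", where 'a = real] by simp
  then have "2 ^ length s * (real (bval t) + 1) \<le> 2 ^ length s * 2 ^ length t"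
    by (intro mult_left_mono) auto
  then show "lo s \<le> lo (s @ t)" "hi (s @ t) \<le> hi s"
    by (simp_all add: lo_def hi_def bval_append power_add field_simps)
qed

text \<open>Comparing the lengths of the intervals shows that \<open>t\<close> is at least as long
  as \<open>s\<close>. The prefix of \<open>t\<close> of length \<open>length s\<close> then has an
  interval that overlaps the one of \<open>s\<close>; for equal length this forces equal
  values.\<close>

lemma nested_prefix:
  assumes "lo s \<le> lo t" "hi t \<le> hi s"
  shows "\<exists>u. t = s @ u"
proof -
  have "hi t - lo t \<le> hi s - lo s" using assms by simp
  then have "1 / 2 ^ length t \<le> (1 / 2 ^ length s :: real)"
    by (simp add: lo_def hi_def add_divide_distrib)
  then have "(2::real) ^ length s \<le> 2 ^ length t" by (simp add: field_simps)
  then have len: "length s \<le> length t" by simp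
  define s' where "s' = take (length s) t"
  have t: "t = s' @ drop (length s) t" "length s' = length s" using len by (auto simp: s'_def)
  have "lo s < hi s'" "lo s' < hi s"
    using assms lo_append[of s' "drop (length s) t"] hi_append[of s' "drop (length s) t"]
      lo_less_hi[of t] t(1) by auto
  then have "real (bval s) < real (bval s') + 1" "real (bval s') < real (bval s) + 1"
    using t(2) by (simp_all add: lo_def hi_def divide_less_cancel)
  then have "bval s' = bval s" by linarith
  then have "s' = s" using bval_inj t(2) by blast
  with t(1) show ?thesis by metis
qed

abbreviation len :: "nat \<Rightarrow> nat" where
  "len a \<equiv> length (str a)"

lemma nb_append: "nb (x @ y) = nb x + 2 ^ length x * nb y"
  by (induction x) auto

lemma nb_bounds: "2 ^ length x \<le> Suc (nb x)" "Suc (nb x) < 2 ^ Suc (length x)"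
  by (induction x) auto

text \<open>The length is the largest \<open>l\<close> with \<open>2 ^ l <= Suc a\<close>, written
  as a bounded count so as to be primitive recursive.\<close>

lemma length_str: "len a = (\<Sum>j<a. of_bool (2 ^ Suc j \<le> Suc a))"
proof -
  define x where "x = str a"
  have a: "a = nb x" by (simp add: x_def)
  have "2 ^ Suc j \<le> Suc (nb x) \<longleftrightarrow> j < length x" for j
  proof
    assume "2 ^ Suc j \<le> Suc (nb x)"
    then have "(2::nat) ^ Suc j < 2 ^ Suc (length x)" using nb_bounds(2) by (rule le_less_trans)
    then show "j < length x" by simp
  next
    assume "j < length x"
    then have "(2::nat) ^ Suc j \<le> 2 ^ length x" by (intro power_increasing) auto
    then show "2 ^ Suc j \<le> Suc (nb x)" using nb_bounds(1) by (rule le_trans)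
  qed
  then have "(\<Sum>j<a. of_bool (2 ^ Suc j \<le> Suc a)) = (\<Sum>j<a. of_bool (j < length x) :: nat)"
    unfolding a by simp
  also have "\<dots> = card ({..<a} \<inter> {j. j < length x})" by simp
  also have "{..<a} \<inter> {j. j < length x} = {..<length x}" using length_le_nb[of x] a by auto
  finally show ?thesis by (simp add: x_def)
qed

lemma prec_length: "prec f \<Longrightarrow> prec (\<lambda>x. len (f x))"
proof -
  have "prec (\<lambda>a. len a)" unfolding length_str by (intro prec_intros)
  then show "prec f \<Longrightarrow> prec (\<lambda>x. len (f x))" by (rule prec_comp)
qed

lemma bval_sum: "bval x = (\<Sum>i<length x. of_bool (x ! i) * 2 ^ (length x - Suc i))"
  by (induction x) (auto simp: sum.lessThan_Suc_shift simp del: sum.lessThan_Suc sum_of_bool_mult_eq)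

text \<open>In base two, \<open>Suc (nb x)\<close> is a leading 1 followed by the bits of
  \<open>x\<close> in reverse order.\<close>

lemma bval_str: "bval (str a) =
  (\<Sum>i<len a. ((Suc a div 2 ^ i) mod 2) * 2 ^ (len a - Suc i))"
proof -
  define x where "x = str a"
  have a: "a = nb x" by (simp add: x_def)
  have "(Suc (nb x) div 2 ^ i) mod 2 = of_bool (x ! i)" if "i < length x" for i
  proof -
    have "Suc (nb x) div 2 ^ i - 1 = 2 * nb (drop (Suc i) x) + 1 + of_bool (x ! i)"
      unfolding nb_drop using that by (simp flip: Cons_nth_drop_Suc)
    then have "Suc (nb x) div 2 ^ i = 2 * nb (drop (Suc i) x) + 2 + of_bool (x ! i)" by linarith
    then show ?thesis by (cases "x ! i") auto
  qed
  then show ?thesis unfolding a str_nb bval_sum[of x] by (intro sum.cong) auto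
qed

lemma prec_bval: "prec f \<Longrightarrow> prec (\<lambda>x. bval (str (f x)))"
proof -
  have "prec (\<lambda>a. bval (str a))" unfolding bval_str by (intro prec_intros prec_length)
  then show "prec f \<Longrightarrow> prec (\<lambda>x. bval (str (f x)))" by (rule prec_comp)
qed

lemma prefix_freeD: "prefix_free S \<Longrightarrow> p \<in> S \<Longrightarrow> q \<in> S \<Longrightarrow> p @ u = q @ v \<Longrightarrow> p = q"
  using prefix_same_cases[of p "p @ u" q] unfolding prefix_free_def by (metis prefixI)

text \<open>All strings of \<open>F\<close> are extended to a common length \<open>L\<close>.
  Prefix-freeness makes the sets of extensions disjoint, and there are only \<open>2 ^ L\<close>
  strings of that length.\<close>

lemma kraft:
  assumes "prefix_free S" "finite F" "F \<subseteq> S"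
  shows "(\<Sum>p\<in>F. 1 / 2 ^ length p :: real) \<le> 1"
proof -
  define L where "L = Max (insert 0 (length ` F))"
  have L: "length p \<le> L" if "p \<in> F" for p using that assms(2) by (auto simp: L_def)
  let ?all = "{s :: bitstring. length s = L}"
  let ?ext = "\<lambda>p. (\<lambda>u. p @ u) ` {u :: bitstring. length u = L - length p}"
  have fin: "finite {s :: bitstring. length s = n}" and card: "card {s :: bitstring. length s = n} = 2 ^ n" for n
    using finite_lists_length_eq[of "UNIV :: bool set" n] card_lists_length_eq[of "UNIV :: bool set" n]
    by simp_all
  have "(\<Sum>p\<in>F. 2 ^ (L - length p)) = (\<Sum>p\<in>F. card (?ext p))"
    by (intro sum.cong refl) (subst card_image, auto simp: inj_on_def card)
  also have "\<dots> = card (\<Union>p\<in>F. ?ext p)"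
  proof (rule card_UN_disjoint[symmetric])
    show "\<forall>p\<in>F. \<forall>q\<in>F. p \<noteq> q \<longrightarrow> ?ext p \<inter> ?ext q = {}"
      using prefix_freeD[OF assms(1)] assms(3) by blast
  qed (use assms fin in auto)
  also have "\<dots> \<le> card ?all"
    using L by (intro card_mono fin) auto
  finally have "(\<Sum>p\<in>F. 2 ^ (L - length p)) \<le> (2::nat) ^ L" by (simp add: card)
  then have "(\<Sum>p\<in>F. 2 ^ (L - length p)) \<le> (2::real) ^ L"
    using of_nat_mono[of "\<Sum>p\<in>F. 2 ^ (L - length p)" "2 ^ L", where 'a = real] by simp
  moreover have "(\<Sum>p\<in>F. 2 ^ (L - length p)) = (\<Sum>p\<in>F. 1 / 2 ^ length p) * (2::real) ^ L"
    unfolding sum_distrib_right using L by (intro sum.cong refl) (simp add: power_diff)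
  ultimately show ?thesis by simp
qed

section \<open>Approximating Omega from below\<close>

definition weight :: "(nat \<Rightarrow> nat) \<Rightarrow> nat \<Rightarrow> real" where
  "weight w i = of_bool (w i \<noteq> 0) / 2 ^ len (pfst i)"

definition approx :: "(nat \<Rightarrow> nat) \<Rightarrow> nat \<Rightarrow> real" where
  "approx w e = (\<Sum>i<e. weight w i)"

lemma clocked_unique:
  assumes "clocked S C" "S (prod_encode (a, t)) \<noteq> 0" "S (prod_encode (a, t')) \<noteq> 0"
  shows "t = t'"
proof -
  have "\<forall>a t t'. S (prod_encode (a, t)) \<noteq> 0 \<and> S (prod_encode (a, t')) \<noteq> 0 \<longrightarrow> t = t'"
    using assms(1) unfolding clocked_def by (elim conjE)
  from this[rule_format, OF conjI, OF assms(2,3)] show ?thesis .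
qed

text \<open>\<open>w\<close> enumerates the domain of \<open>W\<close>: index \<open>i\<close> with \<open>w i \<noteq> 0\<close> stands for the program
  \<open>str (pfst i)\<close>, of running time \<open>psnd i\<close>.\<close>

locale enumerated_computer =
  fixes W :: "bitstring \<rightharpoonup> bitstring" and w :: "nat \<Rightarrow> nat"
  assumes pf: "prefix_free (dom W)" and w: "clocked w W"
begin

lemma prec_w: "prec w" using w by (simp add: clocked_def)

lemma prec_w': "prec f \<Longrightarrow> prec (\<lambda>x. w (f x))"
  using prec_w by (rule prec_comp)

lemma pfst_inj:
  assumes "w i \<noteq> 0" "w j \<noteq> 0" "pfst i = pfst j"
  shows "i = j"
proof -
  have i: "prod_encode (pfst i, psnd i) = i" by (rule pair_collapse)
  have j: "prod_encode (pfst i, psnd j) = j" unfolding assms(3) by (rule pair_collapse)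
  have p: "psnd i = psnd j"
    by (rule clocked_unique[OF w, of "pfst i"]) (simp_all only: i j assms(1,2), simp_all)
  show ?thesis using i[unfolded p] j by (rule trans[OF sym])
qed

lemma W_iff: "W q = Some y \<longleftrightarrow> (\<exists>i. pfst i = nb q \<and> w i = Suc (nb y))"
proof -
  have "W q = Some y \<longleftrightarrow> (\<exists>t. w (prod_encode (nb q, t)) = Suc (nb y))"
    using w by (simp add: clocked_def)
  also have "\<dots> \<longleftrightarrow> (\<exists>i. pfst i = nb q \<and> w i = Suc (nb y))"
    by (metis pair_collapse pfst_pair)
  finally show ?thesis .
qed

lemma dom_index: "w i \<noteq> 0 \<Longrightarrow> str (pfst i) \<in> dom W"
proof -
  assume "w i \<noteq> 0"
  then have "w i = Suc (nb (str (w i - 1)))" by simp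
  then have "W (str (pfst i)) = Some (str (w i - 1))" unfolding W_iff by auto
  then show ?thesis by blast
qed

lemma index_dom: "q \<in> dom W \<Longrightarrow> \<exists>i. w i \<noteq> 0 \<and> pfst i = nb q"
  using W_iff by (metis domD nat.distinct(1))

lemma weight_nonneg: "0 \<le> weight w i"
  by (simp add: weight_def)

lemma approx_mono: "d \<le> e \<Longrightarrow> approx w d \<le> approx w e"
  unfolding approx_def by (intro sum_mono2) (auto simp: weight_nonneg)

lemma sum_weight:
  assumes "finite E"
  shows "sum (weight w) E = (\<Sum>p\<in>(\<lambda>i. str (pfst i)) ` {i \<in> E. w i \<noteq> 0}. 1 / 2 ^ length p)"
proof -
  have "inj_on (\<lambda>i. str (pfst i)) {i \<in> E. w i \<noteq> 0}"
    by (intro inj_onI) (metis (mono_tags, lifting) mem_Collect_eq nb_str pfst_inj)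
  then have "(\<Sum>p\<in>(\<lambda>i. str (pfst i)) ` {i \<in> E. w i \<noteq> 0}. 1 / 2 ^ length p)
      = (\<Sum>i\<in>{i \<in> E. w i \<noteq> 0}. weight w i)"
    by (subst sum.reindex) (auto intro!: sum.cong simp: weight_def)
  also have "\<dots> = sum (weight w) E"
    using assms by (intro sum.mono_neutral_left) (auto simp: weight_def)
  finally show ?thesis ..
qed

lemma Omega_eq: "Omega W = (\<Sum>\<^sub>\<infinity>p\<in>dom W. 1 / 2 ^ length p)"
  by (simp add: Omega_def power_int_minus divide_inverse)

lemma summable: "(\<lambda>p. 1 / 2 ^ length p :: real) summable_on dom W"
  by (rule nonneg_bdd_above_summable_on) (use kraft[OF pf] in \<open>auto intro!: bdd_aboveI[of _ 1]\<close>)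

lemma Omega_le_1: "Omega W \<le> 1"
  unfolding Omega_eq by (rule infsum_le_finite_sums[OF summable]) (rule kraft[OF pf])

lemma sum_weight_le: "finite E \<Longrightarrow> sum (weight w) E \<le> Omega W"
  unfolding Omega_eq sum_weight
  by (rule finite_sum_le_infsum[OF summable]) (use dom_index in \<open>blast | simp\<close>)+

lemma approx_le: "approx w e \<le> Omega W"
  unfolding approx_def by (rule sum_weight_le) simp

text \<open>A finite partial sum of \<open>Omega W\<close> involves finitely many programs, and all
  of these have an index below some \<open>e\<close>.\<close>

lemma approx_converges:
  assumes "r < Omega W"
  shows "\<exists>e. r < approx w e"
proof (rule ccontr)
  assume "\<not> ?thesis"
  then have le: "approx w e \<le> r" for e by (simp add: not_less)
  have "Omega W \<le> r"
    unfolding Omega_eq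
  proof (rule infsum_le_finite_sums[OF summable])
    fix F assume F: "finite F" "F \<subseteq> dom W"
    define ix where "ix q = (SOME i. w i \<noteq> 0 \<and> pfst i = nb q)" for q
    have ix: "w (ix q) \<noteq> 0 \<and> pfst (ix q) = nb q" if "q \<in> F" for q
      unfolding ix_def by (rule someI_ex) (use index_dom F that in blast)
    define e where "e = Suc (Max (insert 0 (ix ` F)))"
    have e: "ix q < e" if "q \<in> F" for q using that F by (auto simp: e_def less_Suc_eq_le)
    have "(\<Sum>p\<in>F. 1 / 2 ^ length p :: real)
        \<le> (\<Sum>p\<in>(\<lambda>i. str (pfst i)) ` {i \<in> {..<e}. w i \<noteq> 0}. 1 / 2 ^ length p)"
    proof (rule sum_mono2)
      show "F \<subseteq> (\<lambda>i. str (pfst i)) ` {i \<in> {..<e}. w i \<noteq> 0}"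
      proof
        fix q assume "q \<in> F"
        with ix e show "q \<in> (\<lambda>i. str (pfst i)) ` {i \<in> {..<e}. w i \<noteq> 0}"
          by (intro image_eqI[of _ _ "ix q"]) auto
      qed
    qed auto
    also have "\<dots> = approx w e" unfolding approx_def by (rule sum_weight[symmetric]) simp
    finally show "(\<Sum>p\<in>F. 1 / 2 ^ length p) \<le> r" using le[of e] by simp
  qed
  with assms show False by simp
qed

text \<open>The numerator of \<open>approx w e\<close> over the denominator \<open>2 ^ e\<close>.
  This denominator is large enough because a program of index \<open>i\<close> has length at most
  \<open>i\<close>.\<close>

definition approx_num :: "nat \<Rightarrow> nat" where
  "approx_num e = (\<Sum>i<e. of_bool (w i \<noteq> 0) * 2 ^ (e - len (pfst i)))"

lemma prec_approx_num: "prec f \<Longrightarrow> prec (\<lambda>x. approx_num (f x))"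
proof -
  have "prec approx_num"
    unfolding approx_num_def by (intro prec_intros prec_length prec_w')
  then show "prec f \<Longrightarrow> prec (\<lambda>x. approx_num (f x))" by (rule prec_comp)
qed

lemma length_pfst_le: "len (pfst i) \<le> i"
proof -
  have "len (pfst i) \<le> pfst i" using length_le_nb[of "str (pfst i)"] by simp
  also have "\<dots> \<le> i" using le_prod_encode_1[of "pfst i" "psnd i"] by simp
  finally show ?thesis .
qed

lemma approx_num: "approx w e = real (approx_num e) / 2 ^ e"
proof -
  have "weight w i = real (of_bool (w i \<noteq> 0) * 2 ^ (e - len (pfst i))) / 2 ^ e" if "i < e" for i
  proof -
    have "(2::real) ^ (e - len (pfst i)) = 2 ^ e / 2 ^ len (pfst i)"
      using length_pfst_le[of i] that by (simp add: power_diff)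
    then show ?thesis by (simp add: weight_def)
  qed
  then show ?thesis
    unfolding approx_def approx_num_def of_nat_sum sum_divide_distrib by (intro sum.cong) auto
qed

text \<open>
  \<open>approx w e\<close> times \<open>2 ^ Suc l\<close>, rounded up.  As \<open>[approx w e, approx w (Suc e)]\<close> has length
  \<open>2 / 2 ^ Suc l\<close>, it contains the dyadic interval of half that length that begins here.
\<close>

definition slot :: "nat \<Rightarrow> nat" where
  "slot e = (approx_num e * 2 ^ Suc (len (pfst e)) + (2 ^ e - 1)) div 2 ^ e"

text \<open>This relation says that \<open>s\<close> is the string \<open>v\<^sub>e\<close> of the
  overview.\<close>

definition codes :: "nat \<Rightarrow> bitstring \<Rightarrow> bool" where
  "codes e s \<longleftrightarrow> w e \<noteq> 0 \<and> length s = Suc (len (pfst e)) \<and> bval s = slot e"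

lemma slot_bounds:
  fixes e :: nat
  defines "l \<equiv> len (pfst e)"
  shows "approx w e * 2 ^ Suc l \<le> slot e" "slot e < approx w e * 2 ^ Suc l + 1"
proof -
  let ?a = "approx_num e * 2 ^ Suc l"
  have s: "slot e = (?a + (2 ^ e - 1)) div 2 ^ e" by (simp add: slot_def l_def)
  have "?a + (2 ^ e - 1) = slot e * 2 ^ e + (?a + (2 ^ e - 1)) mod 2 ^ e"
    unfolding s by (simp add: mult.commute)
  moreover have "(?a + (2 ^ e - 1)) mod 2 ^ e < 2 ^ e" by simp
  moreover have "(1::nat) \<le> 2 ^ e" by simp
  ultimately have "?a \<le> slot e * 2 ^ e" "slot e * 2 ^ e < ?a + 2 ^ e" by linarith+
  then have "real ?a \<le> real (slot e * 2 ^ e)" "real (slot e * 2 ^ e) < real (?a + 2 ^ e)"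
    by (simp_all only: of_nat_le_iff of_nat_less_iff)
  then show "approx w e * 2 ^ Suc l \<le> slot e" "slot e < approx w e * 2 ^ Suc l + 1"
    unfolding approx_num by (simp_all add: field_simps)
qed

lemma codes_interval:
  assumes "w e \<noteq> 0" "length s = Suc (len (pfst e))" "bval s = slot e"
  shows "approx w e \<le> lo s" "hi s \<le> approx w (Suc e)"
proof -
  have "approx w (Suc e) = approx w e + 2 / 2 ^ length s"
    using assms by (simp add: approx_def weight_def)
  then show "approx w e \<le> lo s" "hi s \<le> approx w (Suc e)"
    using slot_bounds[of e] assms by (simp_all add: lo_def hi_def field_simps)
qed

text \<open>The rounded value \<open>slot e\<close> fits into the required number of bits because
  the whole step lies below \<open>Omega W\<close>, which is at most 1.\<close>

lemma codes_exists:
  assumes "w e \<noteq> 0"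
  shows "\<exists>s. codes e s"
proof -
  let ?l = "len (pfst e)"
  have "approx w e + 2 / 2 ^ Suc ?l = approx w (Suc e)"
    using assms by (simp add: approx_def weight_def)
  also have "\<dots> \<le> 1" using approx_le[of "Suc e"] Omega_le_1 by simp
  finally have "approx w e * 2 ^ Suc ?l + 2 \<le> 2 ^ Suc ?l" by (simp add: field_simps)
  then have "real (slot e) < real (2 ^ Suc ?l)" using slot_bounds(2)[of e] by simp
  then have "slot e < 2 ^ Suc ?l" by (simp only: of_nat_less_iff)
  then show ?thesis using bval_surj[of "slot e" "Suc ?l"] assms by (auto simp: codes_def)
qed

text \<open>The steps \<open>[approx w e, approx w (Suc e)]\<close> of different indices overlap in
  at most a point, whereas the interval of an extension has positive length and would lie in both.
  Within one step the length is fixed.\<close>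

lemma codes_prefix:
  assumes "codes d s" "codes e (s @ u)"
  shows "d = e \<and> u = []"
proof -
  have c: "approx w d \<le> lo s" "hi s \<le> approx w (Suc d)"
    "approx w e \<le> lo (s @ u)" "hi (s @ u) \<le> approx w (Suc e)"
    using assms codes_interval by (auto simp: codes_def)
  have "d = e"
  proof (cases d e rule: linorder_cases)
    case less
    then have "approx w (Suc d) \<le> approx w e" by (intro approx_mono) simp
    with c hi_append[of s u] lo_less_hi[of "s @ u"] show ?thesis by linarith
  next
    case greater
    then have "approx w (Suc e) \<le> approx w d" by (intro approx_mono) simp
    with c lo_append[of s u] lo_less_hi[of "s @ u"] show ?thesis by linarith
  qed
  with assms show ?thesis by (auto simp: codes_def)
qed

end

section \<open>Randomness of Omega\<close>

text \<open>The code of the self-delimiting string \<open>1 ^ n 0 x\<close> with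
  \<open>a = nb x\<close>.\<close>

definition mark :: "nat \<Rightarrow> nat \<Rightarrow> nat" where
  "mark n a = 2 ^ Suc n - 2 + 2 ^ n * (2 * a + 1)"

lemma nb_replicate: "nb (replicate n True) = 2 ^ Suc n - 2"
proof -
  have "nb (replicate n True) + 2 = 2 ^ Suc n" by (induction n) auto
  then show ?thesis by simp
qed

lemma nb_mark: "nb (replicate n True @ False # x) = mark n (nb x)"
  by (simp add: nb_append nb_replicate mark_def)

lemma prec_mark: "prec f \<Longrightarrow> prec g \<Longrightarrow> prec (\<lambda>x. mark (f x) (g x))"
  unfolding mark_def by (intro prec_intros)

lemma mark_eq: "nb x = mark n (nb y) \<longleftrightarrow> x = replicate n True @ False # y"
  by (simp flip: nb_mark add: nb_inj)

lemma replicate_mark_inj: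
  "replicate m True @ False # x = replicate n True @ False # y \<Longrightarrow> m = n \<and> x = y"
proof (induction m arbitrary: n)
  case 0
  then show ?case by (cases n) auto
next
  case (Suc m)
  then show ?case by (cases n) auto
qed

text \<open>The strings \<open>1 ^ n 0\<close> are prefix-free, so any primitive recursive sequence
  of outputs can be attached to them; the search parameter is \<open>n\<close> itself.\<close>

lemma ones_computer:
  assumes "prec g"
  shows "\<exists>T. computer T \<and> (\<forall>n. T (replicate n True @ [False]) = Some (str (g n)))"
proof -
  define S where "S e = (if pfst e = mark (psnd e) 0 then Suc (g (psnd e)) else 0)" for e
  define T where "T x = search S (nb x)" for x
  have m: "nb x = mark n 0 \<longleftrightarrow> x = replicate n True @ [False]" for x n
    using mark_eq[of x n "[]"] by simp
  have S: "S (prod_encode (nb x, n)) = (if x = replicate n True @ [False] then Suc (g n) else 0)" for x n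
    unfolding S_def pfst_pair psnd_pair m ..
  have Some: "\<exists>n. x = replicate n True @ [False] \<and> nb y = g n" if x: "T x = Some y" for x y
  proof -
    obtain n where "S (prod_encode (nb x, n)) = Suc (nb y)"
      using search_Some x unfolding T_def by blast
    then show ?thesis unfolding S by (intro exI[of _ n]) (simp split: if_splits)
  qed
  have "T (replicate n True @ [False]) = Some (str (g n))" for n
  proof -
    have "S (prod_encode (nb (replicate n True @ [False]), n)) \<noteq> 0" unfolding S by simp
    then obtain y where y: "T (replicate n True @ [False]) = Some y"
      using search_defined unfolding T_def by blast
    then obtain k where k: "replicate n True @ [False] = replicate k True @ [False]" "nb y = g k"
      using Some by blast
    then have "n = k" using replicate_mark_inj by blast
    then have "y = str (g n)" using k(2) str_nb by metis
    with y show ?thesis by simp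
  qed
  moreover have "partial_recursive T"
    unfolding T_def S_def
    by (intro partial_recursive_search prec_intros prec_mark prec_comp[OF assms])
  moreover have "prefix_free (dom T)"
    unfolding prefix_free_def prefix_def
  proof (intro ballI impI)
    fix p q assume "p \<in> dom T" "q \<in> dom T" "\<exists>u. q = p @ u"
    then obtain m n u where p: "p = replicate m True @ [False]" and q: "q = replicate n True @ [False]"
      and u: "q = p @ u"
      using Some by blast
    have "replicate m True @ False # u = replicate n True @ False # []"
      using u unfolding p q by simp
    then have "m = n" using replicate_mark_inj by blast
    then show "p = q" unfolding p q by simp
  qed
  ultimately show ?thesis unfolding computer_def by blast
qed

text \<open>The computer that maps each \<open>1 ^ n 0\<close> to itself has infinitely many
  outputs, and an optimal computer has to produce all of them.\<close>

lemma infinite_dom: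
  assumes "optimal_computer W"
  shows "infinite (dom W)"
proof
  assume fin: "finite (dom W)"
  have "prec (\<lambda>n. mark n 0)" by (intro prec_mark prec_intros)
  then obtain T where T: "computer T" "\<And>n. T (replicate n True @ [False]) = Some (str (mark n 0))"
    using ones_computer by blast
  have "W ` dom W \<supseteq> range (\<lambda>n. Some (str (mark n 0)))"
  proof clarify
    fix n
    have "replicate n True @ [False] \<in> dom T" using T(2) by blast
    then obtain q where "W q = T (replicate n True @ [False])"
      using assms T(1) unfolding optimal_computer_def by blast
    then show "Some (str (mark n 0)) \<in> W ` dom W" using T(2) by (metis domI imageI)
  qed
  moreover have "inj (\<lambda>n. Some (str (mark n 0)))"
  proof (rule injI)
    fix m n assume "Some (str (mark m 0)) = Some (str (mark n 0))"
    then have "nb (str (mark m 0)) = nb (str (mark n 0))" by simp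
    then have "(3::nat) * 2 ^ m - 2 = 3 * 2 ^ n - 2" by (simp add: mark_def)
    moreover have "(1::nat) \<le> 2 ^ m" "(1::nat) \<le> 2 ^ n" by simp_all
    ultimately have "(2::nat) ^ m = 2 ^ n" by linarith
    then show "m = n" by simp
  qed
  ultimately have "finite (UNIV :: nat set)"
    using fin by (meson finite_imageD finite_imageI finite_subset)
  then show False by simp
qed

context enumerated_computer
begin

lemma approx_less:
  assumes "infinite (dom W)"
  shows "approx w e < Omega W"
proof -
  have "dom W \<subseteq> (\<lambda>i. str (pfst i)) ` {i. w i \<noteq> 0}"
  proof
    fix q assume "q \<in> dom W"
    then obtain i where "w i \<noteq> 0" "pfst i = nb q" using index_dom by blast
    then show "q \<in> (\<lambda>i. str (pfst i)) ` {i. w i \<noteq> 0}" by (intro image_eqI[of _ _ i]) auto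
  qed
  then have "infinite {i. w i \<noteq> 0}" using assms finite_surj by blast
  then have "\<exists>i>e. i \<in> {i. w i \<noteq> 0}" unfolding infinite_nat_iff_unbounded by (rule spec)
  then obtain i where i: "i > e" "w i \<noteq> 0" by blast
  have "approx w e \<le> approx w i" using i by (intro approx_mono) simp
  also have "\<dots> < approx w (Suc i)" using i by (simp add: approx_def weight_def)
  also have "\<dots> \<le> Omega W" by (rule approx_le)
  finally show ?thesis .
qed

text \<open>The computer \<open>C\<close> of the overview. The witness gives the tail
  \<open>u\<close>, the index \<open>t\<close> of \<open>z\<close> in the enumeration of
  \<open>dom T\<close>, and the step \<open>i\<close> whose string is \<open>T z\<close> followed by
  \<open>u\<close>. The output \<open>1 ^ N 0 x\<close> is longer than all outputs of
  \<open>W\<close> with index up to \<open>i\<close>, since \<open>N\<close> is the sum of their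
  values; the input \<open>x\<close> in it keeps different inputs apart.\<close>

definition hit :: "(nat \<Rightarrow> nat) \<Rightarrow> nat \<Rightarrow> nat" where
  "hit \<tau> e = (let u = pfst (pfst (psnd e)); t = psnd (pfst (psnd e)); i = psnd (psnd e);
       v = (\<tau> t - 1) + 2 ^ len (\<tau> t - 1) * u
     in if pfst e = pfst t + 2 ^ len (pfst t) * u \<and> \<tau> t \<noteq> 0 \<and> w i \<noteq> 0 \<and>
         len v = Suc (len (pfst i)) \<and> bval (str v) = slot i
       then Suc (mark (\<Sum>j<Suc i. w j) (pfst e)) else 0)"

lemma prec_slot: "prec f \<Longrightarrow> prec (\<lambda>x. slot (f x))"
  unfolding slot_def by (intro prec_intros prec_approx_num prec_length)

lemma prec_hit: "prec \<tau> \<Longrightarrow> prec (hit \<tau>)"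
proof -
  assume "prec \<tau>"
  note \<tau> = prec_comp[OF this]
  show ?thesis
    unfolding hit_def Let_def
    by (intro prec_intros prec_mark prec_length prec_bval prec_slot \<tau> prec_w')
qed

lemma hit:
  "hit \<tau> (prod_encode (nb x, prod_encode (prod_encode (nb u, t), i))) =
    (if x = str (pfst t) @ u \<and> \<tau> t \<noteq> 0 \<and> codes i (str (\<tau> t - 1) @ u)
     then Suc (nb (replicate (\<Sum>j<Suc i. w j) True @ False # x)) else 0)"
proof -
  have app: "str (a + 2 ^ len a * nb u) = str a @ u" for a
    by (metis nb_append nb_str str_nb)
  have "nb x = pfst t + 2 ^ len (pfst t) * nb u \<longleftrightarrow> x = str (pfst t) @ u"
    by (metis app nb_str str_nb)
  then show ?thesis
    unfolding hit_def Let_def pfst_pair psnd_pair app nb_mark codes_def by (auto simp: conj_ac)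
qed

text \<open>Were there too many such \<open>z\<close>, then each of them would answer every late
  step \<open>i\<close> by a new program of \<open>W\<close>, of weight at least a fixed fraction of
  \<open>weight w i\<close>. All these programs are different and have indices beyond
  \<open>s\<close>, so their total weight would exceed what is left of
  \<open>Omega W\<close>.\<close>

lemma finitely_many_good_intervals:
  assumes opt: "optimal_computer W" and T: "computer T"
  shows "finite {z. \<exists>\<sigma>. T z = Some \<sigma> \<and> length z \<le> length \<sigma> + c \<and> lo \<sigma> < Omega W \<and> Omega W \<le> hi \<sigma>}"
    (is "finite ?G")
proof (rule ccontr)
  assume inf: "infinite ?G"
  have pT: "prefix_free (dom T)" using T by (simp add: computer_def)
  obtain \<tau> where \<tau>: "clocked \<tau> T"
    using T clocked_partial_recursive unfolding computer_def by blast
  interpret T: enumerated_computer T \<tau> using pT \<tau> by unfold_locales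
  define C where "C x = search (hit \<tau>) (nb x)" for x
  define out where "out i x = replicate (\<Sum>j<Suc i. w j) True @ False # x" for i x
  have C_Some: "\<exists>z u \<sigma> i. x = z @ u \<and> T z = Some \<sigma> \<and> codes i (\<sigma> @ u) \<and> y = out i x"
    if "C x = Some y" for x y
  proof -
    obtain e where e: "hit \<tau> (prod_encode (nb x, e)) = Suc (nb y)"
      using search_Some \<open>C x = Some y\<close> unfolding C_def by blast
    define u t i where "u = str (pfst (pfst e))" and "t = psnd (pfst e)" and "i = psnd e"
    have "e = prod_encode (prod_encode (nb u, t), i)" by (simp add: u_def t_def i_def)
    with e have h: "x = str (pfst t) @ u" "\<tau> t \<noteq> 0" "codes i (str (\<tau> t - 1) @ u)" "nb (out i x) = nb y"
      using hit[of \<tau> x u t i] by (auto simp: out_def split: if_splits)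
    have "T (str (pfst t)) = Some (str (\<tau> t - 1))"
      unfolding T.W_iff using h(2) by (intro exI[of _ t]) simp
    moreover have "y = out i x" using h(4) nb_inj by simp
    ultimately show ?thesis
      using h by (intro exI[of _ "str (pfst t)"] exI[of _ u] exI[of _ "str (\<tau> t - 1)"] exI[of _ i]) simp
  qed
  \<comment> \<open>The search may stop at another witness, but \<open>z\<close> is determined as
    \<open>dom T\<close> is prefix-free, and then \<open>i\<close> is determined by
    \<open>codes_prefix\<close>.\<close>
  have C_out: "C (z @ u) = Some (out i (z @ u))" if z: "T z = Some \<sigma>" and i: "codes i (\<sigma> @ u)" for z u \<sigma> i
  proof -
    obtain t where t: "pfst t = nb z" "\<tau> t = Suc (nb \<sigma>)" using z T.W_iff by blast
    then have "hit \<tau> (prod_encode (nb (z @ u), prod_encode (prod_encode (nb u, t), i))) \<noteq> 0"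
      unfolding hit using i by simp
    from search_defined[of "hit \<tau>" "nb (z @ u)", OF this] obtain y where y: "C (z @ u) = Some y"
      unfolding C_def by blast
    then obtain z' u' \<sigma>' i' where h: "z @ u = z' @ u'" "T z' = Some \<sigma>'" "codes i' (\<sigma>' @ u')" "y = out i' (z @ u)"
      using C_Some[OF y] by blast
    have "z = z'" using prefix_freeD[OF pT _ _ h(1)] z h(2) by blast
    then have "u = u'" "\<sigma> = \<sigma>'" using h(1,2) z by auto
    then have "i = i'" using codes_prefix[of i "\<sigma> @ u" i' "[]"] i h(3) by simp
    with y h(4) show ?thesis by simp
  qed
  have "computer C"
    unfolding computer_def
  proof
    have "prec (hit \<tau>)" using \<tau> by (intro prec_hit) (simp add: clocked_def)
    then show "partial_recursive C" unfolding C_def by (rule partial_recursive_search)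
    show "prefix_free (dom C)"
      unfolding prefix_free_def prefix_def
    proof (intro ballI impI)
      fix p q assume "p \<in> dom C" "q \<in> dom C" "\<exists>r. q = p @ r"
      then obtain r y y' where r: "q = p @ r" "C p = Some y" "C q = Some y'" by blast
      obtain z u \<sigma> i where p: "p = z @ u" "T z = Some \<sigma>" "codes i (\<sigma> @ u)" using C_Some[OF r(2)] by blast
      obtain z' u' \<sigma>' i' where q: "q = z' @ u'" "T z' = Some \<sigma>'" "codes i' (\<sigma>' @ u')"
        using C_Some[OF r(3)] by blast
      have eq: "z @ (u @ r) = z' @ u'" using p(1) q(1) r(1) by simp
      have "z = z'" using prefix_freeD[OF pT _ _ eq] p(2) q(2) by blast
      then have "u' = u @ r" "\<sigma>' = \<sigma>" using eq p(2) q(2) by auto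
      then have "r = []" using codes_prefix[of i "\<sigma> @ u" i' r] p(3) q(3) by simp
      then show "p = q" using r(1) by simp
    qed
  qed
  then obtain d where d: "\<And>p. p \<in> dom C \<Longrightarrow> \<exists>q. W q = C p \<and> length q \<le> length p + d"
    using opt unfolding optimal_computer_def by blast
  \<comment> \<open>Each element of \<open>F\<close> returns at least the fraction
    \<open>1 / 2 ^ (c + d + 1)\<close> of a weight, so together they return it twice.\<close>
  obtain F where F: "F \<subseteq> ?G" "finite F" "card F = 2 ^ (c + d + 2)"
    using infinite_arbitrarily_large[OF inf, of "2 ^ (c + d + 2)"] by blast
  define \<sigma> where "\<sigma> z = the (T z)" for z
  have G: "T z = Some (\<sigma> z)" "length z \<le> length (\<sigma> z) + c" "lo (\<sigma> z) < Omega W" "Omega W \<le> hi (\<sigma> z)"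
    if "z \<in> F" for z using F(1) that by (auto simp: \<sigma>_def)
  define start where "start z = (SOME e. lo (\<sigma> z) < approx w e)" for z
  have start: "lo (\<sigma> z) < approx w (start z)" if "z \<in> F" for z
    unfolding start_def using approx_converges[OF G(3)[OF that]] by (rule someI_ex)
  \<comment> \<open>From stage \<open>s\<close> on all approximations lie in the interval of every
    \<open>\<sigma> z\<close> with \<open>z\<close> in \<open>F\<close>, so the strings of all later
    steps extend every such \<open>\<sigma> z\<close>.\<close>
  define s where "s = Max (insert 0 (start ` F))"
  have "start z \<le> s" if "z \<in> F" for z using that F(2) by (simp add: s_def)
  then have s: "lo (\<sigma> z) < approx w s" if "z \<in> F" for z
    using start[OF that] approx_mono that by (metis less_le_trans)
  have gap: "approx w s < Omega W" by (rule approx_less[OF infinite_dom[OF opt]])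
  \<comment> \<open>Between \<open>s\<close> and \<open>s'\<close> more than half of the missing
    mass is gained, so twice this gain overshoots \<open>Omega W\<close>.\<close>
  then obtain s' where s': "(approx w s + Omega W) / 2 < approx w s'"
    using approx_converges[of "(approx w s + Omega W) / 2"] by auto
  then have "approx w s < approx w s'" using gap by (simp add: field_simps)
  then have "s < s'" using approx_mono[of s' s] by (meson not_less)
  define I where "I = {i. s \<le> i \<and> i < s' \<and> w i \<noteq> 0}"
  define P where "P z i j \<longleftrightarrow> j \<ge> s \<and> weight w i / 2 ^ (c + d + 1) \<le> weight w j \<and>
      (\<exists>u. codes i (\<sigma> z @ u) \<and> w j = Suc (nb (out i (z @ u))))" for z i j
  have ex: "\<exists>j. P z i j"
    if z: "z \<in> F" and i: "i \<in> I" for z i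
  proof -
    obtain v where v: "codes i v" using codes_exists i unfolding I_def by blast
    have iv: "approx w i \<le> lo v" "hi v \<le> approx w (Suc i)"
      using codes_interval v by (auto simp: codes_def)
    have "lo (\<sigma> z) \<le> lo v"
      using s[OF z] approx_mono[of s i] iv(1) i by (simp add: I_def)
    moreover have "hi v \<le> hi (\<sigma> z)" using iv(2) approx_le[of "Suc i"] G(4)[OF z] by linarith
    ultimately obtain u where u: "v = \<sigma> z @ u" using nested_prefix by blast
    have C: "C (z @ u) = Some (out i (z @ u))" using C_out G(1)[OF z] v u by blast
    then obtain q where q: "W q = Some (out i (z @ u))" "length q \<le> length (z @ u) + d"
      using d[of "z @ u"] by auto
    then obtain j where j: "pfst j = nb q" "w j = Suc (nb (out i (z @ u)))" using W_iff by blast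
    \<comment> \<open>The output is new: an index \<open>j\<close> up to \<open>i\<close> would have
      a value bounded by the sum in \<open>out\<close>, hence by the length and the code of the
      output, but the value is one more than this code.\<close>
    have "\<not> j \<le> i"
    proof
      assume "j \<le> i"
      then have "w j \<le> (\<Sum>j<Suc i. w j)" by (intro member_le_sum) auto
      also have "\<dots> \<le> length (out i (z @ u))" by (simp add: out_def)
      also have "\<dots> \<le> nb (out i (z @ u))" by (rule length_le_nb)
      finally show False using j(2) by simp
    qed
    then have "s \<le> j" using i by (simp add: I_def)
    \<comment> \<open>The length of \<open>q\<close> is at most
      \<open>length z + length u + d\<close>, where \<open>length z\<close> is at most
      \<open>length (\<sigma> z) + c\<close>; the string of step \<open>i\<close> has length
      \<open>Suc (len (pfst i))\<close>, which gives the 1 in \<open>c + d + 1\<close>.\<close>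
    moreover have "length q \<le> len (pfst i) + (c + d + 1)"
      using q(2) G(2)[OF z] v unfolding u codes_def by simp
    then have "1 / 2 ^ (len (pfst i) + (c + d + 1)) \<le> (1 / 2 ^ length q :: real)"
      by (intro divide_left_mono power_increasing) auto
    then have "weight w i / 2 ^ (c + d + 1) \<le> weight w j"
      using j i by (simp add: weight_def power_add I_def)
    ultimately show ?thesis
      unfolding P_def using v j(2) unfolding u by (intro exI[of _ j] conjI exI[of _ u])
  qed
  define J where "J z i = (SOME j. P z i j)" for z i
  have J: "J z i \<ge> s \<and> weight w i / 2 ^ (c + d + 1) \<le> weight w (J z i) \<and>
      (\<exists>u. codes i (\<sigma> z @ u) \<and> w (J z i) = Suc (nb (out i (z @ u))))"
    if "z \<in> F" "i \<in> I" for z i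
    using someI_ex[OF ex[OF that]] unfolding J_def[symmetric] unfolding P_def .
  have finI: "finite I" by (rule finite_subset[of _ "{..<s'}"]) (auto simp: I_def)
  \<comment> \<open>The output at index \<open>J z i\<close> contains the input
    \<open>z @ u\<close>; prefix-freeness of \<open>dom T\<close> recovers \<open>z\<close> from it,
    and then \<open>codes_prefix\<close> recovers \<open>i\<close>.\<close>
  have inj: "inj_on (\<lambda>(z, i). J z i) (F \<times> I)"
  proof (rule inj_onI, clarify)
    fix z i z' i' assume a: "z \<in> F" "i \<in> I" "z' \<in> F" "i' \<in> I" and eq: "J z i = J z' i'"
    obtain u where u: "codes i (\<sigma> z @ u)" "w (J z i) = Suc (nb (out i (z @ u)))" using J a(1,2) by blast
    obtain u' where u': "codes i' (\<sigma> z' @ u')" "w (J z' i') = Suc (nb (out i' (z' @ u')))" using J a(3,4) by blast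
    have "out i (z @ u) = out i' (z' @ u')" using u(2) u'(2) eq nb_inj by simp
    then have zu: "z @ u = z' @ u'" unfolding out_def using replicate_mark_inj by blast
    have "z = z'" using prefix_freeD[OF pT _ _ zu] G(1) a by blast
    moreover have "i = i'"
      using codes_prefix[of i "\<sigma> z @ u" i' "[]"] u(1) u'(1) zu \<open>z = z'\<close> by simp
    ultimately show "z = z' \<and> i = i'" by simp
  qed
  let ?J = "(\<lambda>(z, i). J z i) ` (F \<times> I)"
  have diff: "approx w s' - approx w s = sum (weight w) I"
  proof -
    have "approx w s' - approx w s = sum (weight w) {s..<s'}"
      unfolding approx_def lessThan_atLeast0 using \<open>s < s'\<close> by (subst sum_diff_nat_ivl) auto
    also have "\<dots> = sum (weight w) I"
      by (rule sum.mono_neutral_right) (auto simp: I_def weight_def)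
    finally show ?thesis .
  qed
  have "2 * (approx w s' - approx w s) = (\<Sum>z\<in>F. \<Sum>i\<in>I. weight w i / 2 ^ (c + d + 1))"
    using F(3) by (simp add: diff sum_divide_distrib[symmetric] power_add)
  also have "\<dots> \<le> (\<Sum>z\<in>F. \<Sum>i\<in>I. weight w (J z i))"
    using J by (intro sum_mono) blast
  also have "\<dots> = (\<Sum>p\<in>F \<times> I. weight w ((\<lambda>(z, i). J z i) p))"
    by (simp add: sum.cartesian_product case_prod_beta)
  also have "\<dots> = sum (weight w) ?J"
    by (rule sum.reindex[OF inj, unfolded comp_def, symmetric])
  finally have "approx w s + 2 * (approx w s' - approx w s) \<le> sum (weight w) {..<s} + sum (weight w) ?J"
    by (simp add: approx_def)
  also have "\<dots> = sum (weight w) ({..<s} \<union> ?J)"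
    using F(2) finI J by (intro sum.union_disjoint[symmetric]) (auto simp: not_less[symmetric])
  also have "\<dots> \<le> Omega W"
    using F(2) finI by (intro sum_weight_le) auto
  finally show False using s' by (simp add: field_simps)
qed

text \<open>If \<open>\<rho>\<close> has length \<open>k\<close> and value \<open>N - 1\<close>,
  then \<open>N / 2 ^ k\<close> is the right end of the interval of \<open>\<rho>\<close> followed
  by any number of ones. This is the reason for admitting equality on the right in
  \<open>finitely_many_good_intervals\<close>.\<close>

lemma Omega_not_dyadic:
  assumes opt: "optimal_computer W"
  shows "Omega W \<noteq> real N / 2 ^ k"
proof
  assume eq: "Omega W = real N / 2 ^ k"
  have "0 < Omega W" using approx_less[OF infinite_dom[OF opt], of 0] by (simp add: approx_def)
  then have N: "N \<ge> 1" using eq by (cases N) auto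
  have "real N = Omega W * 2 ^ k" by (simp add: eq)
  also have "\<dots> \<le> 1 * 2 ^ k" using Omega_le_1 by (intro mult_right_mono) auto
  finally have "real N \<le> real (2 ^ k)" by simp
  then have "N \<le> 2 ^ k" by (simp only: of_nat_le_iff)
  then have "N - 1 < 2 ^ k" using N by simp
  then obtain \<rho> where \<rho>: "length \<rho> = k" "bval \<rho> = N - 1" using bval_surj by blast
  have "prec (\<lambda>n. nb \<rho> + 2 ^ k * (2 ^ Suc n - 2))" by (intro prec_intros)
  then obtain T where T: "computer T"
    "\<And>n. T (replicate n True @ [False]) = Some (str (nb \<rho> + 2 ^ k * (2 ^ Suc n - 2)))"
    using ones_computer by blast
  have str: "str (nb \<rho> + 2 ^ k * (2 ^ Suc n - 2)) = \<rho> @ replicate n True" for n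
    unfolding nb_replicate[symmetric] \<rho>(1)[symmetric] nb_append[symmetric] by simp
  have T': "T (replicate n True @ [False]) = Some (\<rho> @ replicate n True)" for n
    unfolding T(2) str ..
  have ones: "bval (replicate n True) + 1 = 2 ^ n" for n by (induction n) auto
  have num: "bval (\<rho> @ replicate n True) + 1 = N * 2 ^ n" for n
    using N ones[of n] by (cases N) (auto simp: bval_append \<rho>)
  have hi: "hi (\<rho> @ replicate n True) = Omega W" for n
    using arg_cong[OF num[of n], of real] by (simp add: hi_def \<rho> eq power_add add.commute)
  have "lo (\<rho> @ replicate n True) < Omega W" for n
    using lo_less_hi[of "\<rho> @ replicate n True"] hi by simp
  then have "range (\<lambda>n. replicate n True @ [False]) \<subseteq>
      {z. \<exists>\<sigma>. T z = Some \<sigma> \<and> length z \<le> length \<sigma> + 1 \<and> lo \<sigma> < Omega W \<and> Omega W \<le> hi \<sigma>}"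
    using T' hi by (auto simp: \<rho>)
  moreover have "inj (\<lambda>n. replicate n True @ [False])"
    by (rule injI) (use replicate_mark_inj in blast)
  ultimately show False
    using finitely_many_good_intervals[OF opt T(1), of 1] finite_subset range_inj_infinite by blast
qed

text \<open>As \<open>Omega W\<close> lies strictly between 0 and 1 it is its own fractional part.
  The series places it in the closed dyadic interval, and the ends are excluded as they are
  dyadic.\<close>

lemma first_bits_Omega:
  assumes opt: "optimal_computer W"
  shows "length (first_bits (Omega W) m) = nat m"
    and "lo (first_bits (Omega W) m) < Omega W" "Omega W < hi (first_bits (Omega W) m)"
proof -
  let ?b = "binary_expansion (Omega W)" and ?k = "nat m"
  let ?s = "first_bits (Omega W) m"
  show len: "length ?s = ?k" by (simp add: first_bits_def)
  have "0 < Omega W" using approx_less[OF infinite_dom[OF opt], of 0] by (simp add: approx_def)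
  moreover have "Omega W < 1" using Omega_le_1 Omega_not_dyadic[OF opt, of 1 0] by simp
  ultimately have frac: "frac (Omega W) = Omega W" by (simp add: frac_eq)
  have "(\<lambda>i. of_bool (?b i) / 2 ^ Suc i) sums frac (Omega W)"
    using theI'[OF ex1_binary_expansion[of "Omega W"]] unfolding binary_expansion_def by (rule conjunct1)
  then have sums: "(\<lambda>i. of_bool (?b i) / 2 ^ Suc i) sums Omega W" unfolding frac .
  have part: "(\<Sum>i<k. of_bool (?b i) / 2 ^ Suc i) = lo (map ?b [0..<k])" for k
  proof (induction k)
    case (Suc k)
    then show ?case by (simp add: lo_def bval_append add_divide_distrib del: sum_of_bool_mult_eq)
  qed (simp add: lo_def)
  have tail: "(\<lambda>i. of_bool (?b (i + ?k)) / 2 ^ Suc (i + ?k)) sums (Omega W - lo ?s)"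
    using sums_split_initial_segment[OF sums, of ?k] unfolding part first_bits_def .
  have geo: "(\<lambda>i. 1 / 2 ^ Suc (i + ?k)) sums ((1/2::real) ^ ?k)"
    using sums_mult[OF power_half_series, of "(1/2) ^ ?k"]
    by (simp add: power_add power_divide mult.commute mult.left_commute)
  have "0 \<le> Omega W - lo ?s" by (rule sums_le[OF _ sums_zero tail]) simp
  moreover have "Omega W - lo ?s \<le> (1/2) ^ ?k"
    by (rule sums_le[OF _ tail geo]) (simp add: divide_right_mono)
  moreover have "hi ?s = lo ?s + (1/2) ^ ?k"
    by (simp add: hi_def lo_def len add_divide_distrib power_divide)
  moreover have "Omega W \<noteq> lo ?s" unfolding lo_def by (rule Omega_not_dyadic[OF opt])
  moreover have "Omega W \<noteq> hi ?s"
    using Omega_not_dyadic[OF opt, of "Suc (bval ?s)"] by (simp add: hi_def add.commute)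
  ultimately show "lo ?s < Omega W" "Omega W < hi ?s" by auto
qed

end

lemma interval_unique:
  assumes "length s = length t" "lo s \<le> x" "x < hi s" "lo t \<le> x" "x < hi t"
  shows "s = t"
proof (rule bval_inj[OF assms(1)])
  have "lo s < hi t" "lo t < hi s" using assms by auto
  then have "real (bval s) < real (bval t) + 1" "real (bval t) < real (bval s) + 1"
    using assms(1) by (simp_all add: lo_def hi_def divide_less_cancel)
  then show "bval s = bval t" by linarith
qed

lemma nb_unary: "nb (unary n) = 2 ^ Suc n - 2"
  by (simp add: unary_def nb_replicate)

lemma length_le_iff: "length x \<le> n \<longleftrightarrow> nb x < 2 ^ Suc n - 1"
proof
  assume "length x \<le> n"
  then have "(2::nat) ^ Suc (length x) \<le> 2 ^ Suc n" by (intro power_increasing) auto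
  with nb_bounds(2)[of x] show "nb x < 2 ^ Suc n - 1" by linarith
next
  assume "nb x < 2 ^ Suc n - 1"
  then have "(2::nat) ^ length x < 2 ^ Suc n" using nb_bounds(1)[of x] by simp
  then have "length x < Suc n" by (rule power_less_imp_less_exp[rotated]) simp
  then show "length x \<le> n" by simp
qed

section \<open>Dom V and the initial segments of Omega\<close>

lemma enumerated_computer_exists:
  assumes "optimal_computer U"
  shows "\<exists>u. enumerated_computer U u"
proof -
  obtain u where "clocked u U"
    using assms clocked_partial_recursive unfolding optimal_computer_def computer_def by blast
  then have "enumerated_computer U u"
    using assms by unfold_locales (simp add: optimal_computer_def computer_def)
  then show ?thesis by blast
qed

section \<open>Bounded f: the last enumerated program in place of the oracle\<close>

context enumerated_computer
begin

definition enumerated_before :: "nat \<Rightarrow> nat \<Rightarrow> nat" where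
  "enumerated_before e n =
     (\<Sum>p<2 ^ Suc n - 1. 2 ^ p * of_bool (\<exists>j<Suc e. pfst j = p \<and> w j \<noteq> 0))"

lemma prec_enumerated_before: "prec f \<Longrightarrow> prec g \<Longrightarrow> prec (\<lambda>x. enumerated_before (f x) (g x))"
proof -
  assume fg: "prec f" "prec g"
  show ?thesis
    unfolding enumerated_before_def
    by (intro prec_intros prec_w' prec_comp[OF fg(1)] prec_comp[OF fg(2)] fg)
qed

lemma member_enumerated_before:
  "member (enumerated_before e n) (nb s) \<longleftrightarrow> length s \<le> n \<and> (\<exists>j\<le>e. pfst j = nb s \<and> w j \<noteq> 0)"
  unfolding enumerated_before_def member_sum length_le_iff by (simp only: less_Suc_eq_le)

text \<open>Only finitely many indices belong to programs of length at most \<open>n\<close>, and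
  \<open>q\<close> ensures that there is one. At the largest of them the restricted domain is
  complete.\<close>

lemma last_enumerated:
  assumes "q \<in> dom W" "length q \<le> n"
  shows "\<exists>e. w e \<noteq> 0 \<and> len (pfst e) \<le> n \<and>
    (\<forall>s. s \<in> restrict_length (dom W) (int n) \<longleftrightarrow> member (enumerated_before e n) (nb s))"
proof -
  define J where "J = {j. w j \<noteq> 0 \<and> len (pfst j) \<le> n}"
  have "inj_on pfst J" by (rule inj_onI, rule pfst_inj) (auto simp: J_def)
  moreover have "pfst ` J \<subseteq> {..<2 ^ Suc n - 1}"
  proof
    fix p assume "p \<in> pfst ` J"
    then have "len p \<le> n" by (auto simp: J_def)
    then show "p \<in> {..<2 ^ Suc n - 1}" unfolding length_le_iff nb_str lessThan_iff .
  qed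
  ultimately have fin: "finite J" by (meson finite_lessThan finite_subset inj_on_finite)
  obtain j where "w j \<noteq> 0" "pfst j = nb q" using index_dom assms by blast
  then have ne: "J \<noteq> {}" using assms(2) by (auto simp: J_def)
  define e where "e = Max J"
  have e: "e \<in> J" "\<And>j. j \<in> J \<Longrightarrow> j \<le> e" unfolding e_def using fin ne by auto
  have "s \<in> restrict_length (dom W) (int n) \<longleftrightarrow> member (enumerated_before e n) (nb s)" for s
  proof
    assume "s \<in> restrict_length (dom W) (int n)"
    then have s: "s \<in> dom W" "length s \<le> n" by (auto simp: restrict_length_def)
    then obtain j where j: "w j \<noteq> 0" "pfst j = nb s" using index_dom by blast
    then have "j \<in> J" using s by (simp add: J_def)
    with j s e(2) show "member (enumerated_before e n) (nb s)"
      unfolding member_enumerated_before by blast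
  next
    assume "member (enumerated_before e n) (nb s)"
    then obtain j where "length s \<le> n" "pfst j = nb s" "w j \<noteq> 0"
      unfolding member_enumerated_before by blast
    with dom_index[of j] show "s \<in> restrict_length (dom W) (int n)"
      by (simp add: restrict_length_def)
  qed
  with e(1) show ?thesis by (auto simp: J_def)
qed

end

text \<open>The witness is the index \<open>e\<close> of a program \<open>p\<close>, the number
  \<open>i\<close> and a running time for the machine with clock \<open>\<mu>\<close>. The input
  \<open>p 1 ^ i 0\<close> determines \<open>n\<close> as the length of \<open>p\<close> plus
  \<open>i\<close>, and \<open>p\<close> tells how far to enumerate; \<open>2 ^ Suc n - 2\<close> is
  the code of \<open>unary n\<close>.\<close>

definition last_clock :: "(nat \<Rightarrow> nat) \<Rightarrow> (nat \<Rightarrow> nat) \<Rightarrow> nat \<Rightarrow> nat" where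
  "last_clock v \<mu> x = (let e = pfst (pfst (psnd x)); i = psnd (pfst (psnd x));
       n = len (pfst e) + i
     in if v e \<noteq> 0 \<and> pfst x = pfst e + 2 ^ len (pfst e) * mark i 0
       then \<mu> (prod_encode (prod_encode (2 ^ Suc n - 2, enumerated_computer.enumerated_before v e n),
         psnd (psnd x)))
       else 0)"

lemma last_clock:
  "last_clock v \<mu> (prod_encode (nb z, prod_encode (prod_encode (e, i), t))) =
    (if v e \<noteq> 0 \<and> z = str (pfst e) @ replicate i True @ [False]
     then \<mu> (prod_encode (prod_encode (nb (unary (len (pfst e) + i)),
       enumerated_computer.enumerated_before v e (len (pfst e) + i)), t))
     else 0)"
proof -
  have "mark i 0 = nb (replicate i True @ [False])" using nb_mark[of i "[]"] by simp
  then have "pfst e + 2 ^ len (pfst e) * mark i 0 = nb (str (pfst e) @ replicate i True @ [False])"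
    using nb_append[of "str (pfst e)"] by simp
  then have "nb z = pfst e + 2 ^ len (pfst e) * mark i 0 \<longleftrightarrow>
      z = str (pfst e) @ replicate i True @ [False]"
    by (simp only: nb_inj)
  then show ?thesis
    unfolding last_clock_def Let_def pfst_pair psnd_pair nb_unary by (simp only:)
qed

lemma not_computable_infinitely_often:
  assumes V: "optimal_computer V" and W: "optimal_computer W" and M: "oracle_machine M"
    and f: "\<And>n. n \<ge> 1 \<Longrightarrow> f n \<le> b"
  shows "finite {n. n \<ge> 1 \<and> run M (restrict_length (dom V) (int n)) (unary n)
    = Some (first_bits (Omega W) (int n - int (f n) - int c))}"
    (is "finite ?N")
proof (rule ccontr)
  assume inf: "infinite ?N"
  obtain v where "enumerated_computer V v" using enumerated_computer_exists[OF V] by blast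
  then interpret V: enumerated_computer V v .
  obtain w where "enumerated_computer W w" using enumerated_computer_exists[OF W] by blast
  then interpret W: enumerated_computer W w .
  define \<mu> where "\<mu> = clock M"
  have \<mu>_prec: "prec \<mu>" unfolding \<mu>_def by (rule prec_clock[OF M])
  have \<mu>_unique: "t = t'" if "\<mu> (prod_encode (prod_encode (a, D), t)) \<noteq> 0"
    "\<mu> (prod_encode (prod_encode (a, D), t')) \<noteq> 0" for a D t t'
    using clock_Suc_iff(1)[OF M, of "{s. member D (nb s)}" D "str a" t t'] that
    unfolding \<mu>_def by simp
  have \<mu>_run: "run M A x = Some y \<longleftrightarrow> (\<exists>t. \<mu> (prod_encode (prod_encode (nb x, D), t)) = Suc (nb y))"
    if "\<forall>s. s \<in> A \<longleftrightarrow> member D (nb s)" for A D x y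
    unfolding \<mu>_def using that[rule_format] by (rule clock_Suc_iff(2)[OF M])
  define T where "T z = search (last_clock v \<mu>) (nb z)" for z
  have T_Some: "\<exists>e i t. z = str (pfst e) @ replicate i True @ [False] \<and> v e \<noteq> 0 \<and>
      \<mu> (prod_encode (prod_encode (nb (unary (len (pfst e) + i)),
        V.enumerated_before e (len (pfst e) + i)), t)) = Suc (nb y)"
    if z: "T z = Some y" for z y
  proof -
    obtain x where x: "last_clock v \<mu> (prod_encode (nb z, x)) = Suc (nb y)"
      using search_Some z unfolding T_def by blast
    define e i t where "e = pfst (pfst x)" and "i = psnd (pfst x)" and "t = psnd x"
    have "x = prod_encode (prod_encode (e, i), t)" by (simp add: e_def i_def t_def)
    with x show ?thesis
      using last_clock[of v \<mu> z e i t] by (intro exI[of _ e] exI[of _ i] exI[of _ t]) (simp split: if_splits)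
  qed
  \<comment> \<open>The program is delimited by the prefix-freeness of \<open>dom V\<close>, the
    number \<open>i\<close> by the final 0; hence the domain of \<open>T\<close> is
    prefix-free.\<close>
  have decode: "p = p' \<and> i = i' \<and> u = []"
    if "p \<in> dom V" "p' \<in> dom V"
      and eq: "(p @ replicate i True @ [False]) @ u = p' @ replicate i' True @ [False]" for p p' i i' u
  proof -
    have "p @ (replicate i True @ False # u) = p' @ (replicate i' True @ False # [])" using eq by simp
    then have "p = p'" using prefix_freeD[OF V.pf that(1,2)] by blast
    moreover from this have "replicate i True @ False # u = replicate i' True @ False # []" using eq by simp
    ultimately show ?thesis using replicate_mark_inj by blast
  qed
  have "computer T"
    unfolding computer_def
  proof
    have "prec (last_clock v \<mu>)"
      unfolding last_clock_def Let_def
      by (intro prec_intros V.prec_w' prec_length prec_mark V.prec_enumerated_before prec_comp[OF \<mu>_prec])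
    then show "partial_recursive T" unfolding T_def by (rule partial_recursive_search)
    show "prefix_free (dom T)"
      unfolding prefix_free_def prefix_def
    proof (intro ballI impI)
      fix p q assume "p \<in> dom T" "q \<in> dom T" "\<exists>u. q = p @ u"
      then obtain u y y' where u: "q = p @ u" "T p = Some y" "T q = Some y'" by blast
      obtain d i where p: "p = str (pfst d) @ replicate i True @ [False]" "v d \<noteq> 0"
        using T_Some[OF u(2)] by blast
      obtain e j where q: "q = str (pfst e) @ replicate j True @ [False]" "v e \<noteq> 0"
        using T_Some[OF u(3)] by blast
      have "u = []"
        using decode[OF V.dom_index[OF p(2)] V.dom_index[OF q(2)], of i u j] u(1) p(1) q(1) by simp
      then show "p = q" using u(1) by simp
    qed
  qed
  \<comment> \<open>The input \<open>z\<close> for \<open>n\<close> has length \<open>n + 1\<close>,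
    and its output has length at least \<open>n - b - c\<close>.\<close>
  from W.finitely_many_good_intervals[OF W this, of "b + c + 1"]
  have fin: "finite {z. \<exists>\<sigma>. T z = Some \<sigma> \<and> length z \<le> length \<sigma> + (b + c + 1) \<and>
      lo \<sigma> < Omega W \<and> Omega W \<le> hi \<sigma>}" (is "finite ?G") .
  \<comment> \<open>For \<open>n\<close> at least the length of \<open>q\<close> the restricted
    domain is nonempty, so it has a last enumerated element.\<close>
  obtain q where q: "q \<in> dom V" using infinite_dom[OF V] by fastforce
  have ex: "\<exists>z\<in>?G. length z = Suc n" if n: "n \<in> ?N" "length q \<le> n" for n
  proof -
    let ?A = "restrict_length (dom V) (int n)" and ?\<sigma> = "first_bits (Omega W) (int n - int (f n) - int c)"
    obtain e where e: "v e \<noteq> 0" "len (pfst e) \<le> n"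
      "\<forall>s. s \<in> ?A \<longleftrightarrow> member (V.enumerated_before e n) (nb s)"
      using V.last_enumerated[OF q n(2)] by blast
    define i where "i = n - len (pfst e)"
    have i: "len (pfst e) + i = n" using e(2) by (simp add: i_def)
    let ?z = "str (pfst e) @ replicate i True @ [False]"
    have "run M ?A (unary n) = Some ?\<sigma>" using n(1) by blast
    then obtain t where t: "\<mu> (prod_encode (prod_encode (nb (unary n), V.enumerated_before e n), t)) = Suc (nb ?\<sigma>)"
      using \<mu>_run[OF e(3)] by blast
    then have "last_clock v \<mu> (prod_encode (nb ?z, prod_encode (prod_encode (e, i), t))) \<noteq> 0"
      unfolding last_clock i using e(1) by simp
    from search_defined[of "last_clock v \<mu>" "nb ?z", OF this] obtain y where y: "T ?z = Some y"
      unfolding T_def by blast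
    \<comment> \<open>The search returns some witness; \<open>decode\<close> and the uniqueness of
      clocks identify it with the intended one.\<close>
    from T_Some[OF y] obtain e' i' t' where h: "?z = str (pfst e') @ replicate i' True @ [False]" "v e' \<noteq> 0"
      "\<mu> (prod_encode (prod_encode (nb (unary (len (pfst e') + i')),
        V.enumerated_before e' (len (pfst e') + i')), t')) = Suc (nb y)" by blast
    have "str (pfst e) = str (pfst e') \<and> i = i'"
      using decode[OF V.dom_index[OF e(1)] V.dom_index[OF h(2)], of i "[]" i'] h(1) by simp
    then have "pfst e = pfst e'" "i' = i" by (metis nb_str, simp)
    then have "e' = e" using V.pfst_inj e(1) h(2) by metis
    with h(3) i \<open>i' = i\<close> have h3: "\<mu> (prod_encode (prod_encode (nb (unary n), V.enumerated_before e n), t')) = Suc (nb y)"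
      by simp
    then have "t' = t" using \<mu>_unique[of "nb (unary n)" "V.enumerated_before e n" t' t] t by simp
    with h3 t nb_inj have "y = ?\<sigma>" by simp
    moreover have "length ?z = Suc n" using i by simp
    moreover have "Suc n \<le> length ?\<sigma> + (b + c + 1)"
      using W.first_bits_Omega(1)[OF W, of "int n - int (f n) - int c"] f[of n] n(1) by simp
    ultimately show ?thesis
      using y W.first_bits_Omega(2,3)[OF W, of "int n - int (f n) - int c"]
      by (intro bexI[of _ ?z]) (auto simp: less_imp_le)
  qed
  \<comment> \<open>The number \<open>n\<close> is recovered from the length of \<open>z\<close>, so
    infinitely many \<open>n\<close> would give infinitely many good intervals.\<close>
  have "Suc ` {n \<in> ?N. length q \<le> n} \<subseteq> length ` ?G"
  proof (rule image_subsetI)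
    fix n assume "n \<in> {n \<in> ?N. length q \<le> n}"
    then have "n \<in> ?N" "length q \<le> n" by blast+
    from ex[OF this] obtain z where "z \<in> ?G" "length z = Suc n" by blast
    then show "Suc n \<in> length ` ?G" by (intro image_eqI[of _ _ z]) auto
  qed
  then have "finite (Suc ` {n \<in> ?N. length q \<le> n})" using fin by (meson finite_imageI finite_subset)
  then have "finite {n \<in> ?N. length q \<le> n}" by (rule finite_imageD) simp
  then have "finite ({n \<in> ?N. length q \<le> n} \<union> {..<length q})" by simp
  then have "finite ?N" by (rule finite_subset[rotated]) auto
  with inf show False ..
qed

section \<open>Unbounded f: waiting for short programs\<close>

definition value_at :: "(nat \<Rightarrow> nat) \<Rightarrow> nat \<Rightarrow> nat" where
  "value_at \<phi> g = length (str (\<phi> (prod_encode (2 ^ Suc (pfst g) - 2, psnd g)) - 1))"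

text \<open>Here \<open>g\<close> codes a number \<open>n\<close> with a running time, and
  \<open>\<phi>\<close> is to be a clock for \<open>f\<close>. The factor 2 leaves room for the
  prefix \<open>1 ^ k 0\<close> and for the constant of optimality.\<close>

definition large :: "(nat \<Rightarrow> nat) \<Rightarrow> nat \<Rightarrow> nat \<Rightarrow> bool" where
  "large \<phi> k g \<longleftrightarrow> 1 \<le> pfst g \<and> \<phi> (prod_encode (2 ^ Suc (pfst g) - 2, psnd g)) \<noteq> 0 \<and>
     2 * k \<le> value_at \<phi> g"

text \<open>Minimising over the code \<open>g\<close> instead of \<open>n\<close> needs only a
  bounded search, although \<open>f\<close> is accessible only through its clock. The choice is
  unique, which makes \<open>n\<^sub>k\<close> a function of \<open>k\<close>.\<close>

definition first_large :: "(nat \<Rightarrow> nat) \<Rightarrow> nat \<Rightarrow> nat \<Rightarrow> bool" where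
  "first_large \<phi> k g \<longleftrightarrow> large \<phi> k g \<and> (\<forall>h<g. \<not> large \<phi> k h)"

lemma prec_value_at: "prec \<phi> \<Longrightarrow> prec f \<Longrightarrow> prec (\<lambda>x. value_at \<phi> (f x))"
proof -
  assume \<phi>: "prec \<phi>" and f: "prec f"
  show ?thesis
    unfolding value_at_def by (intro prec_intros prec_length prec_comp[OF \<phi>] f)
qed

lemma decidable_large: "prec \<phi> \<Longrightarrow> prec f \<Longrightarrow> prec h \<Longrightarrow> decidable (\<lambda>x. large \<phi> (f x) (h x))"
proof -
  assume \<phi>: "prec \<phi>" and fh: "prec f" "prec h"
  show ?thesis
    unfolding large_def by (intro prec_intros prec_value_at prec_comp[OF \<phi>] \<phi> fh)
qed

lemma decidable_first_large:
  "prec \<phi> \<Longrightarrow> prec f \<Longrightarrow> prec h \<Longrightarrow> decidable (\<lambda>x. first_large \<phi> (f x) (h x))"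
proof -
  assume \<phi>: "prec \<phi>" and fh: "prec f" "prec h"
  show ?thesis
    unfolding first_large_def
    by (intro decidable_conj decidable_All decidable_not decidable_large prec_basic \<phi> fh
        prec_comp[OF fh(1)])
qed

lemma first_large_unique: "first_large \<phi> k g \<Longrightarrow> first_large \<phi> k h \<Longrightarrow> g = h"
  unfolding first_large_def by (meson linorder_neqE_nat)

text \<open>The sum of the (codes of the) outputs of all programs in the oracle set bounds the
  lengths of these outputs, which is all that is needed to approximate \<open>Omega W\<close>.\<close>

definition late :: "(nat \<Rightarrow> nat) \<Rightarrow> nat \<Rightarrow> nat \<Rightarrow> nat \<Rightarrow> nat" where
  "late v a D s = (\<Sum>p<Suc a. \<Sum>t<s. of_bool (member D p) * v (prod_encode (p, t)))"

lemma prec_late: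
  assumes "prec v" "prec f" "prec g" "prec h"
  shows "prec (\<lambda>x. late v (f x) (g x) (h x))"
proof -
  have "prec (\<lambda>z. late v (pfst z) (pfst (psnd z)) (psnd (psnd z)))"
    unfolding late_def by (intro prec_intros decidable_member prec_comp[OF assms(1)])
  from prec_comp[OF this prec_pair[OF assms(2) prec_pair[OF assms(3,4)]]] show ?thesis by simp
qed

lemma interval_exists:
  assumes "0 \<le> x" "x < 1"
  shows "\<exists>r. length r = m \<and> lo r \<le> x \<and> x < hi r"
proof -
  define N where "N = nat \<lfloor>x * 2 ^ m\<rfloor>"
  have N: "real N \<le> x * 2 ^ m" "x * 2 ^ m < real N + 1"
    using assms by (auto simp: N_def of_nat_nat)
  have "x * 2 ^ m < 1 * 2 ^ m" using assms by (intro mult_strict_right_mono) auto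
  with N(1) have "real N < 1 * 2 ^ m" by (rule le_less_trans)
  then have "real N < real (2 ^ m)" by simp
  then have "N < 2 ^ m" by (simp only: of_nat_less_iff)
  then obtain r where "length r = m" "bval r = N" using bval_surj by blast
  with N show ?thesis by (intro exI[of _ r]) (simp add: lo_def hi_def field_simps)
qed

context enumerated_computer
begin

text \<open>At \<open>1 ^ k @ 0 @ r\<close>, where \<open>r\<close> has the length that is wanted of the answer for the \<open>k\<close>-th
  chosen \<open>n\<close>: the index from which on the approximations to \<open>Omega W\<close> exceed \<open>lo r\<close>, in unary.\<close>

definition exceed :: "(nat \<Rightarrow> nat) \<Rightarrow> nat \<Rightarrow> nat" where
  "exceed \<phi> x = (let k = pfst (pfst (psnd x)); r = psnd (pfst (psnd x));
       g = pfst (psnd (psnd x)); e = psnd (psnd (psnd x))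
     in if pfst x = mark k r \<and> first_large \<phi> k g \<and> len r = pfst g - value_at \<phi> g \<and>
         bval (str r) * 2 ^ e < approx_num e * 2 ^ len r
       then Suc (2 ^ Suc e - 2) else 0)"

lemma prec_exceed: "prec \<phi> \<Longrightarrow> prec (exceed \<phi>)"
proof -
  assume \<phi>: "prec \<phi>"
  show ?thesis
    unfolding exceed_def Let_def
    by (intro prec_intros prec_mark decidable_first_large prec_length prec_value_at prec_bval
        prec_approx_num \<phi>)
qed

lemma lo_less_approx: "lo r < approx w e \<longleftrightarrow> bval r * 2 ^ e < approx_num e * 2 ^ length r"
proof -
  have "lo r < approx w e \<longleftrightarrow> real (bval r * 2 ^ e) < real (approx_num e * 2 ^ length r)"
    unfolding lo_def approx_num by (simp add: field_simps)
  then show ?thesis by (simp only: of_nat_less_iff)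
qed

lemma lo_le_approx: "lo r \<le> approx w e \<longleftrightarrow> bval r * 2 ^ e \<le> approx_num e * 2 ^ length r"
proof -
  have "lo r \<le> approx w e \<longleftrightarrow> real (bval r * 2 ^ e) \<le> real (approx_num e * 2 ^ length r)"
    unfolding lo_def approx_num by (simp add: field_simps)
  then show ?thesis by (simp only: of_nat_le_iff)
qed

lemma approx_less_hi: "approx w e < hi r \<longleftrightarrow> approx_num e * 2 ^ length r < Suc (bval r) * 2 ^ e"
proof -
  have "approx w e < hi r \<longleftrightarrow> real (approx_num e * 2 ^ length r) < real (Suc (bval r) * 2 ^ e)"
    unfolding hi_def approx_num by (simp add: field_simps)
  then show ?thesis by (simp only: of_nat_less_iff)
qed

lemma exceed:
  "exceed \<phi> (prod_encode (nb x, prod_encode (prod_encode (k, nb r), prod_encode (g, e)))) =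
    (if x = replicate k True @ False # r \<and> first_large \<phi> k g \<and> length r = pfst g - value_at \<phi> g \<and>
        lo r < approx w e
     then Suc (nb (unary e)) else 0)"
  unfolding exceed_def Let_def pfst_pair psnd_pair str_nb mark_eq lo_less_approx nb_unary ..

definition exceeding :: "(nat \<Rightarrow> nat) \<Rightarrow> bitstring \<rightharpoonup> bitstring" where
  "exceeding \<phi> x = search (exceed \<phi>) (nb x)"

lemma exceeding_Some:
  assumes "exceeding \<phi> x = Some y"
  shows "\<exists>k r g e. x = replicate k True @ False # r \<and> first_large \<phi> k g \<and>
    length r = pfst g - value_at \<phi> g \<and> lo r < approx w e \<and> y = unary e"
proof -
  obtain z where z: "exceed \<phi> (prod_encode (nb x, z)) = Suc (nb y)"
    using search_Some assms unfolding exceeding_def by blast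
  define k r g e where "k = pfst (pfst z)" and "r = str (psnd (pfst z))"
    and "g = pfst (psnd z)" and "e = psnd (psnd z)"
  have "z = prod_encode (prod_encode (k, nb r), prod_encode (g, e))"
    by (simp add: k_def r_def g_def e_def)
  with z show ?thesis
    using exceed[of \<phi> x k r g e] nb_inj
    by (intro exI[of _ k] exI[of _ r] exI[of _ g] exI[of _ e]) (simp split: if_splits)
qed

lemma exceeding_defined:
  assumes "first_large \<phi> k g" "length r = pfst g - value_at \<phi> g" "lo r < approx w e"
  shows "\<exists>y. exceeding \<phi> (replicate k True @ False # r) = Some y"
proof -
  let ?x = "replicate k True @ False # r"
  have "exceed \<phi> (prod_encode (nb ?x, prod_encode (prod_encode (k, nb r), prod_encode (g, e)))) \<noteq> 0"
    unfolding exceed using assms by simp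
  from search_defined[of "exceed \<phi>" "nb ?x", OF this] show ?thesis unfolding exceeding_def .
qed

text \<open>The prefix \<open>1 ^ k 0\<close> determines \<open>k\<close>, hence \<open>g\<close>
  and the length of \<open>r\<close>; so no input in the domain properly extends another
  one.\<close>

lemma computer_exceeding:
  assumes "prec \<phi>"
  shows "computer (exceeding \<phi>)"
  unfolding computer_def
proof
  show "partial_recursive (exceeding \<phi>)"
    unfolding exceeding_def by (rule partial_recursive_search[OF prec_exceed[OF assms]])
  show "prefix_free (dom (exceeding \<phi>))"
    unfolding prefix_free_def prefix_def
  proof (intro ballI impI)
    fix p q assume "p \<in> dom (exceeding \<phi>)" "q \<in> dom (exceeding \<phi>)" "\<exists>u. q = p @ u"
    then obtain u y y' where u: "q = p @ u" "exceeding \<phi> p = Some y" "exceeding \<phi> q = Some y'" by blast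
    obtain k r g where p: "p = replicate k True @ False # r" "first_large \<phi> k g"
      "length r = pfst g - value_at \<phi> g" using exceeding_Some[OF u(2)] by blast
    obtain l s h where q: "q = replicate l True @ False # s" "first_large \<phi> l h"
      "length s = pfst h - value_at \<phi> h" using exceeding_Some[OF u(3)] by blast
    have "replicate k True @ False # (r @ u) = replicate l True @ False # s"
      using u(1) unfolding p(1) q(1) by simp
    then have kl: "k = l" and s: "s = r @ u" using replicate_mark_inj by blast+
    have "g = h" using first_large_unique p(2) q(2) unfolding kl by blast
    then have "u = []" using p(3) q(3) s by simp
    then show "p = q" using u(1) by simp
  qed
qed

text \<open>The witness consists of a running time \<open>t\<close> for \<open>f\<close>, a time
  \<open>s\<close> by which all programs in the table \<open>D\<close> have halted, and the answer
  \<open>r\<close>. The table tells which programs to wait for; \<open>T\<close> is then so late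
  that, at suitable inputs, the interval around \<open>approx w T\<close> of the wanted length is
  already the one around \<open>Omega W\<close>.\<close>

definition read_off :: "(nat \<Rightarrow> nat) \<Rightarrow> (nat \<Rightarrow> nat) \<Rightarrow> nat \<Rightarrow> nat" where
  "read_off v \<phi> x = (let a = pfst (pfst x); D = psnd (pfst x);
       t = pfst (pfst (psnd x)); s = psnd (pfst (psnd x)); r = psnd (psnd x); T = late v a D s
     in if \<phi> (prod_encode (a, t)) \<noteq> 0 \<and>
         (\<forall>p<Suc a. member D p \<longrightarrow> (\<exists>t<s. v (prod_encode (p, t)) \<noteq> 0)) \<and>
         len r = len a - len (\<phi> (prod_encode (a, t)) - 1) \<and>
         bval (str r) * 2 ^ T \<le> approx_num T * 2 ^ len r \<and>
         approx_num T * 2 ^ len r < Suc (bval (str r)) * 2 ^ T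
       then Suc r else 0)"

lemma prec_read_off:
  assumes "prec v" "prec \<phi>"
  shows "prec (read_off v \<phi>)"
  unfolding read_off_def Let_def
  by (intro prec_intros decidable_member prec_late prec_approx_num prec_length prec_bval
      prec_comp[OF assms(1)] prec_comp[OF assms(2)] assms(1))

lemma read_off:
  "read_off v \<phi> (prod_encode (prod_encode (a, D), prod_encode (prod_encode (t, s), nb r))) =
    (if \<phi> (prod_encode (a, t)) \<noteq> 0 \<and>
         (\<forall>p<Suc a. member D p \<longrightarrow> (\<exists>t<s. v (prod_encode (p, t)) \<noteq> 0)) \<and>
         length r = len a - len (\<phi> (prod_encode (a, t)) - 1) \<and>
         lo r \<le> approx w (late v a D s) \<and> approx w (late v a D s) < hi r
     then Suc (nb r) else 0)"
  unfolding read_off_def Let_def pfst_pair psnd_pair str_nb lo_le_approx approx_less_hi ..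

end

lemma computable_infinitely_often:
  assumes V: "optimal_computer V" and W: "optimal_computer W" and f: "total_recursive_pos f"
    and unbounded: "\<And>b. \<exists>n\<ge>1. f n > b"
  shows "\<exists>M. oracle_machine M \<and> infinite {n. n \<ge> 1 \<and> run M (restrict_length (dom V) (int n)) (unary n)
    = Some (first_bits (Omega W) (int n - int (f n)))}"
proof -
  obtain v where "enumerated_computer V v" using enumerated_computer_exists[OF V] by blast
  then interpret V: enumerated_computer V v .
  obtain w where "enumerated_computer W w" using enumerated_computer_exists[OF W] by blast
  then interpret W: enumerated_computer W w .
  obtain Mf where Mf: "turing_machine Mf" "\<And>n. n \<ge> 1 \<Longrightarrow> run Mf {} (unary n) = Some (unary (f n))"
    using f by (auto simp: total_recursive_pos_def)
  have "partial_recursive (run Mf {})" unfolding partial_recursive_def using Mf(1) by blast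
  then obtain \<phi> where \<phi>: "clocked \<phi> (run Mf {})" using clocked_partial_recursive by blast
  have \<phi>_prec: "prec \<phi>" using \<phi> by (simp add: clocked_def)
  have \<phi>_iff: "run Mf {} x = Some y \<longleftrightarrow> (\<exists>t. \<phi> (prod_encode (nb x, t)) = Suc (nb y))" for x y
    using \<phi> by (simp add: clocked_def)
  have \<phi>_f: "\<exists>t. \<phi> (prod_encode (nb (unary n), t)) = Suc (nb (unary (f n)))" if "n \<ge> 1" for n
    using Mf(2)[OF that] \<phi>_iff by blast
  have \<phi>_value: "\<phi> (prod_encode (nb (unary n), t)) = Suc (nb (unary (f n)))"
    if n: "n \<ge> 1" and t: "\<phi> (prod_encode (nb (unary n), t)) \<noteq> 0" for n t
  proof -
    obtain t' where t': "\<phi> (prod_encode (nb (unary n), t')) = Suc (nb (unary (f n)))"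
      using \<phi>_f[OF n] by blast
    then have "t = t'" using clocked_unique[OF \<phi> t, of t'] by simp
    with t' show ?thesis by simp
  qed
  have len: "length (unary n) = n" for n by (simp add: unary_def)
  have val_f: "value_at \<phi> g = f (pfst g)" if "large \<phi> k g" for k g
    using that \<phi>_value[of "pfst g" "psnd g"]
    unfolding large_def value_at_def nb_unary[symmetric] by (simp add: len)
  have "\<exists>g. large \<phi> k g" for k
  proof -
    obtain n where n: "n \<ge> 1" "f n > 2 * k" using unbounded by blast
    obtain t where "\<phi> (prod_encode (nb (unary n), t)) = Suc (nb (unary (f n)))" using \<phi>_f[OF n(1)] by blast
    then have "large \<phi> k (prod_encode (n, t))"
      using n unfolding large_def value_at_def pfst_pair psnd_pair nb_unary[symmetric]
      by (simp add: len)
    then show ?thesis by blast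
  qed
  then have first: "\<exists>g. first_large \<phi> k g" for k
    unfolding first_large_def using exists_least_iff[of "large \<phi> k"] by blast
  define G where "G k = (SOME g. first_large \<phi> k g)" for k
  have G: "first_large \<phi> k (G k)" for k unfolding G_def using first by (rule someI_ex)
  define n where "n k = pfst (G k)" for k
  have n: "n k \<ge> 1" "2 * k \<le> f (n k)" for k
    using G[of k] val_f[of k "G k"] unfolding first_large_def large_def n_def by auto
  have value_G: "value_at \<phi> (G k) = f (n k)" for k
    using G[of k] val_f[of k "G k"] unfolding first_large_def n_def by auto
  have "computer (W.exceeding \<phi>)" by (rule W.computer_exceeding[OF \<phi>_prec])
  then obtain d where d: "\<And>p. p \<in> dom (W.exceeding \<phi>) \<Longrightarrow>
      \<exists>q. V q = W.exceeding \<phi> p \<and> length q \<le> length p + d"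
    using V unfolding optimal_computer_def by blast
  have "prec (W.read_off v \<phi>)" by (rule W.prec_read_off[OF V.prec_w \<phi>_prec])
  from oracle_machine_search[OF this] obtain M where M: "oracle_machine M"
    "\<And>A x. run M A x = search (W.read_off v \<phi>) (prod_encode (nb x, oracle_code A (Suc (nb x))))" by blast
  have correct: "run M (restrict_length (dom V) (int (n k))) (unary (n k))
      = Some (first_bits (Omega W) (int (n k) - int (f (n k))))" if k: "k > d" for k
  proof -
    let ?n = "n k" and ?m = "n k - f (n k)"
    let ?A = "restrict_length (dom V) (int ?n)" and ?a = "nb (unary ?n)"
    let ?D = "oracle_code ?A (Suc ?a)"
    let ?r = "first_bits (Omega W) (int ?n - int (f ?n))"
    have r: "length ?r = ?m" "lo ?r < Omega W" "Omega W < hi ?r"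
      using W.first_bits_Omega[OF W, of "int ?n - int (f ?n)"] by (simp_all add: nat_diff_distrib')
    have member: "member ?D p \<longleftrightarrow> p < Suc ?a \<and> str p \<in> dom V \<and> len p \<le> ?n" for p
      unfolding member_oracle_code restrict_length_def by auto
    have a: "Suc ?a = 2 ^ Suc ?n - 1"
    proof -
      have "(2::nat) \<le> 2 ^ Suc ?n" by simp
      then show ?thesis unfolding nb_unary by linarith
    qed
    have halts: "\<exists>t. v (prod_encode (p, t)) \<noteq> 0" if "member ?D p" for p
    proof -
      have "str p \<in> dom V" using that member by blast
      then obtain j where "v j \<noteq> 0" "pfst j = p" using V.index_dom by (metis nb_str)
      then show ?thesis by (metis pair_collapse)
    qed
    define h where "h p = (SOME t. v (prod_encode (p, t)) \<noteq> 0)" for p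
    have h: "v (prod_encode (p, h p)) \<noteq> 0" if "member ?D p" for p
      unfolding h_def using halts[OF that] by (rule someI_ex)
    \<comment> \<open>The table contains only programs in \<open>dom V\<close>, so a common bound on
      their halting times exists and the search terminates.\<close>
    define s where "s = Suc (Max (insert 0 (h ` {..<Suc ?a})))"
    have s: "h p < s" if "p < Suc ?a" for p
      using that by (simp add: s_def less_Suc_eq_le)
    obtain t where t: "\<phi> (prod_encode (?a, t)) = Suc (nb (unary (f ?n)))" using \<phi>_f[OF n(1)] by blast
    let ?T = "late v ?a ?D s"
    have "0 \<le> approx w 0" "approx w 0 \<le> approx w ?T" by (simp add: approx_def, rule W.approx_mono) simp
    moreover have "approx w ?T < 1"
      using W.approx_less[OF infinite_dom[OF W], of ?T] W.Omega_le_1 by linarith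
    ultimately obtain r0 where r0: "length r0 = ?m" "lo r0 \<le> approx w ?T" "approx w ?T < hi r0"
      using interval_exists[of "approx w ?T" ?m] by auto
    have "W.read_off v \<phi> (prod_encode (prod_encode (?a, ?D), prod_encode (prod_encode (t, s), nb r0))) \<noteq> 0"
      unfolding W.read_off using t r0 h s by (auto simp: len)
    from search_defined[of "W.read_off v \<phi>" "prod_encode (?a, ?D)", OF this]
    obtain y where y: "run M ?A (unary ?n) = Some y" unfolding M(2) by blast
    obtain z where z: "W.read_off v \<phi> (prod_encode (prod_encode (?a, ?D), z)) = Suc (nb y)"
      using search_Some y unfolding M(2) by blast
    \<comment> \<open>The search may have stopped with other times than \<open>t\<close> and
      \<open>s\<close>; what follows uses the tests that its own witness has passed.\<close>
    define t' s' r' where "t' = pfst (pfst z)" and "s' = psnd (pfst z)" and "r' = str (psnd z)"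
    let ?T' = "late v ?a ?D s'"
    have "z = prod_encode (prod_encode (t', s'), nb r')" by (simp add: t'_def s'_def r'_def)
    with z have *: "\<phi> (prod_encode (?a, t')) \<noteq> 0"
      "\<forall>p<Suc ?a. member ?D p \<longrightarrow> (\<exists>t<s'. v (prod_encode (p, t)) \<noteq> 0)"
      "length r' = ?n - len (\<phi> (prod_encode (?a, t')) - 1)"
      "lo r' \<le> approx w ?T'" "approx w ?T' < hi r'" "nb r' = nb y"
      using W.read_off[of v \<phi> ?a ?D t' s' r'] by (auto simp: len split: if_splits)
    have len_r': "length r' = ?m" using *(3) \<phi>_value[OF n(1) *(1)] by (simp add: len)
    have "r' = ?r"
    \<comment> \<open>If \<open>f\<close> exceeds \<open>n\<close> there, truncated subtraction
      makes both strings empty.\<close>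
    proof (cases "f ?n \<le> ?n")
      case False
      then show ?thesis using len_r' r(1) by simp
    next
      case True
      let ?p = "replicate k True @ False # ?r"
      obtain e0 where "lo ?r < approx w e0" using W.approx_converges[OF r(2)] by blast
      then obtain y0 where y0: "W.exceeding \<phi> ?p = Some y0"
        using W.exceeding_defined[OF G[of k], of ?r e0] r(1) value_G[of k] unfolding n_def by auto
      then obtain k' r'' e where e: "?p = replicate k' True @ False # r''" "lo r'' < approx w e" "y0 = unary e"
        using W.exceeding_Some by blast
      then have "r'' = ?r" using replicate_mark_inj by blast
      have "?p \<in> dom (W.exceeding \<phi>)" using y0 by blast
      then obtain q where q: "V q = Some (unary e)" "length q \<le> length ?p + d" using d y0 e(3) by metis
      \<comment> \<open>The length of \<open>q\<close> is at most
        \<open>k + 1 + (n k - f (n k)) + d\<close>, where \<open>f (n k)\<close> is at least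
        \<open>2 * k\<close> and \<open>k\<close> exceeds \<open>d\<close>.\<close>
      have "length q \<le> ?n" using q(2) r(1) True n(2)[of k] k by simp
      then have "nb q < Suc ?a" unfolding a by (simp only: length_le_iff)
      moreover have "q \<in> dom V" using q(1) by blast
      ultimately have mem: "member ?D (nb q)" using \<open>length q \<le> ?n\<close> unfolding member by simp
      with *(2) \<open>nb q < Suc ?a\<close> obtain u where u: "u < s'" "v (prod_encode (nb q, u)) \<noteq> 0" by blast
      obtain j where j: "pfst j = nb q" "v j = Suc (nb (unary e))" using q(1) V.W_iff by blast
      then have "prod_encode (nb q, u) = j" using V.pfst_inj[of "prod_encode (nb q, u)" j] u(2) by simp
      \<comment> \<open>The program \<open>q\<close> prints \<open>unary e\<close>, whose code is at
        least \<open>e\<close> and is counted in the sum \<open>late\<close>; so stage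
        \<open>?T'\<close> is not before stage \<open>e\<close>.\<close>
      have "e \<le> nb (unary e)" using length_le_nb[of "unary e"] by (simp add: len)
      also have "\<dots> \<le> of_bool (member ?D (nb q)) * v (prod_encode (nb q, u))"
        using mem j(2) \<open>prod_encode (nb q, u) = j\<close> by simp
      also have "\<dots> \<le> (\<Sum>t<s'. of_bool (member ?D (nb q)) * v (prod_encode (nb q, t)))"
        using u(1) by (intro member_le_sum) auto
      also have "\<dots> \<le> ?T'"
        unfolding late_def using \<open>nb q < Suc ?a\<close>
        by (intro member_le_sum[of "nb q" "{..<Suc ?a}" "\<lambda>p. \<Sum>t<s'. of_bool (member ?D p) * v (prod_encode (p, t))"]) auto
      finally have "approx w e \<le> approx w ?T'" by (rule W.approx_mono)
      then have "lo ?r \<le> approx w ?T'" using e(2) \<open>r'' = ?r\<close> by simp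
      moreover have "approx w ?T' < hi ?r" using W.approx_le[of ?T'] r(3) by linarith
      ultimately show ?thesis using interval_unique[of r' ?r "approx w ?T'"] *(4,5) len_r' r(1) by simp
    qed
    moreover have "r' = y" using *(6) nb_inj by blast
    ultimately show ?thesis using y by simp
  qed
  have "infinite {n. n \<ge> 1 \<and> run M (restrict_length (dom V) (int n)) (unary n)
    = Some (first_bits (Omega W) (int n - int (f n)))}" (is "infinite ?N")
  proof
    assume fin: "finite ?N"
    \<comment> \<open>Because \<open>f (n k)\<close> is at least \<open>2 * k\<close>, this
      \<open>n k\<close> cannot lie in a finite set on which \<open>f\<close> has the given maximum;
      the numbers \<open>n k\<close> need not be shown distinct.\<close>
    define k where "k = Suc (d + Max (insert 0 (f ` ?N)))"
    have "n k \<in> ?N" using n(1)[of k] correct[of k] by (simp add: k_def)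
    then have "f (n k) \<le> Max (insert 0 (f ` ?N))" using fin by (intro Max_ge) auto
    with n(2)[of k] show False by (simp add: k_def)
  qed
  with M(1) show ?thesis by blast
qed

theorem theorem4p1:
  fixes V W :: "bitstring \<rightharpoonup> bitstring" and f :: "nat \<Rightarrow> nat"
  assumes "optimal_computer V" and "optimal_computer W" and "total_recursive_pos f"
  shows "(\<exists>M (c::nat). oracle_machine M \<and>
            infinite {n. n \<ge> 1 \<and>
              run M (restrict_length (dom V) (int n)) (unary n)
                = Some (first_bits (Omega W) (int n - int (f n) - int c))})
         \<longleftrightarrow> \<not> bdd_above (f ` {1..})"
    (is "?L \<longleftrightarrow> _")
proof
  assume ?L
  then obtain M and c :: nat where M: "oracle_machine M"
    and inf: "infinite {n. n \<ge> 1 \<and>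
              run M (restrict_length (dom V) (int n)) (unary n)
                = Some (first_bits (Omega W) (int n - int (f n) - int c))}" by blast
  show "\<not> bdd_above (f ` {1..})"
  proof
    assume "bdd_above (f ` {1..})"
    then obtain b where "\<And>n. n \<ge> 1 \<Longrightarrow> f n \<le> b" unfolding bdd_above_def by auto
    with not_computable_infinitely_often[OF assms(1,2) M, of f b c] inf show False by blast
  qed
next
  assume "\<not> bdd_above (f ` {1..})"
  then have "\<exists>n\<ge>1. f n > b" for b unfolding bdd_above_def by (auto simp: not_le)
  \<comment> \<open>In this direction the constant \<open>c\<close> can be taken to be 0.\<close>
  from computable_infinitely_often[OF assms this] obtain M where "oracle_machine M"
    "infinite {n. n \<ge> 1 \<and> run M (restrict_length (dom V) (int n)) (unary n)
      = Some (first_bits (Omega W) (int n - int (f n) - int 0))}" by auto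
  then show ?L by blast
qed

end
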